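(* The complete bipartite graph $K_{4,4}$ does not admit a semi-regular drawing.
   Context: A drawing of a graph represents it in the plane with vertices as distinct points and edges as simple arcs joining their end-vertices, subject to: the interior of an edge contains no vertex; two edges sharing an end-vertex do not intersect (apart from that vertex); two edges with no common end-vertex intersect at most once, and if so, transversally. A drawing is semi-regular if every crossing point is a triple crossing point (exactly three edges cross there). *)

theory Defs
  imports "HOL-Analysis.Analysis" "Graph_Theory.Kuratowski"
begin

text \<open>
  As in the theory of Kuratowski subgraphs, an undirected graph is a symmetric digraph; an
  undirected edge is the two-element set of end-vertices of a pair of opposite arcs. The plane is
  the type of complex numbers, as in the library's Jordan curve theorem. A drawing consists of the
  positions \<open>pos\<close> of the vertices and, for each edge \<open>e\<close>, a simple arc \<open>\<gamma> e\<close>, whose direction of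
  traversal is immaterial.
\<close>

definition edges :: "('a, 'b) pre_digraph \<Rightarrow> 'a set set" where
  "edges G = {{u, v} | u v. (u, v) \<in> arcs_ends G}"

definition edge_interior :: "('a \<Rightarrow> complex) \<Rightarrow> ('a set \<Rightarrow> real \<Rightarrow> complex) \<Rightarrow> 'a set \<Rightarrow> complex set" where
  "edge_interior pos \<gamma> e = path_image (\<gamma> e) - pos ` e"

text \<open>
  Edges are merely continuous arcs, so transversality is the topological notion: some open
  neighbourhood of the common point is homeomorphic to the plane in such a way that the two curves
  become the two coordinate axes.
\<close>

definition meet_transversally_at :: "complex set \<Rightarrow> complex set \<Rightarrow> complex \<Rightarrow> bool" where
  "meet_transversally_at A B p \<longleftrightarrow>
    (\<exists>U h k. open U \<and> p \<in> U \<and> homeomorphism U (UNIV :: complex set) h k \<and> h p = 0 \<and>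
       h ` (A \<inter> U) = {z. Im z = 0} \<and> h ` (B \<inter> U) = {z. Re z = 0})"

definition is_drawing ::
  "('a, 'b) pre_digraph \<Rightarrow> ('a \<Rightarrow> complex) \<Rightarrow> ('a set \<Rightarrow> real \<Rightarrow> complex) \<Rightarrow> bool" where
  "is_drawing G pos \<gamma> \<longleftrightarrow>
     inj_on pos (verts G) \<and>
     (\<forall>e \<in> edges G. arc (\<gamma> e) \<and> {pathstart (\<gamma> e), pathfinish (\<gamma> e)} = pos ` e) \<and>
     (\<forall>e \<in> edges G. \<forall>v \<in> verts G. pos v \<notin> edge_interior pos \<gamma> e) \<and>
     (\<forall>e \<in> edges G. \<forall>f \<in> edges G. e \<noteq> f \<and> e \<inter> f \<noteq> {} \<longrightarrow>
        path_image (\<gamma> e) \<inter> path_image (\<gamma> f) = pos ` (e \<inter> f)) \<and>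
     (\<forall>e \<in> edges G. \<forall>f \<in> edges G. e \<inter> f = {} \<longrightarrow>
        path_image (\<gamma> e) \<inter> path_image (\<gamma> f) = {} \<or>
        (\<exists>p. path_image (\<gamma> e) \<inter> path_image (\<gamma> f) = {p} \<and>
             meet_transversally_at (path_image (\<gamma> e)) (path_image (\<gamma> f)) p))"

definition edges_through ::
  "('a, 'b) pre_digraph \<Rightarrow> ('a \<Rightarrow> complex) \<Rightarrow> ('a set \<Rightarrow> real \<Rightarrow> complex) \<Rightarrow> complex \<Rightarrow> 'a set set" where
  "edges_through G pos \<gamma> p = {e \<in> edges G. p \<in> edge_interior pos \<gamma> e}"

definition is_crossing_point ::
  "('a, 'b) pre_digraph \<Rightarrow> ('a \<Rightarrow> complex) \<Rightarrow> ('a set \<Rightarrow> real \<Rightarrow> complex) \<Rightarrow> complex \<Rightarrow> bool" where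
  "is_crossing_point G pos \<gamma> p \<longleftrightarrow>
     (\<exists>e \<in> edges_through G pos \<gamma> p. \<exists>f \<in> edges_through G pos \<gamma> p. e \<noteq> f)"

definition is_semi_regular_drawing ::
  "('a, 'b) pre_digraph \<Rightarrow> ('a \<Rightarrow> complex) \<Rightarrow> ('a set \<Rightarrow> real \<Rightarrow> complex) \<Rightarrow> bool" where
  "is_semi_regular_drawing G pos \<gamma> \<longleftrightarrow>
     is_drawing G pos \<gamma> \<and>
     (\<forall>p. is_crossing_point G pos \<gamma> p \<longrightarrow> card (edges_through G pos \<gamma> p) = 3)"

end

theory Submission
  imports Defs "HOL-Complex_Analysis.Winding_Numbers"
begin

text \<open>
  Planarise a semi-regular drawing with \<open>T\<close> triple points: a plane graph with \<open>8 + T\<close> nodes and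
  \<open>16 + 3 T\<close> segments. As \<open>K\<^sub>4\<^sub>,\<^sub>4\<close> is Eulerian, its faces have a proper 2-colouring, and counting
  the segments modulo 3 in each colour, Euler's inequality leaves room for exactly one quadrilateral of
  each colour, all other faces being triangles. At a triple point any two consecutive rays bound a common
  face, so an edge continues through it to the third ray in either direction.

  Around a vertex on neither quadrilateral the four neighbours form a wheel of triangles. If all four are
  triple points, then two edges would meet twice unless each quadrilateral contains one of the rim
  segments, and so has at least two corners at triple points. Otherwise the edges can be traced through
  the triangles nearby, and the neighbouring vertex of \<open>K\<^sub>4\<^sub>,\<^sub>4\<close> turns out to lie on both
  quadrilaterals. Counting the eight vertices against the eight corners gives the contradiction.
\<close>

text \<open>The modulus 3 comes from the triple points: \<open>T\<close> of them give
  \<open>16 + 3 T\<close> segments, which is 1 modulo 3, and every segment lies on exactly one face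
  of each colour. Hence neither colour class consists of triangles only, while Euler's inequality
  bounds the sum of (length - 3) over all faces by 2. So the excess is exactly 1 in each class.

  The obstacle is that edges are merely continuous arcs and that transversality supplies a chart for
  each pair of edges: no chart need straighten three edges at once, and no cyclic order of the rays
  at a point is given. The rotation at a node is therefore encoded by two involutions, one per
  colour: \<open>\<kappa> c p\<close> pairs the neighbours of \<open>p\<close> whose segments bound
  the same face of colour \<open>c\<close>, and turning around \<open>p\<close> means applying the
  two involutions alternately. At a triple point three such steps lead to the opposite ray. With
  this encoding the whole case analysis takes place in a finite structure that never mentions the
  plane.\<close>

hide_const (open) Digraph_Component.connected

section \<open>Arcs and sides in the plane\<close>

text \<open>Janiszewski's theorem for \<open>s \<union> t\<close> and \<open>K\<close>: they meet
  exactly in the connected set \<open>t\<close>, and \<open>y\<close>, \<open>z\<close> are joined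
  off the first set within \<open>R\<close> and off the second within \<open>U\<close>. In the
  application \<open>s\<close> is an arc with its ends on \<open>K\<close>, \<open>t\<close> an arc
  in \<open>K\<close> closing it to a Jordan curve, \<open>R\<close> one side of that curve and
  \<open>U\<close> a small ball.\<close>

lemma connected_component_near_arc:
  fixes K s t R :: "complex set"
  assumes K: "compact K" and s: "compact s" and t: "connected t" "t \<subseteq> K" "s \<inter> K \<subseteq> t"
    and R: "connected R" "R \<subseteq> - (s \<union> t)" and U: "connected U" "U \<inter> K = {}"
    and yz: "y \<in> U \<inter> R" "z \<in> U \<inter> R"
    and tc: "compact t"
  shows "connected_component (- (K \<union> s)) y z"
proof -
  have "connected_component (- ((s \<union> t) \<union> K)) y z"
  proof (rule Janiszewski)
    show "compact (s \<union> t)" using s tc by (rule compact_Un)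
    show "closed K" using K by (rule compact_imp_closed)
    have "(s \<union> t) \<inter> K = t" using t by blast
    then show "connected ((s \<union> t) \<inter> K)" using t by simp
    show "connected_component (- (s \<union> t)) y z"
      unfolding connected_component_def using R yz by blast
    show "connected_component (- K) y z"
      unfolding connected_component_def using U yz by blast
  qed
  moreover have "(s \<union> t) \<union> K = K \<union> s" using t by blast
  ultimately show ?thesis by simp
qed

text \<open>\<open>R\<close> stands for the inside or the outside of the Jordan curve formed by
  \<open>g\<close> and \<open>t\<close>. By the previous lemma the points of \<open>R\<close> in a
  small ball about an interior point of \<open>g\<close> lie in a single component; which one is
  locally constant along \<open>g\<close>, hence constant, as the interior of \<open>g\<close> is
  connected. So one side of an arc belongs to one face along its whole length, however wild the arc
  is.\<close>

lemma arc_one_side: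
  fixes g t :: "real \<Rightarrow> complex"
  assumes K: "compact K" and g: "arc g" and t: "arc t" "path_image t \<subseteq> K"
    and gK: "path_image g \<inter> K = {pathstart g, pathfinish g}"
    and ends: "pathstart t = pathfinish g" "pathfinish t = pathstart g"
    and R: "connected R" "R \<subseteq> - (path_image g \<union> path_image t)"
      "frontier R = path_image g \<union> path_image t"
  obtains D where "D \<in> components (- (K \<union> path_image g))" "D \<subseteq> R"
    "\<And>m. m \<in> path_image g - K \<Longrightarrow> m \<in> closure D \<and> (\<exists>\<delta>>0. ball m \<delta> \<inter> R \<subseteq> D)"
proof -
  let ?s = "path_image g" and ?K = "K \<union> path_image g"
  let ?i = "path_image g - K"
  have i: "?i = path_image g - {pathstart g, pathfinish g}"
    using gK by blast
  have con: "connected ?i"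
    unfolding i using arc_imp_simple_path[OF g] by (rule connected_simple_path_endless)
  have "g (1/2) \<in> ?i"
    using simple_path_endless[OF arc_imp_simple_path[OF g]] unfolding i by auto
  then obtain m0 where m0: "m0 \<in> ?i" by blast
  have clR: "m \<in> closure R" if "m \<in> ?i" for m
    using that R(3) unfolding frontier_def by auto
  have near: "\<exists>\<delta>>0. ball m \<delta> \<inter> K = {}" if m: "m \<in> ?i" for m
  proof -
    have "open (- K)" using K by (simp add: compact_imp_closed open_Compl)
    then obtain \<delta> where "\<delta> > 0" "ball m \<delta> \<subseteq> - K"
      using m unfolding open_contains_ball by auto
    then show ?thesis by blast
  qed
  have meets: "ball m \<delta> \<inter> R \<noteq> {}" if "m \<in> ?i" "\<delta> > 0" for m \<delta>
  proof -
    have "\<exists>y\<in>R. dist y m < \<delta>"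
      using clR[OF that(1)] that(2) unfolding closure_approachable by blast
    then obtain y where "y \<in> R" "dist y m < \<delta>" by blast
    then have "y \<in> ball m \<delta> \<inter> R" by (simp add: dist_commute)
    then show ?thesis by blast
  qed
  have offK: "ball m \<delta> \<inter> R \<subseteq> - ?K" if "ball m \<delta> \<inter> K = {}" for m \<delta>
    using that R(2) by blast
  have one: "\<exists>C \<in> components (- ?K). ball m \<delta> \<inter> R \<subseteq> C"
    if m: "m \<in> ?i" and d: "\<delta> > 0" "ball m \<delta> \<inter> K = {}" for m \<delta>
  proof -
    obtain y where y: "y \<in> ball m \<delta> \<inter> R" using meets[OF m d(1)] by blast
    have "ball m \<delta> \<inter> R \<subseteq> connected_component_set (- ?K) y"
    proof
      fix z assume z: "z \<in> ball m \<delta> \<inter> R"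
      have "connected_component (- (K \<union> ?s)) y z"
      proof (rule connected_component_near_arc[where t = "path_image t" and R = R and U = "ball m \<delta>"])
        show "?s \<inter> K \<subseteq> path_image t"
          using gK ends pathstart_in_path_image[of t] pathfinish_in_path_image[of t] by auto
      qed (use K g t R d y z in \<open>auto simp: arc_imp_path compact_path_image connected_path_image\<close>)
      then show "z \<in> connected_component_set (- ?K) y" by simp
    qed
    moreover have "connected_component_set (- ?K) y \<in> components (- ?K)"
      using y offK[OF d(2)] by (intro componentsI) blast
    ultimately show ?thesis by blast
  qed
  define P where "P D m \<longleftrightarrow> (\<exists>\<delta>>0. ball m \<delta> \<inter> R \<subseteq> D)" for D m
  have P_uniq: "P D x \<longleftrightarrow> D = C"
    if x: "x \<in> ?i" "x \<in> ball m \<delta>" and C: "C \<in> components (- ?K)" "ball m \<delta> \<inter> R \<subseteq> C"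
      and D: "D \<in> components (- ?K)" for D C x m \<delta>
  proof -
    obtain e where e: "e > 0" "ball x e \<subseteq> ball m \<delta>"
      using x(2) by (meson open_ball openE)
    have "P C x" unfolding P_def using e C(2) by blast
    moreover have "D = C" if PDx: "P D x"
    proof -
      obtain d where d: "d > 0" "ball x d \<inter> R \<subseteq> D" using PDx unfolding P_def by blast
      have "ball x (min d e) \<inter> R \<noteq> {}" by (rule meets[OF x(1)]) (use d e in simp)
      then obtain y where "y \<in> ball x (min d e) \<inter> R" by blast
      then have "y \<in> D" "y \<in> C" using d e C by auto
      then show ?thesis using C(1) D by (metis IntI components_nonoverlap empty_iff)
    qed
    ultimately show ?thesis by blast
  qed
  have all: "\<forall>D \<in> components (- ?K). P D m0 \<longleftrightarrow> P D m" if "m \<in> ?i" for m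
  proof (rule connected_equivalence_relation[OF con m0 that,
        where R = "\<lambda>x y. \<forall>D \<in> components (- ?K). P D x \<longleftrightarrow> P D y"])
    fix a assume a: "a \<in> ?i"
    obtain \<delta> where d: "\<delta> > 0" "ball a \<delta> \<inter> K = {}" using near[OF a] by blast
    obtain C where C: "C \<in> components (- ?K)" "ball a \<delta> \<inter> R \<subseteq> C" using one[OF a d] by blast
    show "\<exists>T. openin (top_of_set ?i) T \<and> a \<in> T \<and>
        (\<forall>x\<in>T. \<forall>D\<in>components (- ?K). P D a = P D x)"
    proof (intro exI conjI ballI)
      show "openin (top_of_set ?i) (?i \<inter> ball a \<delta>)" by (simp add: openin_open_Int)
      show "a \<in> ?i \<inter> ball a \<delta>" using a d by simp
      fix x D assume x: "x \<in> ?i \<inter> ball a \<delta>" and D: "D \<in> components (- ?K)"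
      show "P D a = P D x"
        using P_uniq[of x a \<delta> C D] P_uniq[of a a \<delta> C D] C D x a d by auto
    qed
  qed auto
  obtain \<delta> where d: "\<delta> > 0" "ball m0 \<delta> \<inter> K = {}" using near[OF m0] by blast
  obtain D where D: "D \<in> components (- ?K)" "ball m0 \<delta> \<inter> R \<subseteq> D" using one[OF m0 d] by blast
  have "P D m0" unfolding P_def using d D by blast
  then have PD: "P D m" if "m \<in> ?i" for m using all[OF that] D by blast
  show ?thesis
  proof
    show "D \<in> components (- ?K)" by fact
    show "D \<subseteq> R"
    proof (rule ccontr)
      assume "\<not> D \<subseteq> R"
      moreover have "D \<inter> R \<noteq> {}" using meets[OF m0 d(1)] D by blast
      ultimately have "D \<inter> frontier R \<noteq> {}"
        using connected_Int_frontier[OF in_components_connected[OF D(1)], of R] by blast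
      moreover have "D \<subseteq> - ?K" using D(1) by (rule in_components_subset)
      ultimately show False using R(3) t by blast
    qed
    show "m \<in> closure D \<and> (\<exists>\<delta>>0. ball m \<delta> \<inter> R \<subseteq> D)" if m: "m \<in> ?i" for m
    proof
      show ex: "\<exists>\<delta>>0. ball m \<delta> \<inter> R \<subseteq> D" using PD[OF m] unfolding P_def .
      show "m \<in> closure D"
        unfolding closure_approachable
      proof (intro allI impI)
        fix e :: real assume e: "e > 0"
        obtain \<delta> where "\<delta> > 0" "ball m \<delta> \<inter> R \<subseteq> D" using ex by blast
        then show "\<exists>y\<in>D. dist y m < e"
          using meets[OF m, of "min \<delta> e"] e by (force simp: dist_commute)
      qed
    qed
  qed
qed

text \<open>The Jordan curve theorem for \<open>g +++ t\<close>: the two faces differ because this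
  curve separates them. The arc \<open>t\<close> expresses that the ends of \<open>g\<close> are
  joined within \<open>K\<close>; along a bridge both sides would belong to the same face.\<close>

lemma arc_two_sides:
  fixes g t :: "real \<Rightarrow> complex"
  assumes K: "compact K" and g: "arc g" and t: "arc t" "path_image t \<subseteq> K"
    and gK: "path_image g \<inter> K = {pathstart g, pathfinish g}"
    and ends: "pathstart t = pathfinish g" "pathfinish t = pathstart g"
  obtains D D' where "D \<in> components (- (K \<union> path_image g))" "D' \<in> components (- (K \<union> path_image g))"
    "D \<noteq> D'" "D \<subseteq> inside (path_image (g +++ t))" "D' \<subseteq> outside (path_image (g +++ t))"
    "\<And>m. m \<in> path_image g - K \<Longrightarrow>
      m \<in> closure D \<and> m \<in> closure D' \<and> (\<exists>\<delta>>0. ball m \<delta> - path_image g \<subseteq> D \<union> D')"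
proof -
  let ?J = "path_image g \<union> path_image t"
  have J: "path_image (g +++ t) = ?J" using ends by (simp add: path_image_join)
  have "simple_path (g +++ t)"
  proof (rule simple_path_join_loop)
    show "path_image g \<inter> path_image t \<subseteq> {pathstart g, pathstart t}"
      using gK t ends by auto
  qed (use assms in auto)
  moreover have "pathfinish (g +++ t) = pathstart (g +++ t)" using ends by simp
  ultimately have *: "connected (inside ?J)" "connected (outside ?J)" "inside ?J \<inter> outside ?J = {}"
    "inside ?J \<union> outside ?J = - ?J" "frontier (inside ?J) = ?J" "frontier (outside ?J) = ?J"
    using Jordan_inside_outside[of "g +++ t"] unfolding J by auto
  then have sub: "inside ?J \<subseteq> - ?J" "outside ?J \<subseteq> - ?J" by blast+
  obtain D where D: "D \<in> components (- (K \<union> path_image g))" "D \<subseteq> inside ?J"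
      "\<And>m. m \<in> path_image g - K \<Longrightarrow> m \<in> closure D \<and> (\<exists>\<delta>>0. ball m \<delta> \<inter> inside ?J \<subseteq> D)"
    by (rule arc_one_side[OF K g t gK ends, of "inside ?J"]) (use * sub in blast)+
  obtain D' where D': "D' \<in> components (- (K \<union> path_image g))" "D' \<subseteq> outside ?J"
      "\<And>m. m \<in> path_image g - K \<Longrightarrow> m \<in> closure D' \<and> (\<exists>\<delta>>0. ball m \<delta> \<inter> outside ?J \<subseteq> D')"
    by (rule arc_one_side[OF K g t gK ends, of "outside ?J"]) (use * sub in blast)+
  show ?thesis
  proof
    show "D \<noteq> D'" using D(1,2) D'(2) *(3) in_components_nonempty[OF D(1)] by blast
    fix m assume m: "m \<in> path_image g - K"
    obtain d where d: "d > 0" "ball m d \<inter> inside ?J \<subseteq> D" using D(3)[OF m] by blast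
    obtain d' where d': "d' > 0" "ball m d' \<inter> outside ?J \<subseteq> D'" using D'(3)[OF m] by blast
    have "open (- K)" using K by (simp add: compact_imp_closed open_Compl)
    then obtain e where e: "e > 0" "ball m e \<subseteq> - K"
      using m unfolding open_contains_ball by auto
    have "ball m (min e (min d d')) - path_image g \<subseteq> D \<union> D'"
    proof
      fix z assume z: "z \<in> ball m (min e (min d d')) - path_image g"
      then have "z \<in> - ?J" using e t by auto
      then have "z \<in> inside ?J \<or> z \<in> outside ?J" using *(4) by blast
      then show "z \<in> D \<union> D'" using z d d' by auto
    qed
    then show "m \<in> closure D \<and> m \<in> closure D' \<and> (\<exists>\<delta>>0. ball m \<delta> - path_image g \<subseteq> D \<union> D')"
      using D(3)[OF m] D'(3)[OF m] d d' e by (metis min_less_iff_conj)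
  qed (use D D' J in auto)
qed

section \<open>Plane graphs whose edges are arcs, and Euler's inequality\<close>

locale plane_graph =
  fixes P :: "complex set" and A :: "complex set set"
  assumes finite_P: "finite P" and finite_A: "finite A"
    and arcs: "s \<in> A \<Longrightarrow> \<exists>g. arc g \<and> path_image g = s \<and> s \<inter> P = {pathstart g, pathfinish g}"
    and inter: "s \<in> A \<Longrightarrow> t \<in> A \<Longrightarrow> s \<noteq> t \<Longrightarrow> s \<inter> t \<subseteq> P"
begin

definition "faces = components (- (P \<union> \<Union>A))"

text \<open>Contact at an end of \<open>s\<close> does not count: a face may reach a node of
  \<open>s\<close> without lying along \<open>s\<close>.\<close>

definition "touches D s \<longleftrightarrow> closure D \<inter> (s - P) \<noteq> {}"

definition "bdry D = {s \<in> A. touches D s}"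

lemma compact_arc: "s \<in> A \<Longrightarrow> compact s"
  using arcs by (metis arc_imp_path compact_path_image)

lemma compact_sub: "B \<subseteq> A \<Longrightarrow> compact (P \<union> \<Union>B)"
proof (rule compact_Un)
  show "compact P" using finite_P by (rule finite_imp_compact)
  assume "B \<subseteq> A"
  then show "compact (\<Union>B)"
    using finite_A compact_arc by (intro compact_Union) (auto intro: finite_subset)
qed

lemma arc_Int_rest:
  assumes "s \<in> A" "B \<subseteq> A - {s}"
  shows "s \<inter> (P \<union> \<Union>B) = s \<inter> P"
  using assms inter by blast

lemma open_face_sub: "B \<subseteq> A \<Longrightarrow> D \<in> components (- (P \<union> \<Union>B)) \<Longrightarrow> open D"
  using compact_sub by (meson compact_imp_closed open_Compl open_components)

text \<open>A component inside \<open>s\<close> would have its frontier both in the graph without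
  \<open>s\<close> and in \<open>s\<close>, hence in \<open>P\<close>. The plane minus a finite set
  is connected, so the component would contain it and be unbounded, whereas \<open>s\<close> is
  compact.\<close>

lemma component_minus_arc:
  assumes B: "B \<subseteq> A" and s: "s \<in> A" "s \<notin> B" and D: "D \<in> components (- (P \<union> \<Union>B))"
  shows "D - s \<noteq> {}"
proof
  assume "D - s = {}"
  then have Ds: "D \<subseteq> s" by blast
  let ?K = "P \<union> \<Union>B"
  have "frontier D \<subseteq> ?K"
    using frontier_of_components_closed_complement D compact_sub[OF B] compact_imp_closed by blast
  moreover have "frontier D \<subseteq> s"
    using Ds compact_arc[OF s(1)]
    by (metis closure_minimal compact_imp_closed Diff_subset frontier_def order_trans)
  ultimately have fr: "frontier D \<subseteq> P" using s B inter by blast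
  have ne: "D \<noteq> {}" using D by (rule in_components_nonempty)
  have DK: "D \<subseteq> - ?K" using D by (rule in_components_subset)
  have "connected (UNIV - P)"
    by (rule connected_open_delete_finite) (use finite_P in auto)
  then have "UNIV - P \<subseteq> D"
    using connected_Int_frontier[of "UNIV - P" D] fr ne DK by blast
  then have "bounded (UNIV - P)" using Ds compact_arc[OF s(1)]
    by (meson bounded_subset compact_imp_bounded order_trans)
  then have "bounded (UNIV :: complex set)"
    using finite_P by (metis Diff_Un Diff_cancel Un_Diff_cancel2 bounded_Un finite_imp_bounded sup_top_left)
  then show False by simp
qed

text \<open>Besides the two faces along \<open>s\<close> the detour \<open>t\<close> is returned:
  the colouring needs the Jordan curve \<open>g +++ t\<close> that separates these faces.\<close>

lemma arc_sides:
  assumes B: "B \<subseteq> A" and s: "s \<in> A" "s \<notin> B"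
    and g: "arc g" "path_image g = s" "s \<inter> P = {pathstart g, pathfinish g}"
    and con: "path_component (P \<union> \<Union>B) (pathfinish g) (pathstart g)"
  obtains D D' t where "arc t" "path_image t \<subseteq> P \<union> \<Union>B" "pathstart t = pathfinish g" "pathfinish t = pathstart g"
    "D \<in> components (- (P \<union> \<Union>(insert s B)))" "D' \<in> components (- (P \<union> \<Union>(insert s B)))"
    "D \<noteq> D'" "D \<subseteq> inside (path_image (g +++ t))" "D' \<subseteq> outside (path_image (g +++ t))"
    "\<And>m. m \<in> s - P \<Longrightarrow> m \<in> closure D \<and> m \<in> closure D' \<and> (\<exists>\<delta>>0. ball m \<delta> - s \<subseteq> D \<union> D')"
proof -
  let ?K = "P \<union> \<Union>B"
  have K: "compact ?K" using B by (rule compact_sub)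
  have sK: "s \<inter> ?K = s \<inter> P" using arc_Int_rest B s by blast
  obtain p where p: "path p" "path_image p \<subseteq> ?K" "pathstart p = pathfinish g" "pathfinish p = pathstart g"
    using con unfolding path_component_def by blast
  obtain t where t: "arc t" "path_image t \<subseteq> path_image p" "pathstart t = pathfinish g" "pathfinish t = pathstart g"
    using path_contains_arc[OF p(1,3,4)] arc_distinct_ends[OF g(1)] by metis
  have e: "?K \<union> s = P \<union> \<Union>(insert s B)" by blast
  have m: "s - ?K = s - P" using sK by blast
  show ?thesis
    by (rule arc_two_sides[OF K g(1) t(1), unfolded g(2) e m])
      (use t p g sK that in auto)
qed

definition "conn B = {(x, y). x \<in> P \<and> y \<in> P \<and> path_component (P \<union> \<Union>B) x y}"

lemma equiv_conn: "equiv P (conn B)"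
  unfolding conn_def equiv_def refl_on_def sym_def trans_def
  by (auto simp: path_component_refl path_component_sym intro: path_component_trans)

lemma card_classes_less:
  assumes "equiv P R" "equiv P R'" "R \<subseteq> R'" "(a, b) \<in> R'" "(a, b) \<notin> R"
  shows "card (P // R') < card (P // R)"
proof -
  have ab: "a \<in> P" "b \<in> P" using assms unfolding equiv_def refl_on_def by blast+
  have fin: "finite (P // R)" using finite_P assms(1)
    by (simp add: quotient_def)
  define \<phi> where "\<phi> X = R' `` X" for X
  have phi: "\<phi> (R `` {x}) = R' `` {x}" if x: "x \<in> P" for x
  proof
    have "trans R'" using assms(2) by (simp add: equiv_def)
    then show "\<phi> (R `` {x}) \<subseteq> R' `` {x}"
      unfolding \<phi>_def using assms(3) by (auto dest: transD)
    have "(x, x) \<in> R" using assms(1) x by (simp add: equiv_def refl_on_def)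
    then show "R' `` {x} \<subseteq> \<phi> (R `` {x})" unfolding \<phi>_def by blast
  qed
  have im: "\<phi> ` (P // R) = P // R'" unfolding quotient_def using phi by (auto simp: image_UN)
  have "\<not> inj_on \<phi> (P // R)"
  proof
    assume inj: "inj_on \<phi> (P // R)"
    have "\<phi> (R `` {a}) = \<phi> (R `` {b})"
      using ab phi assms(2,4) by (simp add: equiv_class_eq)
    then have "R `` {a} = R `` {b}" using inj ab by (meson inj_onD quotientI)
    then show False using assms(1,5) ab by (meson eq_equiv_class)
  qed
  then show ?thesis using fin im
    by (metis card_image_le eq_card_imp_inj_on le_neq_implies_less)
qed

text \<open>Induction over the arcs, with the connectivity classes of the nodes in place of a
  connectedness assumption. An arc between two classes merges them, an arc within one class splits a
  face. The claim speaks of a finite subset of the faces because finiteness of the set of all faces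
  is only obtained later.\<close>

lemma euler_aux:
  assumes "B \<subseteq> A"
  shows "\<exists>\<D> \<subseteq> components (- (P \<union> \<Union>B)). finite \<D> \<and>
     card \<D> + card P \<ge> card B + card (P // conn B) + 1"
proof -
  have "finite B" using assms finite_A by (rule finite_subset)
  then show ?thesis using assms
  proof (induction B rule: finite_induct)
    case empty
    have "- P \<noteq> {}" using finite_P by (metis finite_compl infinite_UNIV_char_0 finite.emptyI)
    then obtain C where C: "C \<in> components (- P)"
      by (metis components_eq_empty ex_in_conv)
    have "card (P // conn {}) \<le> card P"
      using finite_P by (simp add: quotient_def UNION_singleton_eq_range card_image_le)
    then show ?case using C by (intro exI[of _ "{C}"]) auto
  next
    case (insert s B)
    let ?K = "P \<union> \<Union>B" and ?K' = "P \<union> \<Union>(insert s B)"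
    have B: "B \<subseteq> A" and s: "s \<in> A" "s \<notin> B" using insert by auto
    obtain \<D> where D: "\<D> \<subseteq> components (- ?K)" "finite \<D>"
      "card \<D> + card P \<ge> card B + card (P // conn B) + 1" using insert.IH[OF B] by blast
    obtain g where g: "arc g" "path_image g = s" "s \<inter> P = {pathstart g, pathfinish g}"
      using arcs[OF s(1)] by blast
    have sK: "s \<inter> ?K = s \<inter> P" using arc_Int_rest B s by blast
    \<comment> \<open>Every old face contains a new one. Selecting one by \<open>\<phi>\<close>
      turns the old faces into pairwise different new faces.\<close>
    have "\<exists>C. C \<in> components (- ?K') \<and> C \<subseteq> D" if D: "D \<in> components (- ?K)" for D
    proof -
      obtain z where z: "z \<in> D" "z \<notin> s" using component_minus_arc[OF B s D] by blast
      then have zK: "z \<in> - ?K'" using in_components_subset[OF D] by auto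
      let ?C = "connected_component_set (- ?K') z"
      have "?C \<subseteq> D"
        by (rule components_maximal[OF D])
          (use zK z connected_component_subset[of "- ?K'" z] in \<open>auto intro: connected_component_refl\<close>)
      then show ?thesis using zK by (auto intro!: exI[of _ ?C] componentsI)
    qed
    then obtain \<phi> where \<phi>: "\<And>D. D \<in> components (- ?K) \<Longrightarrow> \<phi> D \<in> components (- ?K') \<and> \<phi> D \<subseteq> D"
      by metis
    have disj: "D = E" if "D \<in> components (- ?K)" "E \<in> components (- ?K)" "X \<subseteq> D" "X \<subseteq> E" "X \<noteq> {}" for D E X
      using that by (metis components_nonoverlap disjoint_iff subset_empty subsetD ex_in_conv)
    have inj: "inj_on \<phi> \<D>"
    proof (rule inj_onI)
      fix D E assume "D \<in> \<D>" "E \<in> \<D>" "\<phi> D = \<phi> E"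
      then show "D = E" using \<phi> D(1) disj[of D E "\<phi> D"] in_components_nonempty by (metis subsetD)
    qed
    have cards: "card (insert s B) = card B + 1" using insert by simp
    show ?case
    proof (cases "path_component ?K (pathfinish g) (pathstart g)")
      case False
      have "conn B \<subseteq> conn (insert s B)"
        unfolding conn_def by (auto intro: path_component_of_subset[rotated])
      moreover have "(pathfinish g, pathstart g) \<notin> conn B" using False unfolding conn_def by simp
      moreover have "(pathfinish g, pathstart g) \<in> conn (insert s B)"
      proof -
        have "path_component ?K' (pathstart g) (pathfinish g)"
          unfolding path_component_def using g(1,2) by (intro exI[of _ g]) (auto simp: arc_imp_path)
        then show ?thesis unfolding conn_def using g(3) by (auto simp: path_component_sym)
      qed
      ultimately have "card (P // conn (insert s B)) < card (P // conn B)"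
        using card_classes_less[OF equiv_conn equiv_conn] by metis
      moreover have "card (\<phi> ` \<D>) = card \<D>" using inj by (rule card_image)
      ultimately show ?thesis using D \<phi> cards
        by (intro exI[of _ "\<phi> ` \<D>"]) auto
    next
      case True
      obtain E E' where E: "E \<in> components (- ?K')" "E' \<in> components (- ?K')" "E \<noteq> E'"
        "\<And>m. m \<in> s - P \<Longrightarrow> m \<in> closure E \<and> m \<in> closure E'"
        using arc_sides[OF B s g True] by metis
      have "s - P = g ` {0<..<1}"
        using simple_path_endless[OF arc_imp_simple_path[OF g(1)]] g by blast
      then obtain m where m: "m \<in> s - P" by (metis dense equals0D greaterThanLessThan_iff imageI zero_less_one)
      have "m \<in> - ?K" using m sK by blast
      \<comment> \<open>\<open>W\<close> is the old face that contains the interior point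
        \<open>m\<close> of \<open>s\<close>. Both new faces along \<open>s\<close> lie in
        \<open>W\<close>, but \<open>\<phi>\<close> selects only one face inside \<open>W\<close>;
        so at least one of them is additional.\<close>
      then obtain W where W: "W \<in> components (- ?K)" "m \<in> W"
        by (metis Union_components UnionE)
      have opW: "open W" using open_face_sub[OF B W(1)] .
      have inW: "X \<subseteq> W" if X: "X \<in> components (- ?K')" "m \<in> closure X" for X
      proof (rule components_maximal[OF W(1)])
        show "connected X" using X by (simp add: in_components_connected)
        show "X \<subseteq> - ?K" using in_components_subset[OF X(1)] by blast
        show "W \<inter> X \<noteq> {}" using opW W(2) X(2) by (metis Int_commute closure_iff_nhds_not_empty subset_refl)
      qed
      have "\<not> (E \<in> \<phi> ` \<D> \<and> E' \<in> \<phi> ` \<D>)"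
      proof
        assume "E \<in> \<phi> ` \<D> \<and> E' \<in> \<phi> ` \<D>"
        then obtain D D' where DD: "D \<in> \<D>" "D' \<in> \<D>" "E = \<phi> D" "E' = \<phi> D'" by blast
        have "D = W" "D' = W"
          using DD \<phi> D(1) W(1) inW[OF E(1)] inW[OF E(2)] E(4)[OF m] disj
            in_components_nonempty[OF E(1)] in_components_nonempty[OF E(2)]
          by (metis subsetD)+
        then show False using DD E(3) by simp
      qed
      then obtain X where X: "X \<in> components (- ?K')" "X \<notin> \<phi> ` \<D>" using E by blast
      have "card (insert X (\<phi> ` \<D>)) = card \<D> + 1"
        using X D(2) card_image[OF inj] by simp
      moreover have "card (P // conn (insert s B)) \<le> card (P // conn B)"
      proof (rule finite_refines_card_le)
        show "finite (P // conn B)" using finite_P by (simp add: quotient_def)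
        show "conn B \<subseteq> conn (insert s B)"
          unfolding conn_def by (auto intro: path_component_of_subset[rotated])
      qed (rule equiv_conn)+
      ultimately show ?thesis using D \<phi> X cards
        by (intro exI[of _ "insert X (\<phi> ` \<D>)"]) auto
    qed
  qed
qed

lemma euler:
  assumes "P \<noteq> {}"
  shows "\<exists>\<D> \<subseteq> faces. finite \<D> \<and> card \<D> + card P \<ge> card A + 2"
proof -
  have "P // conn A \<noteq> {}" using assms by (simp add: quotient_def)
  moreover have "finite (P // conn A)" using finite_P by (simp add: quotient_def)
  ultimately have "card (P // conn A) \<ge> 1" by (simp add: card_gt_0_iff Suc_leI)
  moreover obtain \<D> where "\<D> \<subseteq> faces" "finite \<D>"
      "card \<D> + card P \<ge> card A + card (P // conn A) + 1"
    using euler_aux[OF order_refl] unfolding faces_def by blast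
  ultimately show ?thesis by (intro exI[of _ \<D>]) simp
qed

end

lemma closure_meets_ball: "m \<in> closure D \<Longrightarrow> \<delta> > 0 \<Longrightarrow> \<exists>y\<in>D. y \<in> ball m \<delta>"
  for m :: "'a::metric_space"
  by (simp add: closure_approachable dist_commute)

section \<open>Boundaries of faces in bridgeless plane graphs\<close>

locale bridgeless_plane_graph = plane_graph +
  assumes bridgeless: "s \<in> A \<Longrightarrow> p \<in> s \<inter> P \<Longrightarrow> q \<in> s \<inter> P \<Longrightarrow> path_component (P \<union> \<Union>(A - {s})) p q"
    and simple: "s \<in> A \<Longrightarrow> t \<in> A \<Longrightarrow> s \<inter> P = t \<inter> P \<Longrightarrow> s = t"
    and A_nonempty: "A \<noteq> {}"
begin

lemma card_ends: "s \<in> A \<Longrightarrow> card (s \<inter> P) = 2"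
  using arcs arc_distinct_ends by (metis card_2_iff)

lemma interior_ne: "s \<in> A \<Longrightarrow> s - P \<noteq> {}"
proof -
  assume "s \<in> A"
  then obtain g where g: "arc g" "path_image g = s" "s \<inter> P = {pathstart g, pathfinish g}"
    using arcs by blast
  then have "s - P = g ` {0<..<1}"
    using simple_path_endless[OF arc_imp_simple_path[OF g(1)]] by blast
  then show ?thesis by simp
qed

lemma closed_graph: "closed (P \<union> \<Union>A)"
  using compact_sub[of A] by (simp add: compact_imp_closed)

lemma face_open: "F \<in> faces \<Longrightarrow> open F"
  using open_face_sub[of A F] unfolding faces_def by simp

lemma face_off: "F \<in> faces \<Longrightarrow> F \<inter> (P \<union> \<Union>A) = {}"
  unfolding faces_def using in_components_subset by blast

definition "sides s D D' \<longleftrightarrow> D \<in> faces \<and> D' \<in> faces \<and> D \<noteq> D' \<and> {F \<in> faces. touches F s} = {D, D'} \<and>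
  (\<forall>m \<in> s - P. m \<in> closure D \<and> m \<in> closure D' \<and> (\<exists>\<delta>>0. ball m \<delta> - s \<subseteq> D \<union> D'))"

text \<open>Near an interior point of \<open>s\<close> everything off \<open>s\<close> belongs to
  the two faces supplied by \<open>arc_sides\<close>, so a third face has no room to touch
  \<open>s\<close>.\<close>

lemma two_sides:
  assumes s: "s \<in> A"
  shows "\<exists>D D'. sides s D D'"
proof -
  obtain g where g: "arc g" "path_image g = s" "s \<inter> P = {pathstart g, pathfinish g}"
    using arcs s by blast
  have "path_component (P \<union> \<Union>(A - {s})) (pathfinish g) (pathstart g)"
    using bridgeless s g(3) by blast
  moreover have "insert s (A - {s}) = A" using s by blast
  ultimately obtain D D' where D: "D \<in> faces" "D' \<in> faces" "D \<noteq> D'"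
    "\<And>m. m \<in> s - P \<Longrightarrow> m \<in> closure D \<and> m \<in> closure D' \<and> (\<exists>\<delta>>0. ball m \<delta> - s \<subseteq> D \<union> D')"
    using arc_sides[of "A - {s}" s g] s g unfolding faces_def by (metis Diff_iff Diff_subset insertI1)
  have "F = D \<or> F = D'" if F: "F \<in> faces" "touches F s" for F
  proof -
    obtain m where m: "m \<in> closure F" "m \<in> s - P" using F(2) unfolding touches_def by blast
    obtain \<delta> where d: "\<delta> > 0" "ball m \<delta> - s \<subseteq> D \<union> D'" using D(4)[OF m(2)] by blast
    have "ball m \<delta> \<inter> F \<noteq> {}" using closure_meets_ball[OF m(1) d(1)] by blast
    then have "F \<inter> D \<noteq> {} \<or> F \<inter> D' \<noteq> {}" using d(2) face_off[OF F(1)] s by blast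
    then show ?thesis using F(1) D(1,2) unfolding faces_def by (metis components_nonoverlap)
  qed
  moreover have "touches D s" "touches D' s"
    using D(4) interior_ne[OF s] unfolding touches_def by blast+
  ultimately have "{F \<in> faces. touches F s} = {D, D'}" using D(1,2) by blast
  then show ?thesis unfolding sides_def using D by blast
qed

lemma bdry_A: "s \<in> bdry F \<Longrightarrow> s \<in> A"
  unfolding bdry_def by blast

lemma finite_bdry: "finite (bdry F)"
  unfolding bdry_def using finite_A by simp

text \<open>Apart from nodes, the frontier of \<open>D\<close> lies in the arcs of
  \<open>bdry D\<close>, and deleting finitely many nodes does not disconnect an open connected set.
  So the arcs away from the boundary of a face can be ignored when its extent is discussed.\<close>

lemma face_bdry_component:
  assumes D: "D \<in> faces" and z: "z \<in> D" and w: "w \<notin> P"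
    and con: "connected_component (- \<Union>(bdry D)) z w"
  shows "w \<in> D"
proof (rule ccontr)
  assume wD: "w \<notin> D"
  let ?L = "\<Union>(bdry D)"
  let ?C = "connected_component_set (- ?L) z"
  have "closed ?L" using finite_bdry compact_arc bdry_A by (intro closed_Union) (auto simp: compact_imp_closed)
  then have "open ?C" by (simp add: open_Compl open_connected_component)
  then have "connected (?C - P)"
    by (intro connected_open_delete_finite) (use finite_P in auto)
  moreover have "z \<in> ?C" using connected_component_in[OF con] by (simp add: connected_component_refl)
  moreover have "z \<notin> P" using z face_off[OF D] by blast
  moreover have "w \<in> ?C" using con by simp
  ultimately have "(?C - P) \<inter> frontier D \<noteq> {}"
    by (intro connected_Int_frontier) (use z w wD in blast)+
  then obtain y where y: "y \<in> ?C - P" "y \<in> frontier D" by blast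
  have "y \<in> P \<union> \<Union>A" using y(2) frontier_of_components_closed_complement[OF closed_graph] D
    unfolding faces_def by blast
  then obtain s where "s \<in> A" "y \<in> s" using y(1) by blast
  then have "s \<in> bdry D" using y unfolding bdry_def touches_def frontier_def by blast
  then have "y \<in> ?L" using \<open>y \<in> s\<close> by blast
  moreover have "connected_component (- ?L) z y" using y(1) by simp
  ultimately show False using connected_component_in by blast
qed

lemma bdry_ne:
  assumes "D \<in> faces"
  shows "bdry D \<noteq> {}"
proof
  assume "bdry D = {}"
  moreover obtain z where z: "z \<in> D" using assms in_components_nonempty unfolding faces_def by blast
  moreover obtain s m where s: "s \<in> A" "m \<in> s - P" using A_nonempty interior_ne by blast
  moreover have "connected_component UNIV z m"
    by (metis UNIV_I connected_component_UNIV mem_Collect_eq)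
  ultimately have "m \<in> D" using face_bdry_component[OF assms z, of m] by simp
  then show False using s face_off[OF assms] by blast
qed

lemma finite_faces: "finite faces"
proof (rule finite_subset)
  show "faces \<subseteq> (\<Union>s\<in>A. {F \<in> faces. touches F s})"
    using bdry_ne unfolding bdry_def by blast
  have "finite {F \<in> faces. touches F s}" if s: "s \<in> A" for s
    using two_sides[OF s] unfolding sides_def by (metis finite.emptyI finite_insert)
  then show "finite (\<Union>s\<in>A. {F \<in> faces. touches F s})" using finite_A by blast
qed

text \<open>If an arc of the boundary of a face ended freely, Janiszewski's theorem would connect its two
  sides around the free end.\<close>

lemma bdry_degree:
  assumes D: "D \<in> faces" and s: "s \<in> bdry D" and q: "q \<in> s \<inter> P"
  shows "\<exists>t \<in> bdry D. t \<noteq> s \<and> q \<in> t"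
proof (rule ccontr)
  assume none: "\<not> ?thesis"
  let ?T = "\<Union>(bdry D - {s})"
  have sA: "s \<in> A" using s by (rule bdry_A)
  obtain g where g: "arc g" "path_image g = s" "s \<inter> P = {pathstart g, pathfinish g}"
    using arcs sA by blast
  obtain E E' where "sides s E E'" using two_sides[OF sA] by blast
  then have E: "E \<in> faces" "E' \<in> faces" "E \<noteq> E'" "{F \<in> faces. touches F s} = {E, E'}"
    "\<forall>m \<in> s - P. m \<in> closure E \<and> m \<in> closure E'"
    unfolding sides_def by simp_all
  have "D = E \<or> D = E'" using D s E(4) unfolding bdry_def by blast
  then have "\<exists>D'. D' \<in> faces \<and> D' \<noteq> D \<and> (\<forall>m. m \<in> s - P \<longrightarrow> m \<in> closure D \<and> m \<in> closure D')"
    using E(1-3) E(5) by metis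
  then obtain D' where D': "D' \<in> faces" "D' \<noteq> D" "\<And>m. m \<in> s - P \<Longrightarrow> m \<in> closure D \<and> m \<in> closure D'"
    by blast
  obtain m where m: "m \<in> s - P" using interior_ne[OF sA] by blast
  have cl: "closed ?T" using finite_bdry compact_arc bdry_A
    by (intro closed_Union) (auto simp: compact_imp_closed)
  have sT: "s \<inter> ?T \<subseteq> s \<inter> P" using inter sA bdry_A by blast
  have mT: "m \<in> - ?T" using sT m by blast
  then obtain \<delta> where d: "\<delta> > 0" "ball m \<delta> \<subseteq> - ?T" using cl
    by (meson open_Compl open_contains_ball)
  obtain y where y: "y \<in> D" "y \<in> ball m \<delta>" using D'(3)[OF m] closure_meets_ball[OF _ d(1)] by blast
  obtain z where z: "z \<in> D'" "z \<in> ball m \<delta>" using D'(3)[OF m] closure_meets_ball[OF _ d(1)] by blast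
  have yz: "y \<notin> P" "z \<notin> P" "y \<notin> s" "z \<notin> s" using y z face_off[OF D] face_off[OF D'(1)] sA by blast+
  have "connected_component (- (s \<union> ?T)) y z"
  proof (rule Janiszewski)
    show "compact s" using compact_arc[OF sA] .
    show "closed ?T" by (rule cl)
    \<comment> \<open>If the end \<open>q\<close> is free, \<open>s\<close> meets the other boundary
      arcs in at most its other end. This makes the intersection connected, as Janiszewski's theorem
      requires.\<close>
    have "s \<inter> ?T \<subseteq> s \<inter> P - {q}" using sT none by blast
    moreover have "card (s \<inter> P - {q}) = 1" using q card_ends[OF sA] by simp
    ultimately have "\<exists>r. s \<inter> ?T \<subseteq> {r}" by (metis card_1_singletonE)
    then show "connected (s \<inter> ?T)" by (metis connected_empty connected_sing subset_singleton_iff)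
    have "connected (- s)" using connected_arc_complement[OF g(1)] g(2) by simp
    then show "connected_component (- s) y z" unfolding connected_component_def using yz by blast
    show "connected_component (- ?T) y z"
      unfolding connected_component_def using y(2) z(2) d(2) connected_ball by blast
  qed
  moreover have "s \<union> ?T = \<Union>(bdry D)" using s by blast
  ultimately have "z \<in> D" using face_bdry_component[OF D y(1) yz(2)] by simp
  then show False using z(1) D'(1,2) D unfolding faces_def by (metis components_nonoverlap disjoint_iff)
qed

text \<open>The two faces together with the interiors of their common boundary arcs form a set that
  is open and closed in the plane minus \<open>P\<close>, hence all of it, and no room is left for a
  further arc. This later excludes two triangles on the same three segments.\<close>

lemma bdry_inj:
  assumes D: "D \<in> faces" "D' \<in> faces" "D \<noteq> D'" and eq: "bdry D = bdry D'"
  shows "bdry D = A"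
proof (rule ccontr)
  assume "bdry D \<noteq> A"
  then obtain t where t: "t \<in> A" "t \<notin> bdry D" unfolding bdry_def by blast
  obtain m where m: "m \<in> t - P" using interior_ne[OF t(1)] by blast
  define O' where "O' = D \<union> D' \<union> (\<Union>(bdry D) - P)"
  have mO: "m \<notin> O'" unfolding O'_def
    using m t face_off[OF D(1)] face_off[OF D(2)] inter bdry_A by blast
  obtain z where z: "z \<in> D" using D(1) in_components_nonempty unfolding faces_def by blast
  have zP: "z \<notin> P" using z face_off[OF D(1)] by blast
  have "connected (UNIV - P)"
    by (rule connected_open_delete_finite) (use finite_P in auto)
  moreover have "z \<in> O'" unfolding O'_def using z by blast
  ultimately have "(UNIV - P) \<inter> frontier O' \<noteq> {}"
    by (intro connected_Int_frontier) (use zP mO m in blast)+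
  then obtain y where y: "y \<notin> P" "y \<in> frontier O'" by blast
  have "closed (\<Union>(bdry D))" using finite_bdry compact_arc bdry_A
    by (intro closed_Union) (auto simp: compact_imp_closed)
  then have "closure O' \<subseteq> closure D \<union> closure D' \<union> \<Union>(bdry D)"
    unfolding O'_def by (metis Diff_subset closure_Un closure_closed closure_mono Un_mono order_refl)
  then have "y \<in> closure D \<union> closure D' \<union> \<Union>(bdry D)" using y unfolding frontier_def by blast
  moreover have "D \<subseteq> interior O'" "D' \<subseteq> interior O'"
    unfolding O'_def using face_open[OF D(1)] face_open[OF D(2)]
    by (intro interior_maximal; blast)+
  moreover have "y \<notin> interior O'" using y unfolding frontier_def by blast
  moreover have "frontier D = closure D - D" "frontier D' = closure D' - D'"
    using face_open D by (simp_all add: frontier_def interior_open)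
  ultimately have "y \<in> frontier D \<or> y \<in> frontier D' \<or> y \<in> \<Union>(bdry D)" by blast
  moreover have "frontier D \<subseteq> P \<union> \<Union>A" "frontier D' \<subseteq> P \<union> \<Union>A"
    using frontier_of_components_closed_complement[OF closed_graph] D unfolding faces_def by blast+
  ultimately obtain s where s: "s \<in> bdry D" "y \<in> s - P"
    using y(1) eq unfolding bdry_def touches_def frontier_def by blast
  obtain E E' where "sides s E E'" using two_sides[OF bdry_A[OF s(1)]] by blast
  then have E: "{F \<in> faces. touches F s} = {E, E'}" "\<exists>\<delta>>0. ball y \<delta> - s \<subseteq> E \<union> E'"
    unfolding sides_def using s(2) by simp_all
  have "D \<in> {E, E'}" "D' \<in> {E, E'}" using E(1) D s eq unfolding bdry_def by blast+
  then obtain \<delta> where d: "\<delta> > 0" "ball y \<delta> - s \<subseteq> D \<union> D'" using E(2) D(3) by blast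
  have "open (- P)" using finite_P by (simp add: finite_imp_closed open_Compl)
  then obtain e where e: "e > 0" "ball y e \<subseteq> - P" using y(1) by (meson ComplI open_contains_ball)
  have "ball y (min \<delta> e) \<subseteq> O'" unfolding O'_def using d e s(1) by auto
  then have "y \<in> interior O'" using d(1) e(1) by (metis mem_interior min_less_iff_conj)
  then show False using y unfolding frontier_def by blast
qed

text \<open>Each arc has exactly two faces along it and these differ in colour, so the boundaries of
  the faces of either colour partition the arcs.\<close>

lemma sum_card_bdry:
  assumes "\<And>s F F'. s \<in> A \<Longrightarrow> F \<in> faces \<Longrightarrow> F' \<in> faces \<Longrightarrow> s \<in> bdry F \<Longrightarrow> s \<in> bdry F' \<Longrightarrow> F \<noteq> F' \<Longrightarrow>
    col F \<noteq> (col F' :: bool)"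
  shows "s \<in> A \<Longrightarrow> \<exists>!F. F \<in> faces \<and> col F = b \<and> s \<in> bdry F"
    and "(\<Sum>F\<in>{F \<in> faces. col F = b}. card (bdry F)) = card A"
proof -
  show ex1: "\<exists>!F. F \<in> faces \<and> col F = b \<and> s \<in> bdry F" if s: "s \<in> A" for s
  proof -
    obtain D D' where "sides s D D'" using two_sides[OF s] by blast
    then have D: "D \<in> faces" "D' \<in> faces" "D \<noteq> D'" "{F \<in> faces. touches F s} = {D, D'}"
      unfolding sides_def by simp_all
    have b: "s \<in> bdry F \<longleftrightarrow> F = D \<or> F = D'" if F: "F \<in> faces" for F
      using D(4) F s unfolding bdry_def by blast
    then have "col D \<noteq> col D'" using assms[OF s D(1,2)] D by blast
    then show ?thesis using b D by metis
  qed
  let ?S = "{F \<in> faces. col F = b}"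
  have "(\<Sum>F\<in>?S. card (bdry F)) = card (Sigma ?S bdry)"
    using finite_faces finite_bdry by simp
  also have "\<dots> = card A"
  proof (rule bij_betw_same_card[of snd])
    show "bij_betw snd (Sigma ?S bdry) A"
    proof (rule bij_betw_imageI)
      show "inj_on snd (Sigma ?S bdry)"
      proof (rule inj_onI)
        fix x y assume xy: "x \<in> Sigma ?S bdry" "y \<in> Sigma ?S bdry" "snd x = snd y"
        then have "fst x \<in> faces \<and> col (fst x) = b \<and> snd x \<in> bdry (fst x)"
          "fst y \<in> faces \<and> col (fst y) = b \<and> snd x \<in> bdry (fst y)" by auto
        then have "fst x = fst y" using ex1[OF bdry_A] by blast
        then show "x = y" using xy(3) by (rule prod_eqI)
      qed
      show "snd ` Sigma ?S bdry = A"
      proof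
        show "snd ` Sigma ?S bdry \<subseteq> A" using bdry_A by auto
        show "A \<subseteq> snd ` Sigma ?S bdry"
        proof
          fix s assume "s \<in> A"
          then obtain F where "F \<in> ?S" "s \<in> bdry F" using ex1 by blast
          then have "(F, s) \<in> Sigma ?S bdry" by simp
          then show "s \<in> snd ` Sigma ?S bdry" by force
        qed
      qed
    qed
  qed
  finally show "(\<Sum>F\<in>?S. card (bdry F)) = card A" .
qed

end

section \<open>Transversal crossings\<close>

lemma rotate_axes:
  "(\<lambda>z. - \<i> * z) ` {z. Im z = 0} = {z. Re z = 0}" "(\<lambda>z. - \<i> * z) ` {z. Re z = 0} = {z. Im z = 0}"
proof -
  have eq: "z = - \<i> * (\<i> * z)" for z :: complex by simp
  show "(\<lambda>z. - \<i> * z) ` {z. Im z = 0} = {z. Re z = 0}"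
  proof (intro equalityI subsetI)
    fix z assume "z \<in> {z. Re z = 0}"
    then have "\<i> * z \<in> {z. Im z = 0}" by simp
    with eq show "z \<in> (\<lambda>z. - \<i> * z) ` {z. Im z = 0}" by (rule image_eqI)
  qed auto
  show "(\<lambda>z. - \<i> * z) ` {z. Re z = 0} = {z. Im z = 0}"
  proof (intro equalityI subsetI)
    fix z assume "z \<in> {z. Im z = 0}"
    then have "\<i> * z \<in> {z. Re z = 0}" by simp
    with eq show "z \<in> (\<lambda>z. - \<i> * z) ` {z. Re z = 0}" by (rule image_eqI)
  qed auto
qed

lemma homeomorphism_mem_image:
  assumes "homeomorphism U V h k" "z \<in> U"
  shows "h z \<in> h ` (A \<inter> U) \<longleftrightarrow> z \<in> A"
proof
  assume "h z \<in> h ` (A \<inter> U)"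
  then obtain w where w: "w \<in> A" "w \<in> U" "h z = h w" by auto
  have "z = k (h z)" using homeomorphism_apply1[OF assms] by simp
  also have "\<dots> = w" unfolding w(3) using homeomorphism_apply1[OF assms(1) w(2)] .
  finally show "z \<in> A" using w(1) by simp
qed (use assms in auto)

text \<open>The half is taken without its end \<open>x\<close>. Closedness after adding
  \<open>x\<close> separates two halves on connected sets that avoid \<open>x\<close>; the last
  condition prevents a half from being absent near \<open>x\<close>.\<close>

definition half_arc :: "complex \<Rightarrow> complex set \<Rightarrow> bool" where
  "half_arc x X \<longleftrightarrow> x \<notin> X \<and> closed (insert x X) \<and> x \<in> closure X"

definition split_at :: "complex \<Rightarrow> complex set \<Rightarrow> complex set \<Rightarrow> complex set \<Rightarrow> bool" where
  "split_at x A X Y \<longleftrightarrow> half_arc x X \<and> half_arc x Y \<and> X \<inter> Y = {} \<and> A = insert x (X \<union> Y)"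

lemma split_at_sym: "split_at x A X Y \<Longrightarrow> split_at x A Y X"
  unfolding split_at_def by blast

text \<open>The preimage of an open half axis is connected and avoids \<open>x\<close>, so it lies
  in one of the two halves. Both half axes cannot lie in \<open>X\<close>, because \<open>Y\<close>
  accumulates at \<open>x\<close>. The assumption \<open>k 1 \<in> X\<close> fixes the sign.\<close>

lemma axis_halves_aux:
  assumes U: "open U" "x \<in> U" and hom: "homeomorphism U (UNIV :: complex set) h k" and hx: "h x = 0"
    and A: "h ` (A \<inter> U) = {z. Im z = 0}" and sp: "split_at x A X Y"
    and X: "k 1 \<in> X"
  shows "\<forall>z\<in>U. (z \<in> X \<longleftrightarrow> Im (h z) = 0 \<and> Re (h z) > 0) \<and> (z \<in> Y \<longleftrightarrow> Im (h z) = 0 \<and> Re (h z) < 0)"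
proof -
  have hk: "h (k z) = z" "k z \<in> U" for z using hom by (auto simp: homeomorphism_def)
  have kh: "k (h z) = z" if "z \<in> U" for z using hom that by (auto simp: homeomorphism_def)
  have k0: "k 0 = x" using kh U hx by metis
  have contk: "continuous_on UNIV k" using hom by (simp add: homeomorphism_def)
  have inA: "z \<in> A \<longleftrightarrow> Im (h z) = 0" if z: "z \<in> U" for z
    using homeomorphism_mem_image[OF hom z, of A] A by simp
  have side: "k ` T \<subseteq> X \<or> k ` T \<subseteq> Y" if T: "connected T" "T \<subseteq> {z. Im z = 0} - {0}" for T
  proof -
    have "connected (k ` T)"
      using connected_continuous_image[OF continuous_on_subset[OF contk subset_UNIV] T(1)] .
    moreover have "k ` T \<subseteq> insert x X \<union> insert x Y"
    proof
      fix w assume "w \<in> k ` T"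
      then obtain z where "w = k z" "z \<in> T" by blast
      then have "w \<in> A" using inA[OF hk(2)] hk T by auto
      then show "w \<in> insert x X \<union> insert x Y" using sp unfolding split_at_def by blast
    qed
    moreover have x: "x \<notin> k ` T"
    proof
      assume "x \<in> k ` T"
      then obtain z where "z \<in> T" "x = k z" by blast
      then show False using hx hk(1)[of z] T(2) by auto
    qed
    moreover have "insert x X \<inter> insert x Y \<inter> k ` T = {}" using x sp unfolding split_at_def by blast
    moreover have "closed (insert x X)" "closed (insert x Y)"
      using sp unfolding split_at_def half_arc_def by auto
    ultimately have "insert x X \<inter> k ` T = {} \<or> insert x Y \<inter> k ` T = {}"
      using connected_closedD by blast
    then show ?thesis using \<open>k ` T \<subseteq> insert x X \<union> insert x Y\<close> x by blast
  qed
  define Pos Neg where "Pos = {z. Im z = 0 \<and> Re z > 0}" and "Neg = {z. Im z = 0 \<and> Re z < 0}"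
  have "Pos = complex_of_real ` {0<..}" "Neg = complex_of_real ` {..<0}"
    unfolding Pos_def Neg_def by (auto simp: complex_eq_iff image_iff intro: exI[of _ "Re _"])
  then have con: "connected Pos" "connected Neg"
    by (auto intro!: connected_continuous_image continuous_intros)
  have "1 \<in> Pos" unfolding Pos_def by simp
  then have P: "k ` Pos \<subseteq> X"
    using side[OF con(1)] X sp unfolding split_at_def Pos_def by fastforce
  have "\<not> k ` Neg \<subseteq> X"
  proof
    assume N: "k ` Neg \<subseteq> X"
    have "Y \<inter> U = {}"
    proof (rule ccontr)
      assume "Y \<inter> U \<noteq> {}"
      then obtain y where y: "y \<in> Y" "y \<in> U" by blast
      then have "Im (h y) = 0" using inA sp unfolding split_at_def by blast
      moreover have "h y \<noteq> 0" using y sp kh k0 unfolding split_at_def half_arc_def by metis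
      ultimately have "h y \<in> Pos \<union> Neg" unfolding Pos_def Neg_def
        by (auto simp: complex_eq_iff linorder_neq_iff)
      then have "k (h y) \<in> X" using P N by blast
      then show False using kh y sp unfolding split_at_def by auto
    qed
    moreover have "x \<in> closure Y" using sp unfolding split_at_def half_arc_def by simp
    ultimately show False using U by (metis Int_commute closure_iff_nhds_not_empty subset_refl)
  qed
  moreover have "Neg \<subseteq> {z. Im z = 0} - {0}" unfolding Neg_def by auto
  ultimately have N: "k ` Neg \<subseteq> Y" using side[OF con(2)] by blast
  show ?thesis
  proof
    fix z assume z: "z \<in> U"
    have "z \<in> A \<longleftrightarrow> Im (h z) = 0" using inA z .
    moreover have "h z \<in> Pos \<Longrightarrow> z \<in> X" "h z \<in> Neg \<Longrightarrow> z \<in> Y" using P N kh[OF z] by (metis image_subset_iff)+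
    moreover have "h z = 0 \<Longrightarrow> z = x" using kh[OF z] k0 by metis
    moreover have "h z = 0 \<or> h z \<in> Pos \<or> h z \<in> Neg" if "Im (h z) = 0"
      using that unfolding Pos_def Neg_def by (auto simp: complex_eq_iff linorder_neq_iff)
    ultimately show "(z \<in> X \<longleftrightarrow> Im (h z) = 0 \<and> Re (h z) > 0) \<and> (z \<in> Y \<longleftrightarrow> Im (h z) = 0 \<and> Re (h z) < 0)"
      using sp unfolding split_at_def half_arc_def Pos_def Neg_def by auto
  qed
qed

lemma axis_halves:
  assumes U: "open U" "x \<in> U" and hom: "homeomorphism U (UNIV :: complex set) h k" and hx: "h x = 0"
    and A: "h ` (A \<inter> U) = {z. Im z = 0}" and sp: "split_at x A X Y"
  obtains a where "a = 1 \<or> a = (-1::real)"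
    "\<And>z. z \<in> U \<Longrightarrow> (z \<in> X \<longleftrightarrow> Im (h z) = 0 \<and> a * Re (h z) > 0) \<and> (z \<in> Y \<longleftrightarrow> Im (h z) = 0 \<and> a * Re (h z) < 0)"
proof -
  have hk: "h (k z) = z" "k z \<in> U" for z using hom by (auto simp: homeomorphism_def)
  have "1 \<in> h ` (A \<inter> U)" using A by simp
  then have "k 1 \<in> A" using hom by (auto simp: homeomorphism_def)
  moreover have "k 1 \<noteq> x" using hk(1)[of 1] hx by auto
  ultimately consider "k 1 \<in> X" | "k 1 \<in> Y" using sp unfolding split_at_def by blast
  then show ?thesis
  proof cases
    case 1
    from axis_halves_aux[OF U hom hx A sp 1] show ?thesis by (intro that[of 1]) auto
  next
    case 2
    from axis_halves_aux[OF U hom hx A split_at_sym[OF sp] 2] show ?thesis by (intro that[of "-1"]) auto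
  qed
qed

lemma meet_transversally_sym:
  assumes "meet_transversally_at A B p"
  shows "meet_transversally_at B A p"
proof -
  obtain U h k where U: "open U" "p \<in> U" and hom: "homeomorphism U (UNIV :: complex set) h k" and hp: "h p = 0"
    and A: "h ` (A \<inter> U) = {z. Im z = 0}" and B: "h ` (B \<inter> U) = {z. Re z = 0}"
    using assms unfolding meet_transversally_at_def by blast
  have "homeomorphism UNIV UNIV (\<lambda>z. - \<i> * z) (\<lambda>z. \<i> * z)"
    by (rule homeomorphismI) (auto intro!: continuous_intros)
  from homeomorphism_compose[OF hom this]
  have "homeomorphism U UNIV (\<lambda>z. - \<i> * h z) (\<lambda>z. k (\<i> * z))" by (simp add: o_def)
  moreover have "(\<lambda>z. - \<i> * h z) ` (A \<inter> U) = {z. Re z = 0}"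
  proof -
    have "(\<lambda>z. - \<i> * h z) ` (A \<inter> U) = (\<lambda>z. - \<i> * z) ` (h ` (A \<inter> U))" by (simp only: image_image)
    then show ?thesis unfolding A rotate_axes .
  qed
  moreover have "(\<lambda>z. - \<i> * h z) ` (B \<inter> U) = {z. Im z = 0}"
  proof -
    have "(\<lambda>z. - \<i> * h z) ` (B \<inter> U) = (\<lambda>z. - \<i> * z) ` (h ` (B \<inter> U))" by (simp only: image_image)
    then show ?thesis unfolding B rotate_axes .
  qed
  ultimately show ?thesis unfolding meet_transversally_at_def using U hp
    by (intro exI[of _ U] exI[of _ "\<lambda>z. - \<i> * h z"] exI[of _ "\<lambda>z. k (\<i> * z)"]) auto
qed

text \<open>A small half disc on one side of \<open>A\<close> in the first chart is connected, so in the second chart, in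
  which \<open>A\<close> is an axis too, it stays on one side of that axis.\<close>

lemma opposite_sides:
  assumes U: "open U" "x \<in> U" and hom: "homeomorphism U (UNIV :: complex set) h k" and hx: "h x = 0"
    and A: "h ` (A \<inter> U) = {z. Im z = 0}"
    and AC: "meet_transversally_at A C x" "A \<inter> C = {x}" and sp: "split_at x C X Y"
  obtains \<rho> where "\<rho> > 0" "\<And>y z. y \<in> U \<Longrightarrow> z \<in> U \<Longrightarrow> y \<in> X \<Longrightarrow> z \<in> Y \<Longrightarrow> norm (h y) < \<rho> \<Longrightarrow> norm (h z) < \<rho> \<Longrightarrow>
    Im (h y) * Im (h z) < 0"
proof -
  have hk: "h (k z) = z" "k z \<in> U" for z using hom by (auto simp: homeomorphism_def)
  have kh: "k (h z) = z" if "z \<in> U" for z using hom that by (auto simp: homeomorphism_def)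
  have k0: "k 0 = x" using kh U hx by metis
  have contk: "continuous_on UNIV k" using hom by (simp add: homeomorphism_def)
  have inA: "z \<in> A \<longleftrightarrow> Im (h z) = 0" if z: "z \<in> U" for z
    using homeomorphism_mem_image[OF hom z, of A] A by simp
  obtain U' h' k' where U': "open U'" "x \<in> U'" and hom': "homeomorphism U' (UNIV :: complex set) h' k'"
    and hx': "h' x = 0" and C': "h' ` (C \<inter> U') = {z. Im z = 0}" and A': "h' ` (A \<inter> U') = {z. Re z = 0}"
    using meet_transversally_sym[OF AC(1)] unfolding meet_transversally_at_def by blast
  obtain a where a: "a = 1 \<or> a = (-1::real)"
    "\<And>z. z \<in> U' \<Longrightarrow> (z \<in> X \<longleftrightarrow> Im (h' z) = 0 \<and> a * Re (h' z) > 0) \<and> (z \<in> Y \<longleftrightarrow> Im (h' z) = 0 \<and> a * Re (h' z) < 0)"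
    using axis_halves[OF U' hom' hx' C' sp] by metis
  have inA': "Re (h' z) \<noteq> 0" if z: "z \<in> U'" "z \<notin> A" for z
  proof
    assume "Re (h' z) = 0"
    then have "h' z \<in> h' ` (A \<inter> U')" using A' by simp
    then show False using homeomorphism_mem_image[OF hom' z(1)] z(2) by simp
  qed
  have "open (k -` U')" using contk U'(1) by (simp add: open_vimage)
  then obtain \<rho> where r: "\<rho> > 0" "ball 0 \<rho> \<subseteq> k -` U'"
    using k0 U'(2) by (metis open_contains_ball vimageI)
  have same: "Re (h' y) * Re (h' z) > 0"
    if yz: "y \<in> U" "z \<in> U" "norm (h y) < \<rho>" "norm (h z) < \<rho>" "s * Im (h y) > 0" "s * Im (h z) > 0" for y z s
  proof -
    let ?H = "{w. inner (Complex 0 s) w > 0} \<inter> ball 0 \<rho>"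
    have H: "w \<in> ?H \<longleftrightarrow> s * Im w > 0 \<and> norm w < \<rho>" for w by (simp add: inner_complex_def)
    have "connected ?H" by (intro convex_connected convex_Int convex_halfspace_gt convex_ball)
    then have c: "connected ((\<lambda>w. Re (h' (k w))) ` ?H)"
    proof (rule connected_continuous_image[rotated])
      have "continuous_on ?H (\<lambda>w. h' (k w))"
      proof (rule continuous_on_compose2[of U' h' _ k])
        show "continuous_on U' h'" using hom' by (simp add: homeomorphism_def)
        show "continuous_on ?H k" using contk continuous_on_subset by blast
        show "k ` ?H \<subseteq> U'" using r by auto
      qed
      then show "continuous_on ?H (\<lambda>w. Re (h' (k w)))" by (intro continuous_intros)
    qed
    have "0 \<notin> (\<lambda>w. Re (h' (k w))) ` ?H"
    proof
      assume "0 \<in> (\<lambda>w. Re (h' (k w))) ` ?H"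
      then obtain w where w: "w \<in> ?H" "Re (h' (k w)) = 0" by auto
      have "k w \<notin> A" using inA[OF hk(2), of w] hk(1) w(1) H by auto
      moreover have "k w \<in> U'" using w(1) r by auto
      ultimately show False using inA' w(2) by blast
    qed
    note zero = this
    have m: "Re (h' y) \<in> (\<lambda>w. Re (h' (k w))) ` ?H" "Re (h' z) \<in> (\<lambda>w. Re (h' (k w))) ` ?H"
      using image_eqI[of "Re (h' y)" "\<lambda>w. Re (h' (k w))" "h y" ?H] image_eqI[of "Re (h' z)" "\<lambda>w. Re (h' (k w))" "h z" ?H]
        yz H kh by (simp_all add: inner_complex_def)
    have "Re (h' y) \<noteq> 0" "Re (h' z) \<noteq> 0" using m zero by metis+
    moreover have "\<not> (Re (h' y) \<le> 0 \<and> 0 \<le> Re (h' z))" "\<not> (Re (h' z) \<le> 0 \<and> 0 \<le> Re (h' y))"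
      using connectedD_interval[OF c m] connectedD_interval[OF c m(2,1)] zero by blast+
    ultimately show ?thesis by (metis linorder_le_cases mult_neg_neg mult_pos_pos order_less_le)
  qed
  show ?thesis
  proof (rule that[OF r(1)])
    fix y z assume yz: "y \<in> U" "z \<in> U" "y \<in> X" "z \<in> Y" "norm (h y) < \<rho>" "norm (h z) < \<rho>"
    have U'': "y \<in> U'" "z \<in> U'" using r(2) yz kh by (metis mem_ball_0 subsetD vimageD)+
    have "y \<noteq> x" "z \<noteq> x" "y \<in> C" "z \<in> C" using yz sp unfolding split_at_def half_arc_def by auto
    then have "y \<notin> A" "z \<notin> A" using AC(2) by auto
    then have nz: "Im (h y) \<noteq> 0" "Im (h z) \<noteq> 0" using inA yz by auto
    \<comment> \<open>In the second chart \<open>C\<close> is the real and \<open>A\<close> the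
      imaginary axis, so the two halves of \<open>C\<close> lie on different sides of
      \<open>A\<close>. By \<open>same\<close> this carries over to the first chart.\<close>
    have "Re (h' y) * Re (h' z) < 0"
      using a(1) a(2)[OF U''(1)] a(2)[OF U''(2)] yz by (auto simp: mult_less_0_iff)
    then have "\<not> (s * Im (h y) > 0 \<and> s * Im (h z) > 0)" for s
      using same[OF yz(1,2) yz(5,6), of s] by auto
    from this[of 1] this[of "-1"] show "Im (h y) * Im (h z) < 0" using nz
      by (auto simp: mult_less_0_iff linorder_neq_iff)
  qed
qed

text \<open>Expresses that \<open>X\<close> and \<open>Y\<close> border a common sector of the
  complement of \<open>K\<close> at \<open>x\<close>, without speaking of an order of rays:
  arbitrarily small connected sets off \<open>K\<close> have limit points on both.\<close>

definition corner :: "complex \<Rightarrow> complex set \<Rightarrow> complex set \<Rightarrow> complex set \<Rightarrow> bool" where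
  "corner x K X Y \<longleftrightarrow> (\<forall>r>0. \<exists>S. connected S \<and> S \<noteq> {} \<and> S \<subseteq> ball x r - K \<and>
     closure S \<inter> X \<inter> ball x r \<noteq> {} \<and> closure S \<inter> Y \<inter> ball x r \<noteq> {})"

lemma same_sign: "a * c < 0 \<Longrightarrow> b * c < 0 \<Longrightarrow> s * a > 0 \<Longrightarrow> s * b > 0" for a b c s :: real
  by (auto simp: mult_less_0_iff zero_less_mult_iff)

lemma opposite_sign: "a * b < 0 \<Longrightarrow> s * b > 0 \<Longrightarrow> s * a < 0" for a b s :: real
  by (auto simp: mult_less_0_iff zero_less_mult_iff)

text \<open>In a chart for \<open>A\<close> and \<open>B\<close> the two halves of \<open>C\<close>
  lie on different sides of both axes, hence near \<open>x\<close> in opposite quadrants. The other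
  two quadrants are free of \<open>C\<close>, and each of them is a corner between a half of
  \<open>A\<close> and a half of \<open>B\<close>. So charts for pairs of curves suffice to find
  corners among three.\<close>

theorem transversal_corners:
  assumes AB: "meet_transversally_at A B x" and AC: "meet_transversally_at A C x" "A \<inter> C = {x}"
    and BC: "meet_transversally_at B C x" "B \<inter> C = {x}"
    and sA: "split_at x A A1 A2" and sB: "split_at x B B1 B2" and sC: "split_at x C C1 C2"
  shows "corner x (A \<union> B \<union> C) A1 B1 \<and> corner x (A \<union> B \<union> C) A2 B2 \<or>
         corner x (A \<union> B \<union> C) A1 B2 \<and> corner x (A \<union> B \<union> C) A2 B1"
proof -
  obtain U h k where U: "open U" "x \<in> U" and hom: "homeomorphism U (UNIV :: complex set) h k" and hx: "h x = 0"
    and A: "h ` (A \<inter> U) = {z. Im z = 0}" and B: "h ` (B \<inter> U) = {z. Re z = 0}"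
    using AB unfolding meet_transversally_at_def by blast
  have hk: "h (k z) = z" "k z \<in> U" for z using hom by (auto simp: homeomorphism_def)
  have kh: "k (h z) = z" if "z \<in> U" for z using hom that by (auto simp: homeomorphism_def)
  have k0: "k 0 = x" using kh U hx by metis
  have contk: "continuous_on UNIV k" and conth: "continuous_on U h" using hom by (simp_all add: homeomorphism_def)
  have "homeomorphism UNIV UNIV (\<lambda>z. - \<i> * z) (\<lambda>z. \<i> * z)"
    by (rule homeomorphismI) (auto intro!: continuous_intros)
  from homeomorphism_compose[OF hom this]
  have hom2: "homeomorphism U UNIV (\<lambda>z. - \<i> * h z) (\<lambda>z. k (\<i> * z))" by (simp add: o_def)
  have B2: "(\<lambda>z. - \<i> * h z) ` (B \<inter> U) = {z. Im z = 0}"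
  proof -
    have "(\<lambda>z. - \<i> * h z) ` (B \<inter> U) = (\<lambda>z. - \<i> * z) ` (h ` (B \<inter> U))" by (simp only: image_image)
    then show ?thesis unfolding B rotate_axes .
  qed
  have hx2: "- \<i> * h x = 0" using hx by simp
  obtain a where a: "a = 1 \<or> a = (-1::real)"
    "\<And>z. z \<in> U \<Longrightarrow> (z \<in> A1 \<longleftrightarrow> Im (h z) = 0 \<and> a * Re (h z) > 0) \<and> (z \<in> A2 \<longleftrightarrow> Im (h z) = 0 \<and> a * Re (h z) < 0)"
    using axis_halves[OF U hom hx A sA] by metis
  obtain b where b: "b = 1 \<or> b = (-1::real)"
    "\<And>z. z \<in> U \<Longrightarrow> (z \<in> B1 \<longleftrightarrow> Re (h z) = 0 \<and> b * Im (h z) > 0) \<and> (z \<in> B2 \<longleftrightarrow> Re (h z) = 0 \<and> b * Im (h z) < 0)"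
    using axis_halves[OF U hom2 hx2 B2 sB] by simp metis
  obtain \<rho>1 where r1: "\<rho>1 > 0" "\<And>y z. y \<in> U \<Longrightarrow> z \<in> U \<Longrightarrow> y \<in> C1 \<Longrightarrow> z \<in> C2 \<Longrightarrow> norm (h y) < \<rho>1 \<Longrightarrow> norm (h z) < \<rho>1 \<Longrightarrow>
    Im (h y) * Im (h z) < 0"
    using opposite_sides[OF U hom hx A AC sC] by metis
  obtain \<rho>2 where r2: "\<rho>2 > 0" "\<And>y z. y \<in> U \<Longrightarrow> z \<in> U \<Longrightarrow> y \<in> C1 \<Longrightarrow> z \<in> C2 \<Longrightarrow> norm (h y) < \<rho>2 \<Longrightarrow> norm (h z) < \<rho>2 \<Longrightarrow>
    Re (h y) * Re (h z) < 0"
    using opposite_sides[OF U hom2 hx2 B2 BC sC] by (simp add: norm_mult) metis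
  define \<rho> where "\<rho> = min \<rho>1 \<rho>2"
  have r: "\<rho> > 0" using r1(1) r2(1) by (simp add: \<rho>_def)
  have opp: "Im (h y) * Im (h z) < 0 \<and> Re (h y) * Re (h z) < 0"
    if "y \<in> U" "z \<in> U" "y \<in> C1" "z \<in> C2" "norm (h y) < \<rho>" "norm (h z) < \<rho>" for y z
    using r1(2)[of y z] r2(2)[of y z] that by (simp add: \<rho>_def)
  have near: "\<exists>z. z \<in> Z \<and> z \<in> U \<and> norm (h z) < \<rho>" if Z: "x \<in> closure Z" for Z
  proof -
    have "open (U \<inter> h -` ball 0 \<rho>)" using conth U(1) by (simp add: continuous_open_preimage)
    moreover have "x \<in> U \<inter> h -` ball 0 \<rho>" using U hx r by simp
    ultimately have "Z \<inter> (U \<inter> h -` ball 0 \<rho>) \<noteq> {}"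
      using Z by (metis closure_iff_nhds_not_empty subset_refl Int_commute)
    then show ?thesis by auto
  qed
  have "x \<in> closure C1" "x \<in> closure C2" using sC unfolding split_at_def half_arc_def by auto
  then obtain c1 c2 where c1: "c1 \<in> C1" "c1 \<in> U" "norm (h c1) < \<rho>" and c2: "c2 \<in> C2" "c2 \<in> U" "norm (h c2) < \<rho>"
    using near by metis
  note c12 = opp[OF c1(2) c2(2) c1(1) c2(1) c1(3) c2(3)]
  \<comment> \<open>\<open>s\<close> and \<open>t\<close> are the signs of the real and the
    imaginary part in a quadrant. The sample point \<open>c1\<close> of \<open>C1\<close> tells
    which diagonal pair of quadrants \<open>C\<close> runs through, and the assumption
    \<open>st\<close> says that the given quadrant is not in that pair.\<close>
  have free: "corner x (A \<union> B \<union> C) X Y"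
    if X: "\<And>z. z \<in> U \<Longrightarrow> Im (h z) = 0 \<Longrightarrow> s * Re (h z) > 0 \<Longrightarrow> z \<in> X"
      and Y: "\<And>z. z \<in> U \<Longrightarrow> Re (h z) = 0 \<Longrightarrow> t * Im (h z) > 0 \<Longrightarrow> z \<in> Y"
      and s: "s = 1 \<or> s = -1" and t: "t = 1 \<or> t = -1"
      and st: "s * t * (Re (h c1) * Im (h c1)) < 0"
    for X Y :: "complex set" and s t :: real
    unfolding corner_def
  proof (intro allI impI)
    fix r' :: real assume r': "r' > 0"
    have "open (k -` ball x r')" using contk by (simp add: open_vimage)
    then obtain \<delta>' where d': "\<delta>' > 0" "ball 0 \<delta>' \<subseteq> k -` ball x r'"
      using k0 r' by (metis centre_in_ball open_contains_ball vimageI)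
    define \<delta> where "\<delta> = min \<delta>' \<rho>"
    have d: "\<delta> > 0" "\<delta> \<le> \<rho>" "ball 0 \<delta> \<subseteq> k -` ball x r'" using d' r unfolding \<delta>_def by auto
    define H where "H = {w. inner (complex_of_real s) w > 0} \<inter> {w. inner (Complex 0 t) w > 0} \<inter> ball 0 \<delta>"
    have H: "w \<in> H \<longleftrightarrow> s * Re w > 0 \<and> t * Im w > 0 \<and> norm w < \<delta>" for w
      by (auto simp: H_def inner_complex_def)
    have "connected H" unfolding H_def by (intro convex_connected convex_Int convex_halfspace_gt convex_ball)
    then have con: "connected (k ` H)" 
      using connected_continuous_image[OF continuous_on_subset[OF contk subset_UNIV]] by blast
    have lim: "k w \<in> closure (k ` H) \<inter> ball x r'"
      if w: "norm w < \<delta>" "\<And>e. e > 0 \<Longrightarrow> \<exists>v\<in>H. dist v w < e" for w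
    proof -
      have "w \<in> closure H" using w(2) by (simp add: closure_approachable)
      then have "k w \<in> closure (k ` H)"
        using image_closure_subset[OF continuous_on_subset[OF contk subset_UNIV] closed_closure closure_subset] by blast
      moreover have "k w \<in> ball x r'" using d(3) w(1) by auto
      ultimately show ?thesis by blast
    qed
    let ?w = "complex_of_real (s * \<delta> / 2)" and ?v = "Complex 0 (t * \<delta> / 2)"
    have Lw: "k ?w \<in> closure (k ` H) \<inter> ball x r'"
    proof (rule lim)
      show "norm ?w < \<delta>" using s d by (auto simp: norm_mult)
      fix e :: real assume e: "e > 0"
      let ?q = "Complex (s * \<delta> / 2) (t * min (e / 2) (\<delta> / 4))"
      have "norm ?q \<le> \<bar>s * \<delta> / 2\<bar> + \<bar>t * min (e / 2) (\<delta> / 4)\<bar>"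
        using cmod_le[of ?q] by simp
      also have "\<dots> < \<delta>" using s t d e by (auto simp: abs_mult)
      finally have "?q \<in> H" unfolding H using s t d e by auto
      moreover have "dist ?q ?w < e"
      proof -
        have "?q - ?w = Complex 0 (t * min (e / 2) (\<delta> / 4))" by (simp add: complex_eq_iff)
        then show ?thesis using t e d by (auto simp: dist_norm cmod_def abs_mult)
      qed
      ultimately show "\<exists>v\<in>H. dist v ?w < e" by blast
    qed
    have Lv: "k ?v \<in> closure (k ` H) \<inter> ball x r'"
    proof (rule lim)
      show "norm ?v < \<delta>" using t d by (auto simp: cmod_def)
      fix e :: real assume e: "e > 0"
      let ?q = "Complex (s * min (e / 2) (\<delta> / 4)) (t * \<delta> / 2)"
      have "norm ?q \<le> \<bar>s * min (e / 2) (\<delta> / 4)\<bar> + \<bar>t * \<delta> / 2\<bar>"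
        using cmod_le[of ?q] by simp
      also have "\<dots> < \<delta>" using s t d e by (auto simp: abs_mult)
      finally have "?q \<in> H" unfolding H using s t d e by auto
      moreover have "dist ?q ?v < e"
      proof -
        have "?q - ?v = Complex (s * min (e / 2) (\<delta> / 4)) 0" by (simp add: complex_eq_iff)
        then show ?thesis using s e d by (auto simp: dist_norm cmod_def abs_mult)
      qed
      ultimately show "\<exists>v\<in>H. dist v ?v < e" by blast
    qed
    have "k ?w \<in> X" using X[OF hk(2)] hk(1) s d by auto
    moreover have "k ?v \<in> Y" using Y[OF hk(2)] hk(1) t d by auto
    moreover have "k ` H \<noteq> {}" using Lw by auto
    moreover have "k ` H \<subseteq> ball x r' - (A \<union> B \<union> C)"
    proof
      fix z assume "z \<in> k ` H"
      then obtain w where w: "w \<in> H" "z = k w" by blast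
      have z: "z \<in> U" "h z = w" using w hk by auto
      have "z \<in> ball x r'" using w H d(3) by auto
      moreover have "z \<notin> A" "z \<notin> B"
      proof -
        have "h z \<notin> {z. Im z = 0}" "h z \<notin> {z. Re z = 0}" using w(1) H z(2) by auto
        then show "z \<notin> A" "z \<notin> B" using A B z(1) by blast+
      qed
      moreover have "z \<notin> C"
      proof
        assume zC: "z \<in> C"
        have nx: "z \<noteq> x" using hx z(2) w(1) H by auto
        have zr: "norm (h z) < \<rho>" using z(2) w(1) H d(2) by auto
        have s1: "s * Re (h z) > 0" "t * Im (h z) > 0" using z(2) w(1) H by auto
        consider "z \<in> C1" | "z \<in> C2" using zC nx sC unfolding split_at_def by blast
        then show False
        proof cases
          case 1
          note o1 = opp[OF z(1) c2(2) 1 c2(1) zr c2(3)]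
          have "s * Re (h c1) > 0" "t * Im (h c1) > 0"
            using same_sign[of "Re (h z)" "Re (h c2)" "Re (h c1)" s] same_sign[of "Im (h z)" "Im (h c2)" "Im (h c1)" t]
              o1 c12 s1 by simp_all
          then have "0 < (s * Re (h c1)) * (t * Im (h c1))" by (rule mult_pos_pos)
          then show False using st by (simp add: mult_ac)
        next
          case 2
          note o2 = opp[OF c1(2) z(1) c1(1) 2 c1(3) zr]
          have "s * Re (h c1) < 0" "t * Im (h c1) < 0"
            using opposite_sign[of "Re (h c1)" "Re (h z)" s] opposite_sign[of "Im (h c1)" "Im (h z)" t] o2 s1 by simp_all
          then have "0 < (s * Re (h c1)) * (t * Im (h c1))" by (rule mult_neg_neg)
          then show False using st by (simp add: mult_ac)
        qed
      qed
      ultimately show "z \<in> ball x r' - (A \<union> B \<union> C)" by blast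
    qed
    ultimately show "\<exists>S. connected S \<and> S \<noteq> {} \<and> S \<subseteq> ball x r' - (A \<union> B \<union> C) \<and>
       closure S \<inter> X \<inter> ball x r' \<noteq> {} \<and> closure S \<inter> Y \<inter> ball x r' \<noteq> {}"
      using con Lw Lv by blast
  qed
  have A1: "\<And>z. z \<in> U \<Longrightarrow> Im (h z) = 0 \<Longrightarrow> a * Re (h z) > 0 \<Longrightarrow> z \<in> A1"
    and A2: "\<And>z. z \<in> U \<Longrightarrow> Im (h z) = 0 \<Longrightarrow> (- a) * Re (h z) > 0 \<Longrightarrow> z \<in> A2"
    and B1: "\<And>z. z \<in> U \<Longrightarrow> Re (h z) = 0 \<Longrightarrow> b * Im (h z) > 0 \<Longrightarrow> z \<in> B1"
    and B2: "\<And>z. z \<in> U \<Longrightarrow> Re (h z) = 0 \<Longrightarrow> (- b) * Im (h z) > 0 \<Longrightarrow> z \<in> B2"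
    using a(2) b(2) by auto
  have ab: "- a = 1 \<or> - a = -1" "- b = 1 \<or> - b = -1" using a(1) b(1) by auto
  have "a * b * (Re (h c1) * Im (h c1)) \<noteq> 0" using c12 a(1) b(1) by auto
  then consider "a * b * (Re (h c1) * Im (h c1)) < 0" | "a * b * (Re (h c1) * Im (h c1)) > 0"
    by (meson linorder_neqE)
  then show ?thesis
  proof cases
    case 1
    then have "(- a) * (- b) * (Re (h c1) * Im (h c1)) < 0" by simp
    with 1 show ?thesis using free[OF A1 B1 a(1) b(1)] free[OF A2 B2 ab] by blast
  next
    case 2
    then have "a * (- b) * (Re (h c1) * Im (h c1)) < 0" "(- a) * b * (Re (h c1) * Im (h c1)) < 0" by simp_all
    then show ?thesis using free[OF A1 B2 a(1) ab(2)] free[OF A2 B1 ab(1) b(1)] by blast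
  qed
qed

section \<open>Winding numbers across an arc\<close>

lemma Ints_norm_less_1: "z \<in> \<int> \<Longrightarrow> norm (z :: complex) < 1 \<Longrightarrow> z = 0"
  by (auto elim!: Ints_cases simp: norm_of_int)

text \<open>\<open>\<Omega>\<close> is a sum of winding numbers of closed curves, one of which runs through \<open>g\<close>. Replacing the
  piece \<open>g\<close> by the detour \<open>t\<close> changes \<open>\<Omega>\<close> by the winding number of the Jordan curve \<open>g +++ t\<close>.\<close>

lemma winding_jump:
  fixes g t :: "real \<Rightarrow> complex" and \<Omega> R :: "complex \<Rightarrow> complex"
  assumes J: "simple_path (g +++ t)" and gt: "arc g" "arc t" "pathstart t = pathfinish g" "pathfinish t = pathstart g"
    and D: "D \<subseteq> inside (path_image (g +++ t))" "D' \<subseteq> outside (path_image (g +++ t))"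
    and m: "m \<in> closure D" "m \<in> closure D'" "m \<notin> path_image t" "continuous (at m) R"
    and \<epsilon>: "\<epsilon> = 1 \<or> \<epsilon> = -1"
    and \<Omega>: "\<And>z. z \<in> D \<union> D' \<Longrightarrow> \<Omega> z = \<epsilon> * winding_number g z + R z"
    and w: "\<And>z. z \<in> D \<Longrightarrow> \<Omega> z = w" "\<And>z. z \<in> D' \<Longrightarrow> \<Omega> z = w'" "w \<in> \<int>" "w' \<in> \<int>"
  shows "w - w' = 1 \<or> w - w' = -1"
proof -
  let ?J = "path_image (g +++ t)"
  have loop: "pathfinish (g +++ t) = pathstart (g +++ t)" using gt by simp
  have cases: "(\<forall>z \<in> inside ?J. winding_number (g +++ t) z = 1) \<or> (\<forall>z \<in> inside ?J. winding_number (g +++ t) z = -1)"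
    using simple_closed_path_winding_number_inside[OF J] loop by blast
  then obtain \<sigma> :: complex where \<sigma>: "\<sigma> = 1 \<or> \<sigma> = -1" "\<And>z. z \<in> inside ?J \<Longrightarrow> winding_number (g +++ t) z = \<sigma>"
    by metis
  have out: "winding_number (g +++ t) z = 0" if "z \<in> outside ?J" for z
    using winding_number_zero_in_outside[of "g +++ t" z] J loop that simple_path_imp_path by blast
  have split: "winding_number (g +++ t) z = winding_number g z + winding_number t z" if "z \<notin> ?J" for z
    using that gt by (intro winding_number_join) (auto simp: arc_imp_path path_image_join)
  \<comment> \<open>\<open>f\<close> no longer involves \<open>g\<close>, so it is continuous at
    \<open>m\<close>. On \<open>D\<close> and \<open>D'\<close> it equals \<open>\<Omega>\<close>
    minus a multiple of the winding number of the Jordan curve, which is an integer there, and a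
    continuous function cannot jump by a nonzero integer.\<close>
  define f where "f z = R z - \<epsilon> * winding_number t z" for z
  have "continuous (at m) f" unfolding f_def
    using continuous_at_winding_number[OF arc_imp_path[OF gt(2)] m(3)] m(4) by (intro continuous_intros)
  then have "\<forall>e>0. \<exists>d>0. \<forall>x. dist x m < d \<longrightarrow> dist (f x) (f m) < e" by (simp add: continuous_at_eps_delta)
  then obtain d where d: "d > 0" "\<And>x. dist x m < d \<Longrightarrow> dist (f x) (f m) < 1/2"
    by (metis half_gt_zero zero_less_one)
  obtain y where y: "y \<in> D" "dist y m < d" using m(1) d(1) by (meson closure_approachable)
  obtain z where z: "z \<in> D'" "dist z m < d" using m(2) d(1) by (meson closure_approachable)
  have "inside ?J \<inter> ?J = {}" "outside ?J \<inter> ?J = {}"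
    using inside_no_overlap outside_no_overlap by auto
  then have off: "y \<notin> ?J" "z \<notin> ?J" using y z D by blast+
  have f: "f x = \<Omega> x - \<epsilon> * winding_number (g +++ t) x" if "x \<in> D \<union> D'" "x \<notin> ?J" for x
    unfolding f_def \<Omega>[OF that(1)] split[OF that(2)] by (simp add: algebra_simps)
  have fy: "f y = w - \<epsilon> * \<sigma>"
    using f[of y] y off w(1)[OF y(1)] \<sigma>(2)[OF subsetD[OF D(1) y(1)]] by simp
  have fz: "f z = w'"
    using f[of z] z off w(2)[OF z(1)] out[OF subsetD[OF D(2) z(1)]] by simp
  have "dist (f y) (f z) < 1"
    using d(2)[OF y(2)] d(2)[OF z(2)] by (rule dist_triangle_half_l)
  then have "norm (w - \<epsilon> * \<sigma> - w') < 1" unfolding fy fz dist_norm .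
  moreover have "w - \<epsilon> * \<sigma> - w' \<in> \<int>" using w(3,4) \<epsilon> \<sigma>(1) by (auto intro!: Ints_diff)
  ultimately have "w - \<epsilon> * \<sigma> - w' = 0" using Ints_norm_less_1 by blast
  then have "w - w' = \<epsilon> * \<sigma>" by (simp add: algebra_simps)
  then show ?thesis using \<epsilon> \<sigma>(1) by auto
qed

section \<open>Plane near-triangulations with curved edges\<close>

text \<open>All that the argument retains of a drawing. Nodes are the vertices in
  \<open>U \<union> V\<close> and the triple points in \<open>X\<close>; \<open>ed p q\<close> is
  the edge that carries the segment from \<open>p\<close> to \<open>q\<close>, \<open>N e\<close>
  the set of nodes on \<open>e\<close>, and \<open>opp x q\<close> the node reached from
  \<open>q\<close> by passing straight on through \<open>x\<close>. \<open>\<kappa> c p q\<close> is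
  the other neighbour of \<open>p\<close> along the face of colour \<open>c\<close> at the segment
  \<open>p q\<close>, and \<open>side c p q\<close> marks the sides of the only quadrilateral of
  colour \<open>c\<close>. \<open>opp_order\<close> holds because the nodes beyond the two ends of a
  segment are different points of a simple arc.\<close>

locale near_triangulation =
  fixes U V X :: "'n set" and nb :: "'n \<Rightarrow> 'n \<Rightarrow> bool" and ed :: "'n \<Rightarrow> 'n \<Rightarrow> 'n set"
    and N :: "'n set \<Rightarrow> 'n set" and opp :: "'n \<Rightarrow> 'n \<Rightarrow> 'n"
    and \<kappa> :: "bool \<Rightarrow> 'n \<Rightarrow> 'n \<Rightarrow> 'n" and side :: "bool \<Rightarrow> 'n \<Rightarrow> 'n \<Rightarrow> bool"
    and E :: "'n set set"
  assumes card_UV: "card U = 4" "card V = 4" "U \<inter> V = {}"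
    and X_disj: "X \<inter> (U \<union> V) = {}"
    and E_def: "E = {{u, v} | u v. u \<in> U \<and> v \<in> V}"
    and nb_sym: "nb p q \<Longrightarrow> nb q p" and nb_irrefl: "\<not> nb p p"
    and ed_E: "nb p q \<Longrightarrow> ed p q \<in> E" and ed_N: "nb p q \<Longrightarrow> p \<in> N (ed p q)"
    and ed_sym: "nb p q \<Longrightarrow> ed p q = ed q p"
    and N_nodes: "e \<in> E \<Longrightarrow> N e \<subseteq> U \<union> V \<union> X"
    and N_ends: "e \<in> E \<Longrightarrow> N e \<inter> (U \<union> V) = e"
    and N_adj: "e \<in> E \<Longrightarrow> f \<in> E \<Longrightarrow> e \<noteq> f \<Longrightarrow> v \<in> e \<inter> f \<Longrightarrow> p \<in> N e \<Longrightarrow> p \<in> N f \<Longrightarrow> p = v"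
    and N_one: "e \<in> E \<Longrightarrow> f \<in> E \<Longrightarrow> p \<in> N e \<Longrightarrow> p \<in> N f \<Longrightarrow> q \<in> N e \<Longrightarrow> q \<in> N f \<Longrightarrow> p \<noteq> q \<Longrightarrow> e = f"
    and X_three: "x \<in> X \<Longrightarrow> card {e \<in> E. x \<in> N e} = 3"
    and end_nb: "e \<in> E \<Longrightarrow> v \<in> e \<Longrightarrow> \<exists>!q. nb v q \<and> ed v q = e"
    and uncrossed: "nb p q \<Longrightarrow> p \<in> U \<union> V \<Longrightarrow> q \<in> U \<union> V \<Longrightarrow> N (ed p q) = {p, q}"
    and opp_nb: "x \<in> X \<Longrightarrow> nb x q \<Longrightarrow> nb x (opp x q) \<and> ed x (opp x q) = ed x q \<and> opp x q \<noteq> q"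
    and opp_order: "x \<in> X \<Longrightarrow> y \<in> X \<Longrightarrow> nb x y \<Longrightarrow> opp x y \<noteq> opp y x"
    and \<kappa>_nb: "nb p q \<Longrightarrow> nb p (\<kappa> c p q)" and \<kappa>_inv: "nb p q \<Longrightarrow> \<kappa> c p (\<kappa> c p q) = q"
    and \<kappa>_neq: "nb p q \<Longrightarrow> \<kappa> c p q \<noteq> q"
    and opp_\<kappa>: "x \<in> X \<Longrightarrow> nb x q \<Longrightarrow> opp x q = \<kappa> c x (\<kappa> (\<not> c) x (\<kappa> c x q))"
    and X_ed: "x \<in> X \<Longrightarrow> nb x q \<Longrightarrow> ed x (\<kappa> c x q) \<noteq> ed x q"
    and X_ed2: "x \<in> X \<Longrightarrow> nb x q \<Longrightarrow> ed x (\<kappa> c x q) \<noteq> ed x (\<kappa> (\<not> c) x q)"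
    and side_sym: "side c p q \<Longrightarrow> side c q p"
    and tri: "nb p q \<Longrightarrow> \<not> side c p q \<Longrightarrow>
      \<kappa> c q p = \<kappa> c p q \<and> nb q (\<kappa> c p q) \<and> \<kappa> c (\<kappa> c p q) p = q"
    and tri_neq: "nb p q \<Longrightarrow> \<not> side c p q \<Longrightarrow> \<not> side (\<not> c) p q \<Longrightarrow> \<kappa> c p q \<noteq> \<kappa> (\<not> c) p q"
    and quad_ex: "\<exists>p q. side c p q"
    and quad: "side c p q \<Longrightarrow> nb p q \<and> \<kappa> c p q \<noteq> \<kappa> c q p \<and> side c p (\<kappa> c p q) \<and> nb (\<kappa> c p q) (\<kappa> c q p) \<and>
      \<kappa> c (\<kappa> c p q) p = \<kappa> c q p \<and>
      {y. \<exists>z. side c y z} = {p, q, \<kappa> c p q, \<kappa> c q p}"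
begin

lemma ed_N2: "nb p q \<Longrightarrow> q \<in> N (ed p q)"
  using ed_N ed_sym nb_sym by metis

lemma E_sub: "e \<in> E \<Longrightarrow> e \<subseteq> N e" using N_ends by blast

lemma ed_eqI: "nb p q \<Longrightarrow> e \<in> E \<Longrightarrow> p \<in> N e \<Longrightarrow> q \<in> N e \<Longrightarrow> ed p q = e"
  using N_one[OF ed_E _ ed_N] ed_N2 nb_irrefl by metis

lemma X_meet: "x \<in> X \<Longrightarrow> e \<in> E \<Longrightarrow> f \<in> E \<Longrightarrow> e \<noteq> f \<Longrightarrow> x \<in> N e \<Longrightarrow> x \<in> N f \<Longrightarrow> e \<inter> f = {}"
proof (rule ccontr)
  assume a: "x \<in> X" "e \<in> E" "f \<in> E" "e \<noteq> f" "x \<in> N e" "x \<in> N f" and "e \<inter> f \<noteq> {}"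
  then obtain v where v: "v \<in> e \<inter> f" by blast
  have "x = v" by (rule N_adj[OF a(2-4) v a(5,6)])
  moreover have "v \<in> U \<union> V" using N_ends[OF a(2)] v by blast
  ultimately show False using X_disj a(1) by blast
qed

lemma meet_X: "e \<in> E \<Longrightarrow> f \<in> E \<Longrightarrow> e \<inter> f = {} \<Longrightarrow> x \<in> N e \<Longrightarrow> x \<in> N f \<Longrightarrow> x \<in> X"
  using N_nodes N_ends by blast

lemma third_edge:
  assumes "x \<in> X" "e \<in> E" "f \<in> E" "e \<noteq> f" "x \<in> N e" "x \<in> N f"
  obtains g where "g \<in> E" "x \<in> N g" "g \<inter> e = {}" "g \<inter> f = {}"
proof -
  have "card {e, f} < card {e \<in> E. x \<in> N e}" using X_three[OF assms(1)] assms(4) by simp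
  then have "\<not> {e \<in> E. x \<in> N e} \<subseteq> {e, f}" by (metis card_mono finite.emptyI finite_insert leD)
  then obtain g where g: "g \<in> E" "x \<in> N g" "g \<noteq> e" "g \<noteq> f" by blast
  then show ?thesis using that X_meet assms by metis
qed

text \<open>\<open>opp_\<kappa>\<close> seen from a ray \<open>m\<close> in the middle: of six rays,
  the one two steps from \<open>m\<close> in one direction is opposite to the one next to
  \<open>m\<close> in the other direction.\<close>

lemma hex:
  assumes "x \<in> X" "nb x m"
  shows "\<kappa> c x (\<kappa> (\<not> c) x m) = opp x (\<kappa> c x m)"
  using opp_\<kappa>[OF assms(1) \<kappa>_nb[OF assms(2)], where c = c] \<kappa>_inv[OF assms(2)] by simp

lemma hex':
  assumes "x \<in> X" "nb x m"
  shows "\<kappa> (\<not> c) x (\<kappa> c x m) = opp x (\<kappa> (\<not> c) x m)"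
  using hex[OF assms, of "\<not> c"] by simp

lemma opp_neq: "x \<in> X \<Longrightarrow> nb x q \<Longrightarrow> opp x q \<noteq> x" using opp_nb nb_irrefl by metis

lemma opp_N: "x \<in> X \<Longrightarrow> nb x q \<Longrightarrow> opp x q \<in> N (ed x q)"
  using opp_nb ed_N2 by metis

lemma nb_O: "nb p q \<Longrightarrow> p \<in> U \<union> V \<Longrightarrow> q \<in> U \<union> V \<Longrightarrow> ed p q = {p, q}"
  using uncrossed[of p q] N_ends[OF ed_E[of p q]] by auto

lemma nb_bip:
  assumes "nb p q" "p \<in> U \<union> V" "q \<in> U \<union> V"
  shows "p \<in> U \<longleftrightarrow> q \<in> V"
proof -
  have "{p, q} \<in> E" using nb_O[OF assms] ed_E[OF assms(1)] by simp
  then show ?thesis unfolding E_def using card_UV(3) by (auto simp: doubleton_eq_iff)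
qed

lemma nb_X: "nb p q \<Longrightarrow> q \<in> U \<union> V \<union> X" using ed_N2 ed_E N_nodes by blast

text \<open>Otherwise \<open>u\<close>, \<open>a\<close> and \<open>y\<close> would be pairwise
  joined by uncrossed edges, a triangle in a bipartite graph.\<close>

lemma common_nb_X:
  assumes "nb u a" "u \<in> U \<union> V" "a \<in> U \<union> V" "nb u y" "nb a y"
  shows "y \<in> X"
proof (rule ccontr)
  assume "y \<notin> X"
  then have y: "y \<in> U \<union> V" using nb_X[OF assms(4)] by blast
  then have "a \<in> U \<longleftrightarrow> y \<in> V" "u \<in> U \<longleftrightarrow> y \<in> V" "u \<in> U \<longleftrightarrow> a \<in> V" using nb_bip assms by metis+
  then show False using assms(3) card_UV(3) y by blast
qed

lemma tri3:
  assumes "nb p q" "\<not> side c p q" "\<kappa> c p q = r"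
  shows "\<kappa> c q p = r" "nb q r" "nb p r" "\<kappa> c r p = q" "\<kappa> c r q = p" "\<kappa> c p r = q" "\<kappa> c q r = p"
proof -
  show 1: "\<kappa> c q p = r" "nb q r" "\<kappa> c r p = q" using tri[OF assms(1,2)] assms(3) by auto
  show 2: "nb p r" "\<kappa> c p r = q" using \<kappa>_nb[OF assms(1), of c] \<kappa>_inv[OF assms(1), of c] assms(3) by auto
  show "\<kappa> c r q = p" using \<kappa>_inv[OF nb_sym[OF 2(1)], of c] 1 by simp
  show "\<kappa> c q r = p" using \<kappa>_inv[OF nb_sym[OF assms(1)], of c] 1 by simp
qed

definition Q where "Q c = {y. \<exists>z. side c y z}"

lemma not_Q: "p \<notin> Q c \<Longrightarrow> \<not> side c p q" "q \<notin> Q c \<Longrightarrow> \<not> side c p q"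
  unfolding Q_def using side_sym by blast+

lemma quad_Q:
  assumes "side c p q" "\<kappa> c p q = r" "\<kappa> c q p = s"
  shows "Q c = {p, q, r, s}" "nb r s" "\<kappa> c r p = s" "\<kappa> c s q = r" "r \<noteq> s" "nb p q" "nb p r" "nb q s"
    "side c p r" "side c q s" "\<kappa> c s r = q" "\<kappa> c r s = p"
proof -
  note q1 = quad[OF assms(1), unfolded assms(2,3)]
  note q2 = quad[OF side_sym[OF assms(1)], unfolded assms(2,3)]
  show Q: "Q c = {p, q, r, s}" using q1 unfolding Q_def by blast
  show n: "nb r s" "\<kappa> c r p = s" "\<kappa> c s q = r" "r \<noteq> s" "nb p q" "side c p r" "side c q s" using q1 q2 by auto
  show "nb p r" "nb q s" using \<kappa>_nb[OF n(5), of c] \<kappa>_nb[OF nb_sym[OF n(5)], of c] assms by auto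
  then have "nb r p" "nb s q" using nb_sym by blast+
  then show "\<kappa> c s r = q" "\<kappa> c r s = p" using \<kappa>_inv[of s q c] \<kappa>_inv[of r p c] n by auto
qed

definition "parts W W' \<longleftrightarrow> W = U \<and> W' = V \<or> W = V \<and> W' = U"

lemma parts_facts:
  assumes "parts W W'"
  shows "W \<union> W' = U \<union> V" "W \<inter> W' = {}" "card W = 4" "card W' = 4" "E = {{u, v} | u v. u \<in> W \<and> v \<in> W'}" "parts W' W"
  using assms card_UV unfolding parts_def E_def by (auto simp: insert_commute)

lemma card_nbs:
  assumes v: "v \<in> U \<union> V"
  shows "card {q. nb v q} = 4"
proof -
  obtain W W' where p: "parts W W'" "v \<in> W" using v unfolding parts_def by blast
  note pf = parts_facts[OF p(1)]
  have "bij_betw (ed v) {q. nb v q} ((\<lambda>w. {v, w}) ` W')"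
  proof (rule bij_betw_imageI)
    show "inj_on (ed v) {q. nb v q}"
    proof (rule inj_onI)
      fix q r assume qr: "q \<in> {q. nb v q}" "r \<in> {q. nb v q}" "ed v q = ed v r"
      then have "ed v q \<in> E" "v \<in> ed v q" using ed_E N_ends ed_N v by fastforce+
      then show "q = r" using end_nb qr by (metis mem_Collect_eq)
    qed
    show "ed v ` {q. nb v q} = (\<lambda>w. {v, w}) ` W'"
    proof (intro equalityI subsetI)
      fix e assume "e \<in> ed v ` {q. nb v q}"
      then have "e \<in> E" "v \<in> e" using ed_E N_ends ed_N v by fastforce+
      then show "e \<in> (\<lambda>w. {v, w}) ` W'" using pf(2,5) p(2) by (auto simp: doubleton_eq_iff)
    next
      fix e assume "e \<in> (\<lambda>w. {v, w}) ` W'"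
      then have "e \<in> E" "v \<in> e" using pf(5) p(2) by auto
      then show "e \<in> ed v ` {q. nb v q}" using end_nb by (metis imageI mem_Collect_eq)
    qed
  qed
  then have "card {q. nb v q} = card ((\<lambda>w. {v, w}) ` W')" by (rule bij_betw_same_card)
  also have "\<dots> = 4" using pf(2,4) p(2) by (subst card_image) (auto simp: inj_on_def doubleton_eq_iff)
  finally show ?thesis .
qed

text \<open>A vertex has four neighbours, on which both involutions act without fixed points.
  \<open>ne\<close> excludes that they send \<open>q\<close> to the same neighbour, in which case
  the four would fall into two orbits; so turning around \<open>v\<close> runs through all of them
  in one cycle.\<close>

lemma link4:
  assumes v: "v \<in> U \<union> V" and q: "nb v q" and ne: "\<kappa> c v q \<noteq> \<kappa> (\<not> c) v q"
  shows "\<kappa> c v (\<kappa> (\<not> c) v q) = \<kappa> (\<not> c) v (\<kappa> c v q)"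
    "distinct [q, \<kappa> c v q, \<kappa> (\<not> c) v q, \<kappa> c v (\<kappa> (\<not> c) v q)]"
    "{r. nb v r} = {q, \<kappa> c v q, \<kappa> (\<not> c) v q, \<kappa> c v (\<kappa> (\<not> c) v q)}"
proof -
  let ?a = "\<kappa> c v q" and ?b = "\<kappa> (\<not> c) v q"
  let ?d = "\<kappa> (\<not> c) v ?a"
  have n: "nb v ?a" "nb v ?b" "nb v ?d" using q \<kappa>_nb by metis+
  have d: "distinct [q, ?a, ?b, ?d]"
    using \<kappa>_neq \<kappa>_inv n q ne by (metis distinct_length_2_or_more distinct_singleton)
  have "finite {r. nb v r}" using card_nbs[OF v] by (metis card.infinite zero_neq_numeral)
  moreover have "{q, ?a, ?b, ?d} \<subseteq> {r. nb v r}" using n q by blast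
  moreover have "card {q, ?a, ?b, ?d} = 4" using d by simp
  ultimately have all: "{r. nb v r} = {q, ?a, ?b, ?d}" using card_nbs[OF v] by (metis card_subset_eq)
  have "\<kappa> c v ?b \<in> {q, ?a, ?b, ?d}" using all n(2) \<kappa>_nb by blast
  moreover have "\<kappa> c v ?b \<noteq> ?b" "\<kappa> c v ?b \<noteq> q" "\<kappa> c v ?b \<noteq> ?a"
    using \<kappa>_neq[OF n(2)] \<kappa>_inv[OF n(2), of c] \<kappa>_inv[OF q, of c] d by (auto simp: \<kappa>_inv q)
  ultimately have eq: "\<kappa> c v ?b = ?d" by blast
  then show "\<kappa> c v ?b = ?d" "distinct [q, ?a, ?b, \<kappa> c v ?b]" "{r. nb v r} = {q, ?a, ?b, \<kappa> c v ?b}"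
    using d all by simp_all
qed

definition "clean u \<longleftrightarrow> u \<in> U \<union> V \<and> u \<notin> Q True \<and> u \<notin> Q False"

lemma clean_Q: "clean u \<Longrightarrow> u \<notin> Q c" unfolding clean_def by (cases c) auto

lemma clean_side: "clean u \<Longrightarrow> \<not> side c u q" using clean_Q not_Q by blast

lemma clean_neq: "clean u \<Longrightarrow> nb u q \<Longrightarrow> \<kappa> c u q \<noteq> \<kappa> (\<not> c) u q"
  using tri_neq clean_side by blast

text \<open>The edges through \<open>x2, x3\<close> and through \<open>x1, x4\<close> would meet on both sides of \<open>u\<close>.\<close>

lemma lens:
  assumes u: "clean u" and x2: "nb u x2" and x: "x1 = \<kappa> c u x2" "x3 = \<kappa> (\<not> c) u x2" "x4 = \<kappa> c u x3"
    and X: "x1 \<in> X" "x2 \<in> X" "x3 \<in> X" "x4 \<in> X"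
  shows "side (\<not> c) x1 x2 \<or> side (\<not> c) x3 x4"
proof (rule ccontr)
  assume no: "\<not> ?thesis"
  have uO: "u \<in> U \<union> V" using u unfolding clean_def by simp
  note l = link4[OF uO x2 clean_neq[OF u x2], of c, folded x]
  have nb: "nb u x1" "nb u x3" "nb u x4" using l(3) by auto
  have x14: "\<kappa> (\<not> c) u x1 = x4" using l(1) x by simp
  note t12 = tri3[OF x2 clean_side[OF u] x(1)[symmetric]]
  note t23 = tri3[OF x2 clean_side[OF u] x(2)[symmetric]]
  note t34 = tri3[OF nb(2) clean_side[OF u] x(3)[symmetric]]
  note t14 = tri3[OF nb(1) clean_side[OF u] x14]
  have h: "\<kappa> (\<not> c) x2 x1 = opp x2 x3" "\<kappa> (\<not> c) x1 x2 = opp x1 x4"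
    "\<kappa> (\<not> c) x3 x4 = opp x3 x2" "\<kappa> (\<not> c) x4 x3 = opp x4 x1"
    using hex'[OF X(2) nb_sym[OF x2], of c] hex'[OF X(1) nb_sym[OF nb(1)], of c]
      hex'[OF X(3) nb_sym[OF nb(2)], of c] hex'[OF X(4) nb_sym[OF nb(3)], of c] t12 t23 t34 t14 by simp_all
  have n12: "nb x1 x2" and n34: "nb x3 x4" and n23: "nb x2 x3" and n14: "nb x1 x4"
    using t12 t34 t23 t14 nb_sym by blast+
  \<comment> \<open>The faces of colour \<open>\<not> c\<close> beyond \<open>x1 x2\<close> and
    beyond \<open>x3 x4\<close> are now triangles. Their third corners lie on both prolonged edges,
    beyond different ends of the segment \<open>x2 x3\<close>.\<close>
  have e: "opp x2 x3 = opp x1 x4" "opp x3 x2 = opp x4 x1"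
    using tri3(1)[OF n12, of "\<not> c"] tri3(1)[OF n34, of "\<not> c"] no h by auto
  let ?g = "ed x2 x3" and ?f = "ed x1 x4"
  have gE: "?g \<in> E" "?f \<in> E" using ed_E n23 n14 by auto
  have mem: "opp x2 x3 \<in> N ?g" "opp x3 x2 \<in> N ?g" "opp x2 x3 \<in> N ?f" "opp x3 x2 \<in> N ?f"
    using opp_N X n23 n14 nb_sym ed_sym e by metis+
  have "?g \<noteq> ?f"
  proof
    assume "?g = ?f"
    then have "x1 \<in> N ?g" "x2 \<in> N ?g" using ed_N[OF n23] ed_N[OF n14] by simp_all
    then have "ed x1 x2 = ?g" using ed_eqI n12 gE by blast
    then have "ed x2 x1 = ed x2 x3" using ed_sym n12 by metis
    then show False using X_ed2[OF X(2) nb_sym[OF x2], of c] t12 t23 by simp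
  qed
  then have "opp x2 x3 = opp x3 x2" using N_one[OF gE mem(1,3,2,4)] by blast
  then show False using opp_order X n23 by blast
qed

end

section \<open>The wheel around a clean vertex with an uncrossed edge\<close>

text \<open>\<open>u\<close> is the hub and \<open>a\<close>, \<open>x2\<close>, \<open>x3\<close>,
  \<open>x4\<close> is the rim in cyclic order; the triangle \<open>u a x2\<close> has colour
  \<open>c\<close> and the triangle \<open>u a x4\<close> has colour \<open>\<not> c\<close>.
  \<open>k\<close> is the fourth neighbour of \<open>a\<close>, opposite to \<open>u\<close> in the
  rotation at \<open>a\<close>. As \<open>c\<close> is a parameter, every statement also covers the
  reflected wheel, in which \<open>x2\<close> and \<open>x4\<close> are exchanged.\<close>

locale wheel = near_triangulation +
  fixes W W' :: "'a set" and u a :: 'a and c :: bool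
  assumes parts: "parts W W'" and uW: "u \<in> W" and clean: "clean u" and ua: "nb u a" and aO: "a \<in> U \<union> V"
begin

definition "x2 = \<kappa> c u a"
definition "x4 = \<kappa> (\<not> c) u a"
definition "x3 = \<kappa> c u x4"
definition "k = \<kappa> (\<not> c) a x2"

lemma uO: "u \<in> U \<union> V" using uW parts_facts(1)[OF parts] by blast

lemmas lk = link4[OF uO ua clean_neq[OF clean ua], of c, folded x2_def x4_def, folded x3_def]

lemma nbs: "nb u x2" "nb u x3" "nb u x4"
  using lk(3) by auto

lemma x23: "\<kappa> (\<not> c) u x2 = x3" using lk(1) by simp

lemmas t12 = tri3[OF ua clean_side[OF clean] x2_def[symmetric]]
lemmas t14 = tri3[OF ua clean_side[OF clean] x4_def[symmetric]]
lemmas t23 = tri3[OF nbs(1) clean_side[OF clean] x23]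
lemmas t34 = tri3[OF nbs(3) clean_side[OF clean] x3_def[symmetric]]

lemma aW: "a \<in> W'"
  using nb_bip[OF ua uO aO] uW parts parts_facts(1,2)[OF parts] aO unfolding parts_def by blast

lemmas third_X = common_nb_X[OF ua uO aO]

lemma x2X: "x2 \<in> X" using third_X t12 by blast
lemma x4X: "x4 \<in> X" using third_X t14 by blast

lemma neqs: "x2 \<noteq> x4" "x3 \<noteq> x2" "x3 \<noteq> x4" "a \<noteq> x2" "a \<noteq> x3" "a \<noteq> x4" "u \<noteq> a" "u \<noteq> x2" "u \<noteq> x3" "u \<noteq> x4"
  using lk(2) ua nbs nb_irrefl by auto

lemma a_link: "\<kappa> c a x4 = k" "distinct [u, x2, x4, k]" "{r. nb a r} = {u, x2, x4, k}"
proof -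
  have a: "\<kappa> c a u = x2" "\<kappa> (\<not> c) a u = x4" using t12 t14 by auto
  then have "\<kappa> c a u \<noteq> \<kappa> (\<not> c) a u" using neqs by simp
  note l = link4[OF aO nb_sym[OF ua] this, unfolded a]
  show "\<kappa> c a x4 = k" using l(1) unfolding k_def by simp
  then show "distinct [u, x2, x4, k]" "{r. nb a r} = {u, x2, x4, k}" using l by simp_all
qed

lemma ak: "nb a k" using a_link(3) by blast

lemma k_neqs: "k \<noteq> u" "k \<noteq> x2" "k \<noteq> x4" "k \<noteq> a" using a_link(2) ak nb_irrefl by auto

lemma hex2: "\<kappa> (\<not> c) x2 a = opp x2 x3" "\<kappa> c x2 x3 = opp x2 a"
  using hex'[OF x2X nb_sym[OF nbs(1)], of c] hex[OF x2X nb_sym[OF nbs(1)], of c] t12 t23 by simp_all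

lemma hex4: "\<kappa> c x4 a = opp x4 x3" "\<kappa> (\<not> c) x4 x3 = opp x4 a"
  using hex[OF x4X nb_sym[OF nbs(3)], of c] hex'[OF x4X nb_sym[OF nbs(3)], of c] t14 t34 by simp_all

lemma hex3:
  assumes "x3 \<in> X"
  shows "\<kappa> (\<not> c) x3 x4 = opp x3 x2" "\<kappa> c x3 x2 = opp x3 x4"
  using hex[OF assms nb_sym[OF nbs(2)], of c] hex'[OF assms nb_sym[OF nbs(2)], of c] t23 t34 by simp_all

lemma n23: "nb x2 x3" and n34: "nb x3 x4" and na2: "nb a x2" and na4: "nb a x4"
  using t12 t14 t23 t34 nb_sym by blast+

lemma ed_23_34: "ed x2 x3 \<noteq> ed x3 x4"
proof (cases "x3 \<in> X")
  case True
  then show ?thesis using X_ed2[OF True nb_sym[OF nbs(2)], of c] t23 t34 ed_sym[OF n23] by simp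
next
  case False
  then have O: "x3 \<in> U \<union> V" using nb_X nbs(2) by blast
  show ?thesis
  proof
    assume "ed x2 x3 = ed x3 x4"
    then have eq: "ed x3 x2 = ed x3 x4" using ed_sym n23 by metis
    have "ed x3 x4 \<in> E" "x3 \<in> ed x3 x4" using ed_E n34 N_ends ed_N O by fastforce+
    then show False using end_nb eq n34 nb_sym[OF n23] neqs(1) by blast
  qed
qed

lemma k_opp2: "\<not> side (\<not> c) a x2 \<Longrightarrow> k = opp x2 x3"
  using tri3(1)[OF na2 _ k_def[symmetric]] hex2 by simp

lemma k_opp4: "\<not> side c a x4 \<Longrightarrow> k = opp x4 x3"
  using tri3(1)[OF na4 _ a_link(1)] hex4 by simp

text \<open>If triangles lay beyond both \<open>a x2\<close> and \<open>a x4\<close>, then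
  \<open>k\<close> would be the continuation of \<open>x3 x2\<close> as well as of
  \<open>x3 x4\<close>, and the two edges carrying these segments would meet in \<open>x3\<close>
  and again in \<open>k\<close>.\<close>

lemma bad_corner: "side (\<not> c) a x2 \<or> side c a x4"
proof (rule ccontr)
  assume no: "\<not> ?thesis"
  then have k: "k = opp x2 x3" "k = opp x4 x3" using k_opp2 k_opp4 by auto
  have "k \<in> N (ed x2 x3)" "k \<in> N (ed x3 x4)"
    using k opp_N x2X x4X n23 n34 nb_sym ed_sym by metis+
  moreover have "x3 \<in> N (ed x2 x3)" "x3 \<in> N (ed x3 x4)" using ed_N ed_N2 n23 n34 by blast+
  moreover have "k \<noteq> x3" using k(1) opp_nb x2X n23 by metis
  ultimately show False using N_one ed_E n23 n34 ed_23_34 by metis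
qed

end

section \<open>Far ends of the edges that pass through a wheel\<close>

context near_triangulation
begin

text \<open>The vertex at the far end of the edge that leaves the vertex \<open>v\<close> through
  its neighbour \<open>q\<close>.\<close>

definition "oth v q = (SOME w. ed v q = {v, w})"

lemma edge_parts: "parts W W' \<Longrightarrow> f \<in> E \<Longrightarrow> \<exists>p \<in> W. \<exists>q \<in> W'. f = {p, q}"
  using parts_facts(5)[of W W'] by auto

lemma oth:
  assumes "parts W W'" "v \<in> W" "nb v q"
  shows "ed v q = {v, oth v q}" "oth v q \<in> W'"
proof -
  note pf = parts_facts[OF assms(1)]
  have e: "ed v q \<in> E" "v \<in> N (ed v q)" using ed_E ed_N assms(3) by auto
  then have "v \<in> ed v q" using N_ends[OF e(1)] pf(1) assms(2) by blast
  moreover obtain p w where pw: "p \<in> W" "w \<in> W'" "ed v q = {p, w}" using edge_parts[OF assms(1) e(1)] by blast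
  ultimately have w: "ed v q = {v, w}" "w \<in> W'" using assms(2) pf(2) by auto
  then have 1: "ed v q = {v, oth v q}" unfolding oth_def by (metis (mono_tags) someI)
  then show "ed v q = {v, oth v q}" .
  have "oth v q = w" using 1 w by (metis doubleton_eq_iff)
  then show "oth v q \<in> W'" using w by simp
qed

lemma ed_inj: "v \<in> U \<union> V \<Longrightarrow> nb v q \<Longrightarrow> nb v r \<Longrightarrow> ed v q = ed v r \<Longrightarrow> q = r"
proof -
  assume a: "v \<in> U \<union> V" "nb v q" "nb v r" "ed v q = ed v r"
  have "v \<in> ed v q" using N_ends[OF ed_E[OF a(2)]] ed_N[OF a(2)] a(1) by blast
  then show "q = r" using end_nb[OF ed_E[OF a(2)]] a by metis
qed

lemma oth_all:
  assumes "parts W W'" "v \<in> W" "{r. nb v r} = {q1, q2, q3, q4}" "distinct [q1, q2, q3, q4]"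
  shows "distinct [oth v q1, oth v q2, oth v q3, oth v q4]" "W' = {oth v q1, oth v q2, oth v q3, oth v q4}"
proof -
  note pf = parts_facts[OF assms(1)]
  have n: "nb v q1" "nb v q2" "nb v q3" "nb v q4" using assms(3) by auto
  have "q = r" if "nb v q" "nb v r" "oth v q = oth v r" for q r
    using oth(1)[OF assms(1,2)] that ed_inj[of v q r] pf(1) assms(2) by auto
  then show d: "distinct [oth v q1, oth v q2, oth v q3, oth v q4]" using n assms(4) by auto
  have sub: "{oth v q1, oth v q2, oth v q3, oth v q4} \<subseteq> W'" using oth(2)[OF assms(1,2)] n by blast
  have c: "card {oth v q1, oth v q2, oth v q3, oth v q4} = card W'" using d pf(4) by simp
  have "finite W'" using pf(4) by (metis card.infinite zero_neq_numeral)
  then show "W' = {oth v q1, oth v q2, oth v q3, oth v q4}" using card_subset_eq[OF _ sub c] by simp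
qed

lemma edgeI: "parts W W' \<Longrightarrow> p \<in> W \<Longrightarrow> q \<in> W' \<Longrightarrow> {p, q} \<in> E"
  using parts_facts(5)[of W W'] by auto

lemma pair_eq: "parts W W' \<Longrightarrow> p \<in> W \<Longrightarrow> q \<in> W' \<Longrightarrow> r \<in> W \<Longrightarrow> s \<in> W' \<Longrightarrow> {p, q} = {r, s} \<longleftrightarrow> p = r \<and> q = s"
  using parts_facts(2) by (auto simp: doubleton_eq_iff)

lemma pair_disj: "parts W W' \<Longrightarrow> p \<in> W \<Longrightarrow> q \<in> W' \<Longrightarrow> r \<in> W \<Longrightarrow> s \<in> W' \<Longrightarrow> {p, q} \<inter> {r, s} = {} \<longleftrightarrow> p \<noteq> r \<and> q \<noteq> s"
  using parts_facts(2) by auto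

lemma X_pair:
  assumes "parts W W'" "x \<in> X" "p \<in> W" "q \<in> W'" "r \<in> W" "s \<in> W'" "x \<in> N {p, q}" "x \<in> N {r, s}" "{p, q} \<noteq> {r, s}"
  shows "p \<noteq> r \<and> q \<noteq> s"
  using X_meet[OF assms(2) edgeI[OF assms(1,3,4)] edgeI[OF assms(1,5,6)] assms(9,7,8)] by auto

lemma meet_l:
  assumes "parts W W'" "p \<in> W" "q \<in> W'" "s \<in> W'" "q \<noteq> s" "y \<in> N {p, q}" "y \<in> N {p, s}"
  shows "y = p"
proof (rule N_adj[OF edgeI[OF assms(1-3)] edgeI[OF assms(1,2,4)]])
  show "{p, q} \<noteq> {p, s}" using assms(5) by (auto simp: doubleton_eq_iff)
qed (use assms in auto)

lemma meet_r:
  assumes "parts W W'" "p \<in> W" "r \<in> W" "q \<in> W'" "p \<noteq> r" "y \<in> N {p, q}" "y \<in> N {r, q}"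
  shows "y = q"
proof (rule N_adj[OF edgeI[OF assms(1,2,4)] edgeI[OF assms(1,3,4)]])
  show "{p, q} \<noteq> {r, q}" using assms(5) by (auto simp: doubleton_eq_iff)
qed (use assms in auto)

end

context wheel
begin

text \<open>The edges at \<open>u\<close> end in \<open>a\<close>, \<open>a2\<close>,
  \<open>a3\<close>, \<open>a4\<close> and the edges at \<open>a\<close> end in \<open>u\<close>,
  \<open>uh\<close>, \<open>uh'\<close>, \<open>uk\<close>; these are all eight vertices. So an edge
  met while tracing is a pair of these names, and it is identified by elimination: edges that share
  a triple point have no common end.\<close>

definition "a2 = oth u x2"
definition "a3 = oth u x3"
definition "a4 = oth u x4"
definition "uh = oth a x2"
definition "uh' = oth a x4"
definition "uk = oth a k"

lemmas parts' = parts_facts(6)[OF parts]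

lemma oth_a: "oth u a = a"
proof -
  have "ed u a = {u, a}" using nb_O[OF ua uO aO] .
  moreover have "ed u a = {u, oth u a}" using oth(1)[OF parts uW ua] .
  ultimately show ?thesis by (metis doubleton_eq_iff)
qed

lemma oth_u: "oth a u = u"
proof -
  have "ed a u = {a, u}" using nb_O[OF nb_sym[OF ua] aO uO] .
  moreover have "ed a u = {a, oth a u}" using oth(1)[OF parts' aW nb_sym[OF ua]] .
  ultimately show ?thesis by (metis doubleton_eq_iff)
qed

lemma W'_eq: "W' = {a, a2, a3, a4}" "distinct [a, a2, a3, a4]"
proof -
  have nb: "{r. nb u r} = {a, x2, x3, x4}" using lk(3) by auto
  have d: "distinct [a, x2, x3, x4]" using lk(2) by auto
  show "W' = {a, a2, a3, a4}" "distinct [a, a2, a3, a4]"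
    using oth_all[OF parts uW nb d] oth_a unfolding a2_def a3_def a4_def by simp_all
qed

lemma W_eq: "W = {u, uh, uh', uk}" "distinct [u, uh, uh', uk]"
  using oth_all[OF parts' aW a_link(3,2)] oth_u unfolding uh_def uh'_def uk_def by simp_all

lemma inW: "u \<in> W" "uh \<in> W" "uh' \<in> W" "uk \<in> W" "a \<in> W'" "a2 \<in> W'" "a3 \<in> W'" "a4 \<in> W'"
  using W_eq(1) W'_eq(1) by auto

lemma eds: "ed u x2 = {u, a2}" "ed u x3 = {u, a3}" "ed u x4 = {u, a4}"
  "ed a x2 = {uh, a}" "ed a x4 = {uh', a}" "ed a k = {uk, a}"
  using oth(1)[OF parts uW] oth(1)[OF parts' aW] nbs na2 na4 ak
  unfolding a2_def a3_def a4_def uh_def uh'_def uk_def by (auto simp: insert_commute)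

lemma mems: "x2 \<in> N {u, a2}" "x3 \<in> N {u, a3}" "x4 \<in> N {u, a4}" "x2 \<in> N {uh, a}" "x4 \<in> N {uh', a}" "k \<in> N {uk, a}"
  using ed_N2[OF nbs(1)] ed_N2[OF nbs(2)] ed_N2[OF nbs(3)] ed_N2[OF na2] ed_N2[OF na4] ed_N2[OF ak] eds by simp_all

lemma ua_unc: "x \<in> N {u, a} \<Longrightarrow> x \<notin> X"
  using uncrossed[OF ua uO aO] nb_O[OF ua uO aO] uO aO X_disj by auto

lemma not_O: "x \<in> X \<Longrightarrow> x \<notin> W" "x \<in> X \<Longrightarrow> x \<notin> W'"
  using X_disj parts_facts(1)[OF parts] by blast+

lemma W_O: "p \<in> W \<Longrightarrow> p \<in> U \<union> V" "p \<in> W' \<Longrightarrow> p \<in> U \<union> V"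
  using parts_facts(1)[OF parts] by blast+

lemma end_on: "p \<in> W \<Longrightarrow> q \<in> W' \<Longrightarrow> x \<in> U \<union> V \<Longrightarrow> x \<in> N {p, q} \<Longrightarrow> x = p \<or> x = q"
  using N_ends[OF edgeI[OF parts]] by blast

text \<open>The triple point \<open>x2\<close> already lies on \<open>{u, a2}\<close> and on
  \<open>{uh, a}\<close>, so the third edge through it, which carries \<open>x2 x3\<close>, avoids
  these four ends.\<close>

lemma x23_edge:
  obtains p q where "p \<in> W" "q \<in> W'" "ed x2 x3 = {p, q}" "p \<noteq> u" "p \<noteq> uh" "q \<noteq> a2" "q \<noteq> a"
proof -
  obtain p q where pq: "p \<in> W" "q \<in> W'" "ed x2 x3 = {p, q}"
    using edge_parts[OF parts ed_E[OF n23]] by blast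
  have x: "x2 \<in> N {p, q}" using ed_N[OF n23] pq(3) by simp
  have "ed x2 u \<noteq> ed x2 x3" using X_ed[OF x2X nb_sym[OF nbs(1)], of "\<not> c"] t23 by simp
  then have 1: "{p, q} \<noteq> {u, a2}" using eds(1) pq(3) ed_sym[OF nbs(1)] by simp
  have "ed x2 a \<noteq> ed x2 x3" using X_ed2[OF x2X nb_sym[OF nbs(1)], of c] t12 t23 by simp
  then have 2: "{p, q} \<noteq> {uh, a}" using eds(4) pq(3) ed_sym[OF na2] by simp
  show ?thesis
    using that[OF pq] X_pair[OF parts x2X pq(1,2) inW(1,6) x mems(1) 1]
      X_pair[OF parts x2X pq(1,2) inW(2,5) x mems(4) 2] by blast
qed

lemma x34_edge:
  obtains p q where "p \<in> W" "q \<in> W'" "ed x3 x4 = {p, q}" "p \<noteq> u" "p \<noteq> uh'" "q \<noteq> a4" "q \<noteq> a"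
proof -
  obtain p q where pq: "p \<in> W" "q \<in> W'" "ed x3 x4 = {p, q}"
    using edge_parts[OF parts ed_E[OF n34]] by blast
  have x: "x4 \<in> N {p, q}" using ed_N2[OF n34] pq(3) by simp
  have "ed x4 u \<noteq> ed x4 x3" using X_ed[OF x4X nb_sym[OF nbs(3)], of c] t34 by simp
  then have 1: "{p, q} \<noteq> {u, a4}" using eds(3) pq(3) ed_sym[OF nbs(3)] ed_sym[OF n34] by simp
  have "ed x4 a \<noteq> ed x4 x3" using X_ed2[OF x4X nb_sym[OF nbs(3)], of c] t34 t14 by simp
  then have 2: "{p, q} \<noteq> {uh', a}" using eds(5) pq(3) ed_sym[OF na4] ed_sym[OF n34] by simp
  show ?thesis
    using that[OF pq] X_pair[OF parts x4X pq(1,2) inW(1,8) x mems(3) 1]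
      X_pair[OF parts x4X pq(1,2) inW(3,5) x mems(5) 2] by blast
qed

end

section \<open>Wheels with a quadrilateral on only one side of the vertex \<open>a\<close>\<close>

text \<open>The asymmetric case left open by \<open>bad_corner\<close>, to be refuted: the
  quadrilateral of colour \<open>\<not> c\<close> lies beyond \<open>a x2\<close>, but a triangle
  lies beyond \<open>a x4\<close>. The fourth corner of that quadrilateral is \<open>w\<close>. At
  \<open>x4\<close> the rays in cyclic order lead to \<open>a\<close>, \<open>u\<close>,
  \<open>x3\<close>, \<open>z\<close>, \<open>y4\<close>, \<open>k\<close>.\<close>

locale bad_wheel = wheel +
  assumes bad: "side (\<not> c) a x2" and good: "\<not> side c a x4"
begin

definition "w = opp x2 x3"
definition "y4 = opp x4 u"
definition "z = opp x4 a"

lemma qd: "Q (\<not> c) = {a, x2, k, w}" "nb k w" "\<kappa> (\<not> c) k a = w" "\<kappa> (\<not> c) w x2 = k" "k \<noteq> w" "nb x2 w"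
  using quad_Q[OF bad k_def[symmetric] hex2(1)] unfolding w_def by auto

lemma k4: "k = opp x4 x3" using k_opp4 good .

lemma kN: "k \<in> N (ed x3 x4)" using opp_N[OF x4X nb_sym[OF n34]] ed_sym[OF n34] k4 by simp

lemma k_x3: "k \<noteq> x3" using opp_nb[OF x4X nb_sym[OF n34]] k4 by simp

lemma w_x3: "w \<noteq> x3" using opp_nb[OF x2X n23] unfolding w_def by simp

lemma wN: "w \<in> N (ed x2 x3)" using opp_N[OF x2X n23] unfolding w_def .

lemma x3N: "x3 \<in> N (ed x2 x3)" "x3 \<in> N (ed x3 x4)" using ed_N2[OF n23] ed_N[OF n34] by auto

lemma x4N: "x4 \<in> N (ed x3 x4)" using ed_N2[OF n34] .

lemma x4_w: "x4 \<noteq> w"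
proof
  assume "x4 = w"
  then show False using N_one[OF ed_E[OF n23] ed_E[OF n34] x3N wN] x4N ed_23_34 w_x3 by metis
qed

lemma x3_Q: "x3 \<notin> Q (\<not> c)" using qd(1) neqs k_x3 w_x3 by auto
lemma x4_Q: "x4 \<notin> Q (\<not> c)" using qd(1) neqs k_neqs x4_w by auto

lemmas tk = tri3[OF na4 good a_link(1)]

lemma nk4: "nb k x4" using tk nb_sym by blast

lemma y4_k: "\<kappa> (\<not> c) x4 k = y4"
proof -
  have "\<kappa> (\<not> c) x4 (\<kappa> c x4 a) = opp x4 (\<kappa> (\<not> c) x4 a)" using hex'[OF x4X nb_sym[OF na4]] .
  then show ?thesis unfolding y4_def using tk t14 by simp
qed

lemmas ty = tri3[OF nb_sym[OF nk4] not_Q(1)[OF x4_Q] y4_k]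

lemma z34: "\<kappa> (\<not> c) x4 x3 = z" using hex4(2) unfolding z_def .

lemmas tz = tri3[OF nb_sym[OF n34] not_Q(1)[OF x4_Q] z34]

lemma z_y4: "\<kappa> c x4 y4 = z"
proof -
  have "\<kappa> c x4 (\<kappa> (\<not> c) x4 k) = opp x4 (\<kappa> c x4 k)" using hex[OF x4X nb_sym[OF nk4]] .
  then show ?thesis using y4_k tk unfolding z_def by simp
qed

lemma y4N: "y4 \<in> N {u, a4}" using opp_N[OF x4X nb_sym[OF nbs(3)]] eds(3) ed_sym[OF nbs(3)] unfolding y4_def by simp
lemma zN: "z \<in> N {uh', a}" using opp_N[OF x4X nb_sym[OF na4]] eds(5) ed_sym[OF na4] unfolding z_def by simp
lemma y4_u: "y4 \<noteq> u" using opp_nb[OF x4X nb_sym[OF nbs(3)]] unfolding y4_def by simp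
lemma ed_x4y4: "ed x4 y4 = {u, a4}"
  using opp_nb[OF x4X nb_sym[OF nbs(3)]] eds(3) ed_sym[OF nbs(3)] unfolding y4_def by simp

lemma y4_O: "y4 \<notin> X \<Longrightarrow> y4 = a4"
  using end_on[OF inW(1,8) _ y4N] y4_u N_nodes[OF edgeI[OF parts inW(1,8)]] y4N by blast

lemma x4_e4: "x4 \<in> N f \<Longrightarrow> f \<in> E \<Longrightarrow> k \<in> N {u, a4} \<Longrightarrow> k \<in> N f \<Longrightarrow> f = {u, a4}"
  using N_one[of f "{u, a4}" x4 k] edgeI[OF parts inW(1,8)] mems(3) k_neqs(3) by auto

text \<open>A triple point \<open>k\<close> carries the edge \<open>{uk, a}\<close>, the edge
  \<open>{p', q'}\<close> of the segment \<open>x3 x4\<close>, and a third edge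
  \<open>{p, q}\<close> that runs through \<open>w\<close>, \<open>k\<close> and \<open>y4\<close>.
  Most inequalities say that these three are pairwise disjoint; \<open>p \<noteq> u\<close> holds
  because \<open>y4\<close> lies on \<open>{u, a4}\<close> as well.\<close>

lemma k_crossing:
  assumes kX: "k \<in> X" and r: "ed k y4 = {p, q}" "p \<in> W" "q \<in> W'" and g: "ed x3 x4 = {p', q'}" "p' \<in> W" "q' \<in> W'"
  shows "y4 = opp k w" "w \<in> N {p, q}" "k \<in> N {p, q}" "y4 \<in> N {p, q}" "p \<noteq> uk" "p \<noteq> p'" "q \<noteq> a" "q \<noteq> q'" "p \<noteq> u"
    "p' \<noteq> uk"
proof -
  have "\<kappa> (\<not> c) k (\<kappa> c k a) = opp k (\<kappa> (\<not> c) k a)" using hex'[OF kX nb_sym[OF ak]] .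
  then show yo: "y4 = opp k w" using tk ty qd by simp
  have edw: "ed k w = {p, q}" using opp_nb[OF kX qd(2)] yo r by simp
  show m: "w \<in> N {p, q}" "k \<in> N {p, q}" "y4 \<in> N {p, q}"
    using ed_N2[OF qd(2)] edw ed_N[OF qd(2)] ed_N2[of k y4] ty r nb_sym by auto
  have eg: "ed k x4 = {p', q'}"
    using ed_eqI[OF nk4 ed_E[OF n34] kN x4N] g by simp
  have 1: "{p, q} \<noteq> {uk, a}" using X_ed[OF kX nb_sym[OF ak], of "\<not> c"] qd(3) edw ed_sym[OF ak] eds(6) by auto
  have 2: "{p, q} \<noteq> {p', q'}" using X_ed2[OF kX nb_sym[OF ak], of c] qd(3) edw eg tk by auto
  have 3: "{p', q'} \<noteq> {uk, a}" using X_ed[OF kX nb_sym[OF ak], of c] eg ed_sym[OF ak] eds(6) tk by auto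
  have kg: "k \<in> N {p', q'}" using kN g by simp
  show "p \<noteq> uk" "q \<noteq> a" using X_pair[OF parts kX r(2,3) inW(4,5) m(2) mems(6) 1] by auto
  show "p \<noteq> p'" "q \<noteq> q'" using X_pair[OF parts kX r(2,3) g(2,3) m(2) kg 2] by auto
  show "p' \<noteq> uk" using X_pair[OF parts kX g(2,3) inW(4,5) kg mems(6) 3] by auto
  show "p \<noteq> u"
  proof
    assume pu: "p = u"
    show False
    proof (cases "q = a4")
      case True
      then have "{p', q'} = {u, a4}" using x4_e4[of "{p', q'}"] x4N g kg m(2) pu edgeI[OF parts] by auto
      then show False using 2 True pu by simp
    next
      case False
      then show False using meet_l[OF parts inW(1) r(3) inW(8)] m(3) y4N pu y4_u by blast
    qed
  qed
qed

end

section \<open>The rim node \<open>x3\<close> is a vertex\<close>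

context bad_wheel
begin

lemma pairE: "{p, q} \<in> E" if "p \<in> W" "q \<in> W'" for p q
  using edgeI[OF parts that] .

lemma ne_WW': "p \<in> W \<Longrightarrow> q \<in> W' \<Longrightarrow> p \<noteq> q"
  using parts_facts(2)[OF parts] by blast

lemma two_common: "x \<in> N {p, q} \<Longrightarrow> x \<in> N {r, s} \<Longrightarrow> y \<in> N {p, q} \<Longrightarrow> y \<in> N {r, s} \<Longrightarrow> x \<noteq> y \<Longrightarrow>
    p \<in> W \<Longrightarrow> q \<in> W' \<Longrightarrow> r \<in> W \<Longrightarrow> s \<in> W' \<Longrightarrow> p = r \<and> q = s"
  using N_one[of "{p, q}" "{r, s}" x y] pairE pair_eq[OF parts, of p q r s] by auto

lemma k_end: "k \<notin> X \<Longrightarrow> k = uk"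
  using end_on[OF inW(4,5) _ mems(6)] k_neqs N_nodes[OF edgeI[OF parts inW(4,5)]] mems(6) by blast

lemma z_tri:
  assumes "x3 \<in> X"
  shows "z = opp x3 x2"
  using tz(1) hex3(1)[OF assms] by simp

text \<open>At a triple point \<open>x3\<close> the edges of \<open>x2 x3\<close> and
  \<open>x3 x4\<close> are disjoint from \<open>{u, a3}\<close>. Together with what
  \<open>x2\<close> and \<open>x4\<close> exclude, \<open>a4\<close> and \<open>a2\<close> remain as
  their ends in \<open>W'\<close>.\<close>

lemma A_edges:
  assumes x3X: "x3 \<in> X"
  obtains p2 p3 where "ed x2 x3 = {p2, a4}" "ed x3 x4 = {p3, a2}" "p2 = uh' \<or> p2 = uk" "p3 = uh \<or> p3 = uk" "p2 \<noteq> p3"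
proof -
  obtain p2 q2 where g: "p2 \<in> W" "q2 \<in> W'" "ed x2 x3 = {p2, q2}" "p2 \<noteq> u" "p2 \<noteq> uh" "q2 \<noteq> a2" "q2 \<noteq> a"
    by (rule x23_edge)
  obtain p3 q3 where f: "p3 \<in> W" "q3 \<in> W'" "ed x3 x4 = {p3, q3}" "p3 \<noteq> u" "p3 \<noteq> uh'" "q3 \<noteq> a4" "q3 \<noteq> a"
    by (rule x34_edge)
  have n: "nb x3 u" "nb x3 x2" using nb_sym nbs(2) n23 by auto
  have "ed x3 u \<noteq> ed x3 x2" using X_ed[OF x3X n(1), of "\<not> c"] t23 by simp
  then have 1: "{p2, q2} \<noteq> {u, a3}" using g(3) ed_sym[OF n23] ed_sym[OF nbs(2)] eds(2) by simp
  have "ed x3 u \<noteq> ed x3 x4" using X_ed[OF x3X n(1), of c] t34 by simp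
  then have 2: "{p3, q3} \<noteq> {u, a3}" using f(3) ed_sym[OF nbs(2)] eds(2) by simp
  have 3: "{p2, q2} \<noteq> {p3, q3}" using ed_23_34 g(3) f(3) by simp
  have x: "x3 \<in> N {p2, q2}" "x3 \<in> N {p3, q3}" using x3N g f by auto
  have "q2 \<noteq> a3" "q3 \<noteq> a3" "p2 \<noteq> p3"
    using X_pair[OF parts x3X g(1,2) inW(1,7) x(1) mems(2) 1] X_pair[OF parts x3X f(1,2) inW(1,7) x(2) mems(2) 2]
      X_pair[OF parts x3X g(1,2) f(1,2) x 3] by auto
  moreover have "q2 \<in> {a, a2, a3, a4}" "q3 \<in> {a, a2, a3, a4}" "p2 \<in> {u, uh, uh', uk}" "p3 \<in> {u, uh, uh', uk}"
    using g f W_eq W'_eq by auto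
  ultimately show ?thesis using that g f by auto
qed

text \<open>\<open>p3 = uh\<close> and \<open>p = uh'\<close> are forced, which leaves two choices
  each for \<open>p2\<close> and \<open>q\<close>. Three of the four combinations make two edges
  meet twice or identify two different nodes. In the fourth \<open>w\<close> is a triple point, and
  none of the remaining pairs of ends is possible for the third edge through it.\<close>

lemma not_crossing_crossing:
  assumes x3X: "x3 \<in> X" and kX: "k \<in> X"
  shows False
proof -
  obtain p2 p3 where g: "ed x2 x3 = {p2, a4}" "ed x3 x4 = {p3, a2}" "p2 = uh' \<or> p2 = uk" "p3 = uh \<or> p3 = uk" "p2 \<noteq> p3"
    by (rule A_edges[OF x3X])
  have pW: "p2 \<in> W" "p3 \<in> W" using g inW by auto
  obtain p q where r: "p \<in> W" "q \<in> W'" "ed k y4 = {p, q}"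
    using edge_parts[OF parts ed_E] ty(2) by blast
  note kc = k_crossing[OF kX r(3,1,2) g(2) pW(2) inW(6)]
  have p3: "p3 = uh" using kc(10) g(4) by auto
  have p: "p = uh'" using kc p3 r(1) W_eq by auto
  have q: "q = a3 \<or> q = a4" using kc r(2) W'_eq by auto
  note wk = meet_r[OF parts _ _ inW(8), of _ _ w]
  have w: "w \<in> N {p2, a4}" using wN g by simp
  have x3g: "x3 \<in> N {p2, a4}" "x3 \<in> N {p3, a2}" using x3N g by auto
  have d: "uh' \<noteq> uk" "uh' \<noteq> uh" "u \<noteq> uh'" "a3 \<noteq> a4" "a \<noteq> a4" using W_eq(2) W'_eq(2) by auto
  from q g(3) consider "q = a4" "p2 = uh'" | "q = a4" "p2 = uk" | "q = a3" "p2 = uh'" | "q = a3" "p2 = uk" by blast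
  then show False
  proof cases
    case 1
    then have "k \<in> N {p2, a4}" using kc(3) p by simp
    then show False using two_common[OF _ _ x3g k_x3 pW(1) inW(8) pW(2) inW(6)] kN g by auto
  next
    case 2
    then have "y4 = a4" using meet_r[OF parts inW(1,3,8) d(3) y4N] kc(4) p by simp
    moreover have "w = a4" using meet_r[OF parts inW(4,3,8) d(1)[symmetric]] w kc(2) p 2 by simp
    ultimately show False using kc(1) opp_nb[OF kX qd(2)] by simp
  next
    case 3
    then have "w = uh'" using meet_l[OF parts inW(3,8,7) d(4)[symmetric]] w kc(2) p by simp
    moreover have "z \<in> N {uh', a4}"
      using opp_N[OF x3X nb_sym[OF n23]] z_tri[OF x3X] ed_sym[OF n23] g(1) 3 by simp
    then have "z = uh'" using meet_l[OF parts inW(3,5,8) d(5) zN] by simp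
    ultimately show False using opp_order[OF x2X x3X n23] z_tri[OF x3X] unfolding w_def by simp
  next
    case 4
    have "{uk, a4} \<inter> {uh', a3} = {}" using pair_disj[OF parts inW(4,8,3,7)] d by auto
    then have wX: "w \<in> X" using meet_X[OF pairE[OF inW(4,8)] pairE[OF inW(3,7)]] w kc(2) p 4 by simp
    have "{uk, a4} \<noteq> {uh', a3}" using pair_eq[OF parts inW(4,8,3,7)] d by auto
    then obtain f where f: "f \<in> E" "w \<in> N f" "f \<inter> {uk, a4} = {}" "f \<inter> {uh', a3} = {}"
      using third_edge[OF wX pairE[OF inW(4,8)] pairE[OF inW(3,7)]] w kc(2) p 4 by blast
    obtain s t where st: "s \<in> W" "t \<in> W'" "f = {s, t}" using edge_parts[OF parts f(1)] by blast
    have s: "s = u \<or> s = uh" and t: "t = a \<or> t = a2" using st f W_eq W'_eq by auto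
    have w': "w \<in> N {uk, a4}" using w 4 by simp
    have nw: "w \<noteq> x2" using qd(6) nb_irrefl by metis
    have x2g: "x2 \<in> N {uk, a4}" using ed_N[OF n23] g(1) 4 by simp
    from s t consider "s = u" "t = a" | "s = u" "t = a2" | "s = uh" "t = a" | "s = uh" "t = a2" by blast
    then show False
    proof cases
      case 1 then show False using ua_unc f(2) st(3) wX by blast
    next
      case 2 then show False using two_common[OF _ w' mems(1) x2g nw inW(1,6,4,8)] f(2) st(3) W_eq by auto
    next
      case 3 then show False using two_common[OF _ w' mems(4) x2g nw inW(2,5,4,8)] f(2) st(3) W_eq by auto
    next
      case 4
      have "w \<in> N {p3, a2}" using f(2) st(3) 4 p3 by simp
      then show False using two_common[OF w _ x3g w_x3 pW(1) inW(8) pW(2) inW(6)] g(5) by blast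
    qed
  qed
qed

text \<open>\<open>k\<close> is now the vertex \<open>uk\<close>, with neighbours \<open>a\<close>,
  \<open>x4\<close>, \<open>w\<close>, \<open>y4\<close> in which the edges to \<open>a\<close>,
  \<open>a2\<close> are recognised. So the edges through \<open>w\<close> and \<open>y4\<close> end
  in \<open>a3\<close> and \<open>a4\<close> in some order. Either order fixes three corners of the
  quadrilateral of colour \<open>c\<close>, and the one that remains cannot supply both corners
  demanded by \<open>inQ\<close>.\<close>

lemma not_crossing_end:
  assumes x3X: "x3 \<in> X" and kX: "k \<notin> X"
  shows False
proof -
  obtain p2 p3 where g: "ed x2 x3 = {p2, a4}" "ed x3 x4 = {p3, a2}" "p2 = uh' \<or> p2 = uk" "p3 = uh \<or> p3 = uk" "p2 \<noteq> p3"
    by (rule A_edges[OF x3X])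
  have pW: "p2 \<in> W" "p3 \<in> W" using g inW by auto
  have k: "k = uk" using k_end kX .
  have d: "uh' \<noteq> uk" "uh' \<noteq> uh" "u \<noteq> uh'" "a3 \<noteq> a4" "a \<noteq> a4" "u \<noteq> uk" "a2 \<noteq> a" "uh \<noteq> uk" "a4 \<noteq> a2" "a2 \<noteq> a3" "u \<noteq> uh" "a \<noteq> a3"
    using W_eq(2) W'_eq(2) by auto
  have "k \<in> N {p3, a2}" using kN g by simp
  then have p3: "p3 = uk" using end_on[OF pW(2) inW(6)] k W_O(1)[OF inW(4)] ne_WW'[OF inW(4,6)] by auto
  then have p2: "p2 = uh'" using g by auto
  have g23: "ed x2 x3 = {uh', a4}" and g34: "ed x3 x4 = {uk, a2}" using g p2 p3 by auto
  have x3g: "x3 \<in> N {uh', a4}" "x3 \<in> N {uk, a2}" using x3N g23 g34 by auto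
  have w: "w \<in> N {uh', a4}" using wN g23 by simp
  have "z \<in> N {uh', a4}"
    using opp_N[OF x3X nb_sym[OF n23]] z_tri[OF x3X] ed_sym[OF n23] g23 by simp
  then have z: "z = uh'" using meet_l[OF parts inW(3,5,8) d(5) zN] by simp
  have ku: "nb uk a" "nb uk x4" "nb uk w" "nb uk y4" using nb_sym[OF ak] nk4 qd(2) ty(2) k by auto
  have "\<kappa> c uk a = x4" "\<kappa> (\<not> c) uk a = w" "\<kappa> (\<not> c) uk x4 = y4" using tk qd ty k by auto
  note l = link4[OF W_O(1)[OF inW(4)] ku(1), of c, unfolded this]
  have l: "\<kappa> c uk w = y4" "distinct [a, x4, w, y4]" "{r. nb uk r} = {a, x4, w, y4}"
    using l x4_w by auto
  have oth4: "distinct [oth uk a, oth uk x4, oth uk w, oth uk y4]" "W' = {oth uk a, oth uk x4, oth uk w, oth uk y4}"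
    using oth_all[OF parts inW(4) l(3,2)] by auto
  have e_a: "ed uk a = {uk, a}" using eds(6) ed_sym[OF ku(1)] k by simp
  then have o1: "oth uk a = a" using oth(1)[OF parts inW(4) ku(1)] by (auto simp: doubleton_eq_iff)
  have "ed uk x4 = {uk, a2}" using ed_eqI[OF nk4 ed_E[OF n34] kN x4N] g34 k by simp
  then have o2: "oth uk x4 = a2" using oth(1)[OF parts inW(4) ku(2)] by (auto simp: doubleton_eq_iff)
  have wy: "w \<in> N {uk, oth uk w}" "y4 \<in> N {uk, oth uk y4}"
    using ed_N2[OF ku(3)] ed_N2[OF ku(4)] oth(1)[OF parts inW(4) ku(3)] oth(1)[OF parts inW(4) ku(4)] by auto
  have o34: "oth uk w = a3 \<and> oth uk y4 = a4 \<or> oth uk w = a4 \<and> oth uk y4 = a3"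
  proof -
    have "oth uk w \<in> {a, a2, a3, a4}" "oth uk y4 \<in> {a, a2, a3, a4}"
      using oth(2)[OF parts inW(4) ku(3)] oth(2)[OF parts inW(4) ku(4)] W'_eq(1) by auto
    moreover have "oth uk w \<noteq> a" "oth uk w \<noteq> a2" "oth uk y4 \<noteq> a" "oth uk y4 \<noteq> a2" "oth uk w \<noteq> oth uk y4"
      using oth4(1) unfolding o1 o2 by auto
    ultimately show ?thesis by auto
  qed
  have x3notO: "x3 \<notin> W" "x3 \<notin> W'" "x2 \<notin> W" "x2 \<notin> W'" "x4 \<notin> W" "x4 \<notin> W'"
    using not_O x3X x2X x4X by auto
  \<comment> \<open>Unless \<open>x2 x3\<close> is itself a side, the triangle beyond it has as
    third corner a triple point \<open>v\<close> whose third edge turns out to be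
    \<open>{uh', a3}\<close>, and then \<open>y3 = a3\<close>. If \<open>x3 z\<close> were not a
    side either, the vertices \<open>z = uh'\<close> and \<open>a3\<close> would be joined by an
    uncrossed edge, although that edge passes through \<open>v\<close>.\<close>
  have inQ: "x3 \<in> Q c \<and> (x2 \<in> Q c \<or> a3 \<in> Q c)"
  proof (cases "side c x2 x3")
    case True
    then show ?thesis using not_Q by blast
  next
    case False
    define v where "v = opp x2 a"
    note tv = tri3[OF n23 False hex2(2)[folded v_def]]
    have vo: "v = opp x3 x4" using tv(1) hex3(2)[OF x3X] by simp
    have vh: "v \<in> N {uh, a}" using opp_N[OF x2X nb_sym[OF na2]] eds(4) ed_sym[OF na2] unfolding v_def by simp
    have vg: "v \<in> N {uk, a2}" using opp_N[OF x3X n34] g34 vo by simp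
    have "{uh, a} \<inter> {uk, a2} = {}" using pair_disj[OF parts inW(2,5,4,6)] d by auto
    then have vX: "v \<in> X" using meet_X[OF pairE[OF inW(2,5)] pairE[OF inW(4,6)] _ vh vg] by simp
    have nv3: "nb v x3" "nb x3 v" using tv(2) nb_sym by auto
    have nx34: "nb x3 x4" "nb x3 x2" using n34 nb_sym[OF n23] by auto
    define y3 where "y3 = opp x3 u"
    have nx3u: "nb x3 u" using nb_sym nbs(2) by blast
    have "\<kappa> c x3 (\<kappa> (\<not> c) x3 x4) = opp x3 (\<kappa> c x3 x4)" using hex[OF x3X n34] .
    then have zy3: "\<kappa> c x3 z = y3" using tz t34 unfolding y3_def by simp
    have "\<kappa> (\<not> c) x3 (\<kappa> c x3 x2) = opp x3 (\<kappa> (\<not> c) x3 x2)" using hex'[OF x3X nx34(2)] .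
    then have "\<kappa> (\<not> c) x3 v = y3" using tv t23 unfolding y3_def by simp
    note t3 = tri3[OF nv3(2) not_Q(1)[OF x3_Q] this]
    have y3N: "y3 \<in> N {u, a3}" using opp_N[OF x3X nx3u] eds(2) ed_sym[OF nbs(2)] unfolding y3_def by simp
    obtain s t where st: "s \<in> W" "t \<in> W'" "ed v y3 = {s, t}" using edge_parts[OF parts ed_E[OF t3(2)]] by blast
    have vst: "v \<in> N {s, t}" "y3 \<in> N {s, t}" using ed_N[OF t3(2)] ed_N2[OF t3(2)] st by auto
    have e3: "ed v x3 = {uk, a2}" using opp_nb[OF x3X n34] vo g34 ed_sym[OF nv3(1)] by simp
    have e2: "ed v x2 = {uh, a}" using opp_nb[OF x2X nb_sym[OF na2]] eds(4) ed_sym[OF na2] ed_sym[of v x2] nb_sym[OF tv(3)]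
      unfolding v_def by simp
    have "ed v y3 \<noteq> ed v x3" using X_ed[OF vX nv3(1), of "\<not> c"] t3 by simp
    then have 1: "{s, t} \<noteq> {uk, a2}" using e3 st by simp
    have "ed v x2 \<noteq> ed v y3" using X_ed2[OF vX nv3(1), of c] tv t3 by simp
    then have 2: "{s, t} \<noteq> {uh, a}" using e2 st by auto
    have "s \<noteq> uk" "t \<noteq> a2" "s \<noteq> uh" "t \<noteq> a"
      using X_pair[OF parts vX st(1,2) inW(4,6) vst(1) vg 1] X_pair[OF parts vX st(1,2) inW(2,5) vst(1) vh 2] by auto
    then have s: "s = u \<or> s = uh'" and t: "t = a3 \<or> t = a4" using st W_eq W'_eq by auto
    have nv: "v \<noteq> x3" "v \<noteq> x4" using opp_neq[OF x3X n34] opp_nb[OF x3X n34] vo by auto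
    have st': "s = uh' \<and> t = a3"
    proof (rule ccontr)
      assume "\<not> ?thesis"
      with s t consider "s = u" "t = a3" | "s = u" "t = a4" | "s = uh'" "t = a4" by blast
      then show False
      proof cases
        case 1 then show False using two_common[OF _ vg mems(2) x3g(2) nv(1) inW(1,7,4,6)] vst d by auto
      next
        case 2
        have "x4 \<in> N {uk, a2}" using x4N g34 by simp
        then show False using two_common[OF _ vg mems(3) _ nv(2) inW(1,8,4,6)] vst d 2 by auto
      next
        case 3 then show False using two_common[OF _ vg x3g(1) x3g(2) nv(1) inW(3,8,4,6)] vst d by auto
      qed
    qed
    then have "y3 = a3" using meet_r[OF parts inW(1,3,7) d(3) y3N] vst by simp
    then have kz: "\<kappa> c x3 z = a3" using zy3 by simp
    have "side c x3 z"
    proof (rule ccontr)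
      assume "\<not> side c x3 z"
      from tri3(2)[OF tz(2) this kz] have n: "nb uh' a3" using z by simp
      have "N {uh', a3} = {uh', a3}"
        using uncrossed[OF n] nb_O[OF n] W_O(1)[OF inW(3)] W_O(2)[OF inW(7)] by simp
      then have "v \<in> {uh', a3}" using vst st' by simp
      then show False using not_O[OF vX] inW by auto
    qed
    from quad_Q(1)[OF this kz] show ?thesis by simp
  qed
  from o34 show False
  proof
    assume o: "oth uk w = a3 \<and> oth uk y4 = a4"
    then have y: "y4 = a4" using meet_r[OF parts inW(1,4,8) d(6) y4N] wy by simp
    have n4: "nb x4 y4" using ty(3) .
    have "side c x4 y4"
    proof (rule ccontr)
      assume "\<not> side c x4 y4"
      from tri3(2)[OF n4 this z_y4] have n: "nb a4 uh'" using y z by simp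
      have "N {uh', a4} = {uh', a4}"
        using uncrossed[OF n] nb_O[OF n] W_O(1)[OF inW(3)] W_O(2)[OF inW(8)] by (simp add: insert_commute)
      then have "x2 \<in> {uh', a4}" using ed_N[OF n23] g23 by simp
      then show False using x3notO inW by auto
    qed
    from quad_Q(1)[OF this z_y4] obtain s where "Q c = {x4, a4, uh', s}" using y z by auto
    then show False using inQ x3notO neqs d inW ne_WW'[OF inW(3,7)] by auto
  next
    assume o: "oth uk w = a4 \<and> oth uk y4 = a3"
    then have wa: "w = a4" using meet_r[OF parts inW(3,4,8) d(1) w] wy by simp
    have "{uk, a3} \<inter> {u, a4} = {}" using pair_disj[OF parts inW(4,7,1,8)] d by auto
    then have yX: "y4 \<in> X" using meet_X[OF pairE[OF inW(4,7)] pairE[OF inW(1,8)]] wy o y4N by simp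
    have "side c uk w"
    proof (rule ccontr)
      assume "\<not> side c uk w"
      note t = tri3[OF ku(3) this l(1)]
      have "ed y4 w \<noteq> ed y4 x4" using X_ed2[OF yX nb_sym[OF ku(4)], of c] t ty k by simp
      moreover have "ed y4 x4 = {u, a4}" using ed_x4y4 ed_sym[OF ty(3)] by simp
      moreover have "w \<in> N {u, a4}" using wa E_sub[OF pairE[OF inW(1,8)]] by auto
      then have "ed y4 w = {u, a4}" using ed_eqI[OF nb_sym[OF t(2)] pairE[OF inW(1,8)] y4N] by simp
      ultimately show False by simp
    qed
    from quad_Q(1)[OF this l(1)] obtain s where Qs: "Q c = {uk, a4, y4, s}" using wa by auto
    have "x3 \<noteq> y4" "x2 \<noteq> y4"
      using meet_l[OF parts inW(1,7,8) d(4) mems(2)] meet_l[OF parts inW(1,6,8) d(9)[symmetric] mems(1)] y4N y4_u by auto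
    then show False using inQ Qs x3notO neqs d inW ne_WW'[OF inW(4,7)] not_O[OF yX] by auto
  qed
qed

lemma x3_end: "x3 \<notin> X"
  using not_crossing_crossing not_crossing_end by blast

end

section \<open>Reflecting a wheel whose rim contains two vertices\<close>

context bad_wheel
begin

lemma x3_O: "x3 \<in> U \<union> V" using x3_end nb_X[OF nbs(2)] by blast

lemma x3_a3: "x3 = a3"
  using nb_O[OF nbs(2) uO x3_O] eds(2) by (metis doubleton_eq_iff)

text \<open>As \<open>x3\<close> is a vertex, the wheel can be read from the spoke
  \<open>u x3\<close> instead of \<open>u a\<close>; exchanging the colours preserves the names
  \<open>x2\<close> and \<open>x4\<close>. The segment \<open>x3 x4\<close> is good there because
  \<open>x3\<close> is no corner of the quadrilateral of colour \<open>\<not> c\<close>, so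
  \<open>bad_corner\<close> makes \<open>x3 x2\<close> a side of the other quadrilateral.\<close>

lemma mirror: "bad_wheel U V X nb ed N opp \<kappa> side E W W' u x3 (\<not> c)"
proof -
  interpret m: wheel U V X nb ed N opp \<kappa> side E W W' u x3 "\<not> c"
    by unfold_locales (use parts uW clean nbs(2) x3_O in auto)
  have m2: "m.x2 = x2" and m4: "m.x4 = x4" using t23 t34 unfolding m.x2_def m.x4_def by simp_all
  have "\<not> side (\<not> c) x3 x4" using not_Q(1)[OF x3_Q] .
  then show ?thesis
    by unfold_locales (use m.bad_corner m2 m4 in auto)
qed

end

text \<open>A copy of \<open>bad_wheel\<close> to which the reflected wheel is attached under the
  prefix \<open>m\<close>. Attaching it to \<open>bad_wheel\<close> itself would be circular, since
  the reflected wheel is again a \<open>bad_wheel\<close>.\<close>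

locale mirrored_wheel = bad_wheel

sublocale mirrored_wheel \<subseteq> m: bad_wheel U V X nb ed N opp \<kappa> side E W W' u x3 "\<not> c"
  by (rule mirror)

context mirrored_wheel
begin

lemma m_eqs: "m.x2 = x2" "m.x4 = x4" "m.x3 = a" "m.k = z" "m.z = k" "m.y4 = y4" "m.a2 = a2" "m.a4 = a4" "m.a3 = a"
proof -
  show 1: "m.x2 = x2" "m.x4 = x4" using t23 t34 unfolding m.x2_def m.x4_def by simp_all
  then show 2: "m.x3 = a" using t14 unfolding m.x3_def by simp
  show "m.k = z" using m.k4 unfolding 1 2 z_def .
  show "m.z = k" using k4 unfolding m.z_def 1 by simp
  show "m.y4 = y4" unfolding m.y4_def y4_def 1 ..
  show "m.a2 = a2" "m.a4 = a4" unfolding m.a2_def m.a4_def a2_def a4_def 1 by auto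
  show "m.a3 = a" unfolding m.a3_def 2 by (rule oth_a)
qed

lemmas m_inW = m.inW[unfolded m_eqs]
lemmas m_eds = m.eds[unfolded m_eqs]
lemmas m_mems = m.mems[unfolded m_eqs]

lemma g34: "ed x3 x4 = {m.uh', a3}" "ed x2 x3 = {m.uh, a3}"
  using m_eds x3_a3 ed_sym[OF n23] by simp_all

lemma m_ty: "\<kappa> c z x4 = y4" "nb z y4" "\<kappa> c y4 x4 = z" "\<kappa> c y4 z = x4" "\<kappa> c z y4 = x4" "\<kappa> c x4 y4 = z"
  using m.ty[unfolded m_eqs] by simp_all

lemma k_neq_z: "k \<noteq> z"
proof
  assume "k = z"
  then have "k \<in> N {uh', a}" "k \<in> N {uk, a}" using zN mems by auto
  then show False using meet_r[OF parts inW(3,4,5)] W_eq(2) k_neqs by auto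
qed

lemma uh_neqs: "m.uh \<noteq> u" "m.uh \<noteq> uh" "m.uh' \<noteq> u" "m.uh' \<noteq> uh'"
proof -
  show "m.uh \<noteq> u" "m.uh' \<noteq> u" using m.W_eq(2) by auto
  show "m.uh \<noteq> uh" by (rule x23_edge) (use g34 pair_eq[OF parts] m_inW x3_a3 inW in metis)
  show "m.uh' \<noteq> uh'" by (rule x34_edge) (use g34 pair_eq[OF parts] m_inW x3_a3 inW in metis)
qed

text \<open>Otherwise \<open>k\<close> is the vertex \<open>uk\<close>, \<open>z\<close> is a triple
  point, and the segments from \<open>y4\<close> to \<open>k\<close> and to \<open>z\<close> lie on
  one edge. If \<open>y4\<close> is a triple point, these are the two rays next to the ray to
  \<open>x4\<close>, which belong to different edges; if \<open>y4\<close> is a vertex, the edge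
  \<open>k y4\<close> is uncrossed and cannot contain \<open>z\<close>.\<close>

lemma not_end: "m.uh' \<noteq> uk"
proof
  assume j: "m.uh' = uk"
  have d: "a \<noteq> a3" "uk \<noteq> uh'" "uk \<noteq> uh" "uh \<noteq> uh'" using W_eq(2) W'_eq(2) by auto
  have kg: "k \<in> N {uk, a3}" using kN g34(1) j by simp
  then have k: "k = uk" using meet_l[OF parts inW(4,5,7) d(1) mems(6)] by simp
  have md: "distinct [u, m.uh, m.uh', m.uk]" using m.W_eq(2) .
  have "m.uh \<in> W" "m.uk \<in> W" using m_inW by auto
  then have mh: "m.uh = uh'" and mk: "m.uk = uh" using md uh_neqs j W_eq(1) by auto
  have zz: "z \<in> N {uh, a3}" using m_mems(6) mk x3_a3 by simp
  have "{uh, a3} \<inter> {uh', a} = {}" using pair_disj[OF parts inW(2,7,3,5)] d by auto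
  then have zX: "z \<in> X" using meet_X[OF pairE[OF inW(2,7)] pairE[OF inW(3,5)] _ zz zN] by simp
  obtain p q where r: "p \<in> W" "q \<in> W'" "ed z y4 = {p, q}"
    using edge_parts[OF parts ed_E[OF m_ty(2)]] by blast
  have ga: "ed a x4 = {uh', a}" by (rule eds(5))
  note kc = m.k_crossing[unfolded m_eqs, OF zX r(3,1,2) ga inW(3,5)]
  have p: "p = uk" using kc r(1) W_eq mk by auto
  have nky: "nb k y4" using ty(2) .
  have "k \<in> N {p, q}" using E_sub[OF pairE[OF r(1,2)]] p k by auto
  then have ek: "ed k y4 = ed z y4" using ed_eqI[OF nky pairE[OF r(1,2)] _ kc(4)] r(3) by simp
  show False
  proof (cases "y4 \<in> X")
    case True
    have "ed y4 z \<noteq> ed y4 k" using X_ed2[OF True nb_sym[OF ty(3)], of c] m_ty ty by simp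
    then show False using ek ed_sym[OF nky] ed_sym[OF m_ty(2)] by simp
  next
    case False
    then have "y4 \<in> U \<union> V" using nb_X[OF nky] by blast
    then have "N (ed k y4) = {k, y4}" using uncrossed[OF nky] k W_O(1)[OF inW(4)] by simp
    then have "z \<in> {k, y4}" using ek r(3) kc(3) by simp
    then show False using k_neq_z m_ty(2) nb_irrefl by auto
  qed
qed

end

context mirrored_wheel
begin

text \<open>\<open>not_end\<close>, used for the wheel and for its reflection, forces
  \<open>m.uh' = uh\<close>, \<open>m.uk = uk\<close> and \<open>m.uh = uh'\<close>. With the edges
  known, \<open>y4 = a4\<close> follows, then both quadrilaterals, and then the remaining neighbours
  of \<open>a4\<close> and \<open>uk\<close>. In the end \<open>opp k x4 = opp z x4\<close>, so that
  the edges \<open>{uh, a3}\<close> and \<open>{uh', a}\<close> meet there as well as in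
  \<open>x4\<close>.\<close>

lemma contradiction: False
proof -
  interpret mm: mirrored_wheel U V X nb ed N opp \<kappa> side E W W' u x3 "\<not> c" by unfold_locales
  have mm: "mm.m.uh' = uh'" unfolding mm.m.uh'_def mm.m.x4_def m_eqs uh'_def
    using t34 t14 by (simp add: uh'_def x4_def)
  have 1: "uh' \<noteq> m.uk" using mm.not_end mm by simp
  have d: "uk \<noteq> uh'" "uk \<noteq> uh" "uh \<noteq> uh'" "a \<noteq> a3" "a2 \<noteq> a4" "u \<noteq> uh'" "a3 \<noteq> a4" "a \<noteq> a4" using W_eq(2) W'_eq(2) by auto
  have md: "distinct [u, m.uh, m.uh', m.uk]" using m.W_eq(2) .
  have mW: "m.uh \<in> W" "m.uh' \<in> W" "m.uk \<in> W" using m_inW by auto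
  have mh': "m.uh' = uh" using mW(2) W_eq(1) uh_neqs not_end by auto
  have mk: "m.uk = uk" using mW(3) W_eq(1) 1 md mh' by auto
  have mh: "m.uh = uh'" using mW(1) W_eq(1) md mh' mk by auto
  have x34: "ed x3 x4 = {uh, a3}" and x23: "ed x2 x3 = {uh', a3}" using g34 mh mh' by auto
  have kg: "k \<in> N {uh, a3}" using kN x34 by simp
  have "{uh, a3} \<inter> {uk, a} = {}" using pair_disj[OF parts inW(2,7,4,5)] d by auto
  then have kX: "k \<in> X" using meet_X[OF pairE[OF inW(2,7)] pairE[OF inW(4,5)] _ kg mems(6)] by simp
  have zk: "z \<in> N {uk, a3}" using m_mems(6) mk x3_a3 by simp
  have "{uk, a3} \<inter> {uh', a} = {}" using pair_disj[OF parts inW(4,7,3,5)] d by auto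
  then have zX: "z \<in> X" using meet_X[OF pairE[OF inW(4,7)] pairE[OF inW(3,5)] _ zk zN] by simp
  obtain p q where r: "p \<in> W" "q \<in> W'" "ed k y4 = {p, q}"
    using edge_parts[OF parts ed_E] ty(2) by blast
  note kc = k_crossing[OF kX r(3,1,2) x34 inW(2,7)]
  have p: "p = uh'" and q: "q = a2 \<or> q = a4" using kc r W_eq W'_eq by auto
  obtain p' q' where r': "p' \<in> W" "q' \<in> W'" "ed z y4 = {p', q'}"
    using edge_parts[OF parts ed_E[OF m_ty(2)]] by blast
  note mc = m.k_crossing[unfolded m_eqs, OF zX r'(3,1,2) eds(5) inW(3,5)]
  have p': "p' = uh" and q': "q' = a2 \<or> q' = a4" using mc r' W_eq W'_eq mk x3_a3 by auto
  have y4N': "y4 \<in> N {uh', q}" "y4 \<in> N {uh, q'}" using kc(4) mc(4) p p' by auto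
  have qq: "{uh', q} \<noteq> {uh, q'}" using pair_eq[OF parts inW(3) r(2) inW(2) r'(2)] d by auto
  have "y4 \<notin> X"
  proof
    assume yX: "y4 \<in> X"
    have du: "uh' \<noteq> u" "uh \<noteq> u" using W_eq(2) by (simp_all add: eq_commute)
    have e: "{uh', q} \<noteq> {u, a4}" using pair_eq[OF parts inW(3) r(2) inW(1,8)] du by blast
    have e': "{uh, q'} \<noteq> {u, a4}" using pair_eq[OF parts inW(2) r'(2) inW(1,8)] du by blast
    have "q \<noteq> a4" using X_pair[OF parts yX inW(3) r(2) inW(1,8) y4N'(1) y4N e] ..
    moreover have "q' \<noteq> a4" using X_pair[OF parts yX inW(2) r'(2) inW(1,8) y4N'(2) y4N e'] ..
    moreover have "q \<noteq> q'" using X_pair[OF parts yX inW(3) r(2) inW(2) r'(2) y4N' qq] ..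
    ultimately show False using q q' by blast
  qed
  then have y: "y4 = a4" by (rule y4_O)
  have qa: "q = a4" "q' = a4"
    using end_on[OF inW(3) r(2) W_O(2)[OF inW(8)]] end_on[OF inW(2) r'(2) W_O(2)[OF inW(8)]] y4N' y
      ne_WW'[OF inW(3,8)] ne_WW'[OF inW(2,8)] by auto
  have "w \<in> N {uh', a3}" "w \<in> N {uh', a4}" using wN x23 kc(2) p qa by auto
  then have w: "w = uh'" using meet_l[OF parts inW(3,7,8) d(7)] by simp
  have "m.w \<in> N {uh, a}" using m.wN[unfolded m_eqs] eds(4) ed_sym[OF na2] by simp
  moreover have "m.w \<in> N {uh, a4}" using mc(2) p' qa by simp
  ultimately have mw: "m.w = uh" using meet_l[OF parts inW(2,5,8) d(8)] by simp
  \<comment> \<open>Both quadrilaterals are known completely from here on. Neither \<open>a4\<close>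
    nor \<open>uk\<close> is among their corners, so all faces around these two vertices are
    triangles.\<close>
  have Qc': "Q (\<not> c) = {a, x2, k, uh'}" and Qc: "Q c = {x3, x2, z, uh}"
    using qd(1) w m.qd(1)[unfolded m_eqs] mw by simp_all
  have na4x4: "nb a4 x4" "nb a4 k" "nb a4 z" using ty m_ty y nb_sym by auto
  have \<kappa>4: "\<kappa> c a4 x4 = z" "\<kappa> (\<not> c) a4 x4 = k" using m_ty ty y by auto
  define q0 where "q0 = \<kappa> c a4 k"
  have "\<kappa> c a4 x4 \<noteq> \<kappa> (\<not> c) a4 x4" using \<kappa>4 k_neq_z by simp
  note l4 = link4[OF W_O(2)[OF inW(8)] na4x4(1) this, unfolded \<kappa>4, folded q0_def]
  have o: "distinct [oth a4 x4, oth a4 z, oth a4 k, oth a4 q0]" "W = {oth a4 x4, oth a4 z, oth a4 k, oth a4 q0}"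
    using oth_all[OF parts' inW(8) l4(3,2)] by auto
  have "ed a4 x4 = {u, a4}" "ed a4 k = {uh', a4}" "ed a4 z = {uh, a4}"
    using ed_x4y4 ed_sym[OF na4x4(1)] ed_sym[OF na4x4(2)] ed_sym[OF na4x4(3)] r r' p p' qa y by auto
  then have "oth a4 x4 = u" "oth a4 k = uh'" "oth a4 z = uh"
    using oth(1)[OF parts' inW(8) na4x4(1)] oth(1)[OF parts' inW(8) na4x4(2)] oth(1)[OF parts' inW(8) na4x4(3)]
    by (auto simp: doubleton_eq_iff)
  moreover have n0: "nb a4 q0" using l4(3) by blast
  then have "oth a4 q0 \<in> {u, uh, uh', uk}" using oth(2)[OF parts' inW(8)] W_eq(1) by simp
  ultimately have "oth a4 q0 = uk" using o(1) by auto
  then have q0N: "q0 \<in> N {uk, a4}" using oth(1)[OF parts' inW(8) n0] ed_N2[OF n0] by (simp add: insert_commute)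
  have aX: "a4 \<noteq> x2" "a4 \<noteq> x3" "a4 \<noteq> k" "a4 \<noteq> z" "a4 \<noteq> uh" "a4 \<noteq> uh'" "a4 \<noteq> a"
    using not_O[OF x2X] not_O[OF kX] not_O[OF zX] inW x3_a3 d ne_WW'[OF inW(2,8)] ne_WW'[OF inW(3,8)] by auto
  have a4Q: "a4 \<notin> Q c" "a4 \<notin> Q (\<not> c)" using Qc Qc' aX by auto
  have uX: "uk \<noteq> x2" "uk \<noteq> x3" "uk \<noteq> k" "uk \<noteq> z" "uk \<noteq> uh" "uk \<noteq> uh'" "uk \<noteq> a"
    using not_O[OF x2X] not_O[OF kX] not_O[OF zX] inW x3_a3 d ne_WW'[OF inW(4,7)] ne_WW'[OF inW(4,5)] by auto
  have ukQ: "uk \<notin> Q c" "uk \<notin> Q (\<not> c)" using Qc Qc' uX by auto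
  note tc = tri3[OF na4x4(2) not_Q(1)[OF a4Q(1)] q0_def[symmetric]]
  have nk: "nb k x4" "nb k a4" "nb z x4" "nb z a4" using na4x4 nk4 m_ty y nb_sym ty tz by auto
  have "\<kappa> c k (\<kappa> (\<not> c) k x4) = opp k (\<kappa> c k x4)" using hex[OF kX nk(1)] .
  then have "q0 = opp k a" using ty tk tc y by simp
  then have "q0 \<in> N {uk, a}" using opp_N[OF kX nb_sym[OF ak]] eds(6) ed_sym[OF ak] by simp
  then have q0: "q0 = uk" using meet_l[OF parts inW(4,5,8) d(8)] q0N by simp
  have c'z: "\<kappa> (\<not> c) a4 z = uk" using l4(1) q0 by simp
  note tc' = tri3[OF na4x4(3) not_Q(1)[OF a4Q(2)] c'z]
  have "\<kappa> (\<not> c) k (\<kappa> c k a4) = opp k (\<kappa> (\<not> c) k a4)" using hex'[OF kX nk(2)] .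
  then have v1: "\<kappa> (\<not> c) k uk = opp k x4" using tc q0 ty y by simp
  have nku: "nb k uk" "nb z uk" using tc tc' q0 by auto
  have v1': "\<kappa> (\<not> c) uk k = opp k x4" using tri3(1)[OF nku(1) not_Q(2)[OF ukQ(2)] v1] .
  have "\<kappa> c z (\<kappa> (\<not> c) z a4) = opp z (\<kappa> c z a4)" using hex[OF zX nk(4)] .
  then have v2: "\<kappa> c z uk = opp z x4" using tc' m_ty y by simp
  have v2': "\<kappa> c uk z = opp z x4" using tri3(1)[OF nku(2) not_Q(2)[OF ukQ(1)] v2] .
  have nu: "nb uk a4" using nb_sym[OF n0] q0 by simp
  have \<kappa>u: "\<kappa> c uk a4 = k" "\<kappa> (\<not> c) uk a4 = z" using tc tc' q0 by auto
  have "\<kappa> c uk a4 \<noteq> \<kappa> (\<not> c) uk a4" using \<kappa>u k_neq_z by simp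
  \<comment> \<open>Turning around \<open>uk\<close> from \<open>a4\<close> in either direction
    reaches the same fourth neighbour after two steps, once past \<open>k\<close> and once past
    \<open>z\<close>.\<close>
  from link4(1)[OF W_O(1)[OF inW(4)] nu this, unfolded \<kappa>u] have v: "opp z x4 = opp k x4" using v1' v2' by simp
  have ek: "ed k x4 = {uh, a3}" using ed_eqI[OF nk(1) ed_E[OF n34] kN x4N] x34 by simp
  have zm: "x4 \<in> N {uh', a}" by (rule mems(5))
  have ez: "ed z x4 = {uh', a}" using ed_eqI[OF nk(3) pairE[OF inW(3,5)] zN zm] .
  have "opp k x4 \<in> N {uh, a3}" "opp k x4 \<in> N {uh', a}"
    using opp_N[OF kX nk(1)] opp_N[OF zX nk(3)] ek ez v by auto
  moreover have "x4 \<in> N {uh, a3}" using x4N x34 by simp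
  moreover have "opp k x4 \<noteq> x4" using opp_nb[OF kX nk(1)] by simp
  ultimately show False using two_common[OF _ _ _ zm _ inW(2,7,3,5), of "opp k x4"] d(3) by simp
qed

end

lemma (in bad_wheel) contradiction: False
proof -
  interpret m: mirrored_wheel U V X nb ed N opp \<kappa> side E W W' u a c by unfold_locales
  show False by (rule m.contradiction)
qed

text \<open>\<open>bad_corner\<close> gives one of the two, and a wheel with exactly one of them is
  a \<open>bad_wheel\<close> for \<open>c\<close> or for \<open>\<not> c\<close>. So the vertex
  \<open>a\<close> is a corner of both quadrilaterals.\<close>

lemma (in wheel) both_bad: "side (\<not> c) a x2" "side c a x4"
proof -
  interpret m: wheel U V X nb ed N opp \<kappa> side E W W' u a "\<not> c"
    by unfold_locales (use parts uW clean ua aO in auto)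
  have m: "m.x2 = x4" "m.x4 = x2" unfolding m.x2_def m.x4_def x2_def x4_def by simp_all
  have 1: "side c a x4" if bad: "side (\<not> c) a x2"
  proof (rule ccontr)
    assume good: "\<not> side c a x4"
    interpret b: bad_wheel U V X nb ed N opp \<kappa> side E W W' u a c
      by unfold_locales (use bad good in auto)
    show False by (rule b.contradiction)
  qed
  have 2: "side (\<not> c) a x2" if bad: "side c a x4"
  proof (rule ccontr)
    assume good: "\<not> side (\<not> c) a x2"
    interpret b: bad_wheel U V X nb ed N opp \<kappa> side E W W' u a "\<not> c"
      by unfold_locales (use bad good m in auto)
    show False by (rule b.contradiction)
  qed
  show "side (\<not> c) a x2" "side c a x4" using bad_corner 1 2 by blast+
qed

text \<open>The neighbours of \<open>a\<close> other than \<open>u\<close> are two triple points and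
  \<open>k\<close>, which is a corner of a quadrilateral. This makes the charging of clean vertices
  to such \<open>a\<close> injective.\<close>

lemma (in wheel) unique_clean:
  assumes "nb a u'" "near_triangulation.clean U V side u'"
  shows "u' = u"
proof -
  have u': "clean u'" using assms(2) .
  then have "u' \<in> U \<union> V" unfolding clean_def by blast
  then have "u' \<noteq> x2" "u' \<noteq> x4" using x2X x4X X_disj by blast+
  moreover have "k \<in> Q (\<not> c)" using quad_Q(1)[OF both_bad(1) k_def[symmetric] refl] by simp
  then have "u' \<noteq> k" using clean_Q[OF u'] by blast
  ultimately show ?thesis using a_link(3) assms(1) by blast
qed

section \<open>Counting the vertices against the corners of the quadrilaterals\<close>

context near_triangulation
begin

lemma clean_wheel:
  assumes "clean u" "nb u a" "a \<in> U \<union> V"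
  obtains W W' where "wheel U V X nb ed N opp \<kappa> side E W W' u a"
proof -
  have "u \<in> U \<union> V" using assms(1) unfolding clean_def by simp
  then obtain W W' where "parts W W'" "u \<in> W" unfolding parts_def by blast
  then have "wheel U V X nb ed N opp \<kappa> side E W W' u a"
    by unfold_locales (use assms in auto)
  then show ?thesis by (rule that)
qed

lemma Q_card: "card (Q c) = 4" "finite (Q c)"
proof -
  obtain p q where s: "side c p q" using quad_ex by blast
  note q = quad_Q[OF s refl refl]
  have "distinct [p, q, \<kappa> c p q, \<kappa> c q p]"
    using q(5) \<kappa>_neq[OF q(6), of c] \<kappa>_neq[OF nb_sym[OF q(6)], of c] q(6-8) nb_irrefl by auto
  then show "card (Q c) = 4" "finite (Q c)" unfolding q(1) by simp_all
qed

text \<open>The edge opposite to \<open>v\<close> would need a fifth end vertex.\<close>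

lemma only_ends_in_quad:
  assumes v: "v \<in> Q c" "v \<notin> Q (\<not> c)" and sub: "Q c \<subseteq> U \<union> V"
  shows False
proof -
  obtain q where s: "side c v q" using v(1) unfolding Q_def by blast
  define r where "r = \<kappa> c v q"
  note qq = quad_Q[OF s r_def[symmetric] refl]
  have O: "v \<in> U \<union> V" "q \<in> U \<union> V" "r \<in> U \<union> V" using qq(1) sub by auto
  obtain W W' where p: "parts W W'" "v \<in> W" using O(1) unfolding parts_def by blast
  note p' = parts_facts(6)[OF p(1)]
  define x3 where "x3 = \<kappa> (\<not> c) v q"
  define x4 where "x4 = \<kappa> c v x3"
  have n: "nb v q" "nb v r" using qq by auto
  note t3 = tri3[OF n(1) not_Q(1)[OF v(2)] x3_def[symmetric]]
  have x3X: "x3 \<in> X" using common_nb_X[OF n(1) O(1,2) t3(3,2)] .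
  then have rx: "r \<noteq> x3" using O(3) X_disj by blast
  have ne: "\<kappa> c v q \<noteq> \<kappa> (\<not> c) v q" using rx unfolding r_def x3_def .
  note l = link4[OF O(1) n(1) ne, folded r_def x3_def, folded x4_def]
  have r4: "\<kappa> (\<not> c) v r = x4" using l(1) by simp
  note t4 = tri3[OF n(2) not_Q(1)[OF v(2)] r4]
  have x4X: "x4 \<in> X" using common_nb_X[OF n(2) O(1,3) t4(3,2)] .
  have "\<not> side c v x3"
  proof
    assume "side c v x3"
    then have "x3 \<in> Q c" using not_Q by blast
    then show False using sub x3X X_disj by blast
  qed
  note t34 = tri3[OF t3(3) this x4_def[symmetric]]
  have ov: "oth v q = q" "oth v r = r"
    using nb_O[OF n(1) O(1,2)] nb_O[OF n(2) O(1,3)] oth(1)[OF p n(1)] oth(1)[OF p n(2)] by (auto simp: doubleton_eq_iff)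
  have W': "W' = {q, r, oth v x3, oth v x4}" using oth_all(2)[OF p l(3,2)] ov by simp
  have qW: "q \<in> W'" "r \<in> W'" using W' by auto
  obtain s t where st: "s \<in> W" "t \<in> W'" "ed x3 x4 = {s, t}" using edge_parts[OF p(1) ed_E[OF t34(2)]] by blast
  have on: "x3 \<in> N {s, t}" "x4 \<in> N {s, t}" using ed_N[OF t34(2)] ed_N2[OF t34(2)] st(3) by auto
  \<comment> \<open>\<open>t\<close> differs from the end in \<open>W'\<close> of each other edge
    considered at \<open>x3\<close> or \<open>x4\<close>, and the ends of these edges exhaust
    \<open>W'\<close>.\<close>
  have no: "t \<noteq> t'" if x: "x \<in> X" "x \<in> N {s, t}" and y: "nb y x" "y \<in> U \<union> V" "s' \<in> W" "t' \<in> W'" "ed y x = {s', t'}"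
    and ne: "ed y x \<noteq> ed x3 x4" for x y s' t'
  proof -
    have "x \<in> N {s', t'}" using ed_N2[OF y(1)] y(5) by simp
    moreover have "{s, t} \<noteq> {s', t'}" using ne st(3) y(5) by auto
    ultimately show ?thesis using X_pair[OF p(1) x(1) st(1,2) y(3,4) x(2)] by blast
  qed
  have e34: "ed x4 x3 = ed x3 x4" using ed_sym[OF t34(2)] by simp
  have "ed v x3 \<noteq> ed x3 x4" using X_ed[OF x3X nb_sym[OF t3(3)], of c] t34 ed_sym[OF t3(3)] by simp
  then have 1: "t \<noteq> oth v x3" using no[OF x3X on(1) t3(3) O(1) p(2) oth(2,1)[OF p t3(3)]] by simp
  have "ed v x4 \<noteq> ed x3 x4" using X_ed[OF x4X nb_sym[OF t34(3)], of c] t34 e34 ed_sym[OF t34(3)] by simp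
  then have 2: "t \<noteq> oth v x4" using no[OF x4X on(2) t34(3) O(1) p(2) oth(2,1)[OF p t34(3)]] by simp
  have "ed q x3 \<noteq> ed x3 x4"
    using X_ed2[OF x3X nb_sym[OF t3(3)], of c] t34 t3 ed_sym[OF t3(2)] by simp
  moreover have "ed q x3 = {oth q x3, q}" using oth(1)[OF p' qW(1) t3(2)] by (simp add: insert_commute)
  ultimately have 3: "t \<noteq> q" using no[OF x3X on(1) t3(2) O(2) oth(2)[OF p' qW(1) t3(2)] qW(1)] by simp
  have "ed r x4 \<noteq> ed x3 x4"
    using X_ed2[OF x4X nb_sym[OF t34(3)], of c] t34 t4 ed_sym[OF t4(2)] e34 by simp
  moreover have "ed r x4 = {oth r x4, r}" using oth(1)[OF p' qW(2) t4(2)] by (simp add: insert_commute)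
  ultimately have 4: "t \<noteq> r" using no[OF x4X on(2) t4(2) O(3) oth(2)[OF p' qW(2) t4(2)] qW(2)] by simp
  show False using st(2) W' 1 2 3 4 by blast
qed

definition "S0 = {u. clean u \<and> (\<forall>a. nb u a \<longrightarrow> a \<in> X)}"
definition "S1 = {u. clean u \<and> (\<exists>a \<in> U \<union> V. nb u a)}"

lemma finite_UV: "finite (U \<union> V)" "card (U \<union> V) = 8"
proof -
  have "finite U" "finite V" using card_UV by (metis card.infinite zero_neq_numeral)+
  then show "finite (U \<union> V)" "card (U \<union> V) = 8" using card_UV by (simp_all add: card_Un_disjoint)
qed

text \<open>A clean vertex with an uncrossed edge is charged to the other end of that edge, a corner
  of both quadrilaterals by \<open>both_bad\<close>. Thus \<open>S1\<close> is paid for by the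
  vertices that are counted twice when the corners of the two quadrilaterals are added up.\<close>

lemma S1_card: "card S1 \<le> card ((U \<union> V) \<inter> Q True \<inter> Q False)"
proof -
  define f where "f u = (SOME a. a \<in> U \<union> V \<and> nb u a)" for u
  have f: "f u \<in> U \<union> V" "nb u (f u)" "clean u" if "u \<in> S1" for u
  proof -
    have "\<exists>a. a \<in> U \<union> V \<and> nb u a" using that unfolding S1_def by blast
    from someI_ex[OF this] show "f u \<in> U \<union> V" "nb u (f u)" unfolding f_def by auto
    show "clean u" using that unfolding S1_def by blast
  qed
  have "inj_on f S1"
  proof (rule inj_onI)
    fix u u' assume u: "u \<in> S1" "u' \<in> S1" "f u = f u'"
    obtain W W' where "wheel U V X nb ed N opp \<kappa> side E W W' u (f u)"
      by (rule clean_wheel[OF f(3,2,1)[OF u(1)]])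
    then interpret w: wheel U V X nb ed N opp \<kappa> side E W W' u "f u" True .
    have "nb (f u) u'" using nb_sym[OF f(2)[OF u(2)]] u(3) by simp
    then show "u = u'" using w.unique_clean f(3)[OF u(2)] by blast
  qed
  moreover have "f ` S1 \<subseteq> (U \<union> V) \<inter> Q True \<inter> Q False"
  proof
    fix b assume "b \<in> f ` S1"
    then obtain u where u: "u \<in> S1" "b = f u" by blast
    obtain W W' where "wheel U V X nb ed N opp \<kappa> side E W W' u (f u)"
      by (rule clean_wheel[OF f(3,2,1)[OF u(1)]])
    then interpret w: wheel U V X nb ed N opp \<kappa> side E W W' u "f u" True .
    have "f u \<in> Q True" "f u \<in> Q False" using w.both_bad not_Q by auto
    then show "b \<in> (U \<union> V) \<inter> Q True \<inter> Q False" using u f(1) by blast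
  qed
  ultimately show ?thesis using finite_UV(1) by (metis card_inj_on_le finite_Int)
qed

text \<open>\<open>lens\<close> with the colours exchanged: of two opposite rim segments around
  \<open>u\<close> one is a side of the quadrilateral of colour \<open>c\<close>, and the triangle
  on the other side of that segment has its third corner in \<open>u\<close>.\<close>

lemma S0_side:
  assumes "u \<in> S0"
  shows "\<exists>p q. side c p q \<and> p \<in> X \<and> q \<in> X \<and> \<kappa> (\<not> c) p q = u \<and> \<kappa> (\<not> c) q p = u"
proof -
  have u: "clean u" "\<And>a. nb u a \<Longrightarrow> a \<in> X" using assms unfolding S0_def by auto
  have uO: "u \<in> U \<union> V" using u unfolding clean_def by simp
  have "card {q. nb u q} \<noteq> 0" using card_nbs[OF uO] by simp
  then obtain x2 where x2: "nb u x2" by fastforce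
  define x1 x3 x4 where x: "x1 = \<kappa> (\<not> c) u x2" "x3 = \<kappa> (\<not> \<not> c) u x2" "x4 = \<kappa> (\<not> c) u x3"
  have n: "nb u x3" "nb u x1" "nb u x4" using \<kappa>_nb x2 x by auto
  have "side c x1 x2 \<or> side c x3 x4"
    using lens[OF u(1) x2 x(1,2,3)] u(2) n x2 by simp
  moreover note tri3[OF x2 clean_side[OF u(1)] x(1)[symmetric]] tri3[OF n(1) clean_side[OF u(1)] x(3)[symmetric]]
  ultimately show ?thesis using u(2) n x2 by blast
qed

definition "XX c = {{p, q} | p q. side c p q \<and> p \<in> X \<and> q \<in> X}"

text \<open>The side found by \<open>S0_side\<close> determines \<open>u\<close> as the third corner
  of the triangle across it, so different vertices receive different sides.\<close>

lemma S0_card: "finite (XX c) \<Longrightarrow> card S0 \<le> card (XX c)"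
proof -
  assume fin: "finite (XX c)"
  define P where "P u e \<longleftrightarrow>
    (\<exists>p q. e = {p, q} \<and> side c p q \<and> p \<in> X \<and> q \<in> X \<and> \<kappa> (\<not> c) p q = u \<and> \<kappa> (\<not> c) q p = u)" for u e
  define g where "g u = (SOME e. P u e)" for u
  have g: "P u (g u)" if "u \<in> S0" for u
  proof -
    have "\<exists>e. P u e" using S0_side[OF that, of c] unfolding P_def by blast
    then show ?thesis unfolding g_def by (rule someI_ex)
  qed
  have "inj_on g S0"
  proof (rule inj_onI)
    fix u u' assume u: "u \<in> S0" "u' \<in> S0" "g u = g u'"
    obtain p q where pq: "g u = {p, q}" "\<kappa> (\<not> c) p q = u" "\<kappa> (\<not> c) q p = u" using g[OF u(1)] unfolding P_def by blast
    obtain r s where rs: "g u' = {r, s}" "\<kappa> (\<not> c) r s = u'" using g[OF u(2)] unfolding P_def by blast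
    have "p = r \<and> q = s \<or> p = s \<and> q = r" using pq(1) rs(1) u(3) by (metis doubleton_eq_iff)
    then show "u = u'" using pq rs by auto
  qed
  moreover have "g ` S0 \<subseteq> XX c"
  proof
    fix e assume "e \<in> g ` S0"
    then obtain u where u: "u \<in> S0" "e = g u" by blast
    show "e \<in> XX c" using g[OF u(1)] unfolding u(2) P_def XX_def by blast
  qed
  ultimately show ?thesis using fin by (rule card_inj_on_le)
qed

text \<open>Both ends of a side are corners, so only the two diagonals have to be excluded. The
  involution at an end of a diagonal would have to send the other end to a remaining corner, but
  those two are already exchanged with each other.\<close>

lemma XX_sub:
  assumes "side c p q" "\<kappa> c p q = r" "\<kappa> c q p = s"
  shows "XX c \<subseteq> {{p, q}, {p, r}, {q, s}, {r, s}}"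
proof
  note q = quad_Q[OF assms]
  fix e assume "e \<in> XX c"
  then obtain y z where yz: "e = {y, z}" "side c y z" unfolding XX_def by blast
  have z: "z \<in> Q c" "y \<in> Q c" using yz(2) not_Q by blast+
  have d: "distinct [p, q, r, s]"
    using q(5) \<kappa>_neq[OF q(6), of c] \<kappa>_neq[OF nb_sym[OF q(6)], of c] q(6-8) nb_irrefl assms by auto
  have nd: "\<not> side c p s" "\<not> side c q r" 
  proof -
    show "\<not> side c p s"
    proof
      assume a: "side c p s"
      have ns: "nb s p" using quad[OF a] nb_sym by blast
      have "\<kappa> c p s \<in> {p, q, r, s}" using quad_Q(1)[OF a refl refl] q(1) by blast
      moreover have "\<kappa> c p s \<noteq> p" "\<kappa> c p s \<noteq> s" using \<kappa>_nb[OF nb_sym[OF ns], of c] nb_irrefl \<kappa>_neq[OF nb_sym[OF ns], of c] by auto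
      moreover have "\<kappa> c p s \<noteq> q" "\<kappa> c p s \<noteq> r"
        using \<kappa>_inv[OF nb_sym[OF ns], of c] \<kappa>_inv[OF q(6), of c] assms d by auto
      ultimately show False by blast
    qed
    show "\<not> side c q r"
    proof
      assume a: "side c q r"
      have n: "nb q r" using quad[OF a] by blast
      have "\<kappa> c q r \<in> {p, q, r, s}" using quad_Q(1)[OF a refl refl] q(1) by blast
      moreover have "\<kappa> c q r \<noteq> q" "\<kappa> c q r \<noteq> r" using \<kappa>_nb[OF n, of c] nb_irrefl \<kappa>_neq[OF n, of c] by auto
      moreover have "\<kappa> c q r \<noteq> p" "\<kappa> c q r \<noteq> s"
        using \<kappa>_inv[OF n, of c] \<kappa>_inv[OF nb_sym[OF q(6)], of c] assms d by auto
      ultimately show False by blast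
    qed
  qed
  then have "\<not> side c s p" "\<not> side c r q" using side_sym by blast+
  moreover have "y \<noteq> z" using quad[OF yz(2)] nb_irrefl by blast
  ultimately show "e \<in> {{p, q}, {p, r}, {q, s}, {r, s}}" using z yz nd unfolding q(1) by (auto simp: insert_commute)
qed

lemma XX_finite: "finite (XX c)" and XX_card: "card (XX c) \<le> 4"
  and XX_card3: "Q c \<inter> (U \<union> V) \<noteq> {} \<Longrightarrow> card (XX c) \<le> 3"
  and XX_O: "XX c \<noteq> {} \<Longrightarrow> card (Q c \<inter> (U \<union> V)) \<le> 2"
proof -
  obtain p q where s: "side c p q" using quad_ex by blast
  note sub = XX_sub[OF s refl refl]
  then show "finite (XX c)" by (rule finite_subset) simp
  have "card {{p, q}, {p, \<kappa> c p q}, {q, \<kappa> c q p}, {\<kappa> c p q, \<kappa> c q p}} \<le> 4"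
    by (simp add: card_insert_if)
  then show "card (XX c) \<le> 4" using card_mono[OF _ sub] by simp
  show "card (XX c) \<le> 3" if ne: "Q c \<inter> (U \<union> V) \<noteq> {}"
  proof -
    obtain v where v: "v \<in> Q c" "v \<in> U \<union> V" using ne by blast
    obtain y where y: "side c v y" using v(1) unfolding Q_def by blast
    have "{v, y} \<notin> XX c" using v(2) X_disj unfolding XX_def by (auto simp: doubleton_eq_iff)
    then have "XX c \<subseteq> {{v, \<kappa> c v y}, {y, \<kappa> c y v}, {\<kappa> c v y, \<kappa> c y v}}" using XX_sub[OF y refl refl] by blast
    then have "card (XX c) \<le> card {{v, \<kappa> c v y}, {y, \<kappa> c y v}, {\<kappa> c v y, \<kappa> c y v}}" by (rule card_mono[rotated]) simp
    also have "\<dots> \<le> 3" by (simp add: card_insert_if)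
    finally show ?thesis .
  qed
  show "card (Q c \<inter> (U \<union> V)) \<le> 2" if "XX c \<noteq> {}"
  proof -
    obtain y z where yz: "side c y z" "y \<in> X" "z \<in> X" using \<open>XX c \<noteq> {}\<close> unfolding XX_def by blast
    have "y \<notin> U \<union> V" "z \<notin> U \<union> V" using yz X_disj by blast+
    then have "Q c \<inter> (U \<union> V) \<subseteq> {\<kappa> c y z, \<kappa> c z y}" unfolding quad_Q(1)[OF yz(1) refl refl] by blast
    then have "card (Q c \<inter> (U \<union> V)) \<le> card {\<kappa> c y z, \<kappa> c z y}" by (rule card_mono[rotated]) simp
    also have "\<dots> \<le> 2" by (simp add: card_insert_if)
    finally show ?thesis .
  qed
qed

text \<open>Let \<open>m c\<close> count the vertices among the corners of colour \<open>c\<close>.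
  Covering the eight vertices gives \<open>8 \<le> m True + m False + card S0\<close>, as the common
  corners pay for \<open>S1\<close>. If \<open>S0\<close> is nonempty, then
  \<open>m c \<le> 2\<close> and \<open>card S0 \<le> 4\<close>, so equality would be needed
  throughout; but a vertex among the corners lowers the last bound to 3. If \<open>S0\<close> is
  empty, all corners are vertices; then \<open>S1\<close> is empty too, the quadrilaterals have no
  common corner, and \<open>only_ends_in_quad\<close> applies.\<close>

theorem no_near_triangulation: False
proof -
  let ?O = "U \<union> V"
  let ?m = "\<lambda>c. card (Q c \<inter> ?O)"
  have fin: "finite (Q c \<inter> ?O)" for c using finite_UV(1) by simp
  have fS: "finite S0" "finite S1" using finite_UV(1) unfolding S0_def S1_def clean_def by (auto intro: finite_subset)
  have cover: "?O \<subseteq> ((Q True \<inter> ?O) \<union> (Q False \<inter> ?O)) \<union> (S0 \<union> S1)"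
  proof
    fix v assume v: "v \<in> ?O"
    show "v \<in> ((Q True \<inter> ?O) \<union> (Q False \<inter> ?O)) \<union> (S0 \<union> S1)"
    proof (cases "clean v")
      case True
      then show ?thesis unfolding S0_def S1_def using nb_X by blast
    next
      case False
      then show ?thesis using v unfolding clean_def by blast
    qed
  qed
  have "card ?O \<le> card (((Q True \<inter> ?O) \<union> (Q False \<inter> ?O)) \<union> (S0 \<union> S1))"
    using fin fS by (intro card_mono[OF _ cover]) auto
  also have "\<dots> \<le> card ((Q True \<inter> ?O) \<union> (Q False \<inter> ?O)) + (card S0 + card S1)"
    using card_Un_le[of S0 S1] card_Un_le[of "(Q True \<inter> ?O) \<union> (Q False \<inter> ?O)" "S0 \<union> S1"] by linarith
  finally have 8: "8 \<le> card ((Q True \<inter> ?O) \<union> (Q False \<inter> ?O)) + card S0 + card S1" using finite_UV(2) by simp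
  have ie: "?m True + ?m False = card ((Q True \<inter> ?O) \<union> (Q False \<inter> ?O)) + card (?O \<inter> Q True \<inter> Q False)"
  proof -
    have "(Q True \<inter> ?O) \<inter> (Q False \<inter> ?O) = ?O \<inter> Q True \<inter> Q False" by blast
    then show ?thesis using card_Un_Int[OF fin fin, of True False] by simp
  qed
  have main: "8 \<le> ?m True + ?m False + card S0" using 8 ie S1_card by linarith
  have m4: "?m c \<le> 4" for c using card_mono[OF Q_card(2)[of c], of "Q c \<inter> ?O"] Q_card(1)[of c] by simp
  show False
  proof (cases "S0 = {}")
    case False
    then obtain u where u: "u \<in> S0" by blast
    have ne: "XX c \<noteq> {}" for c
    proof -
      obtain p q where "side c p q" "p \<in> X" "q \<in> X" using S0_side[OF u, of c] by blast
      then have "{p, q} \<in> XX c" unfolding XX_def by blast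
      then show ?thesis by blast
    qed
    then have m2: "?m c \<le> 2" for c using XX_O by blast
    have "card S0 \<le> 4" using S0_card[OF XX_finite, of True] XX_card[of True] by simp
    then have "?m True = 2" using main m2[of True] m2[of False] by linarith
    then have "Q True \<inter> ?O \<noteq> {}" by auto
    then have "card S0 \<le> 3" using S0_card[OF XX_finite, of True] XX_card3[of True] by simp
    then show False using main m2[of True] m2[of False] by linarith
  next
    case True
    then have "?m c = 4" for c using main m4[of True] m4[of False] by (cases c) simp_all
    then have "card (Q c \<inter> ?O) = card (Q c)" for c using Q_card by simp
    then have "Q c \<inter> ?O = Q c" for c using Q_card(2)[of c] by (intro card_subset_eq) auto
    then have sub: "Q c \<subseteq> ?O" for c by blast
    have "S1 = {}"
    proof (rule ccontr)
      assume "S1 \<noteq> {}"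
      then obtain u a where u: "clean u" "nb u a" "a \<in> ?O" unfolding S1_def by blast
      obtain W W' where "wheel U V X nb ed N opp \<kappa> side E W W' u a" by (rule clean_wheel[OF u])
      then interpret w: wheel U V X nb ed N opp \<kappa> side E W W' u a True .
      \<comment> \<open>A wheel would put its triple point \<open>x2\<close> among corners that are
        all vertices.\<close>
      have "w.x2 \<in> Q False" using w.both_bad(1) not_Q(2) by fastforce
      then show False using sub w.x2X X_disj by blast
    qed
    then have "card (?O \<inter> Q True \<inter> Q False) = 0" using 8 ie main True m4[of True] m4[of False] by simp
    then have "?O \<inter> Q True \<inter> Q False = {}" using finite_UV(1) by simp
    then have disj: "Q True \<inter> Q False = {}" using sub[of True] by blast
    obtain v where "v \<in> Q True" using quad_ex[of True] unfolding Q_def by blast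
    then show False using only_ends_in_quad[of v True] sub disj by auto
  qed
qed

end

section \<open>Face-coloured planarisations\<close>

text \<open>\<open>bT\<close>, \<open>bF\<close> are the numbers of faces of the two colours and
  \<open>dT\<close>, \<open>dF\<close> their sums of (length - 3). With
  \<open>bT = 5 + T - x\<close> and \<open>bF = 5 + T - y\<close> these sums become
  \<open>1 + 3 x\<close> and \<open>1 + 3 y\<close>. As they are not negative, neither are
  \<open>x\<close> and \<open>y\<close>, whereas Euler's inequality says
  \<open>x + y \<le> 0\<close>.\<close>

lemma mod3_excess:
  fixes S T bT bF dT dF p :: nat
  assumes "S = 16 + 3 * T" "p = 8 + T" "S = 3 * bT + dT" "S = 3 * bF + dF" "bT + bF + p \<ge> S + 2"
  shows "dT = 1 \<and> dF = 1"
proof -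
  define x y where "x = 5 + int T - int bT" and "y = 5 + int T - int bF"
  have d: "int dT = 1 + 3 * x" "int dF = 1 + 3 * y" using assms(1,3,4) unfolding x_def y_def by simp_all
  have "x + y \<le> 0" using assms(1,2,5) unfolding x_def y_def by simp
  moreover have "0 \<le> x" "0 \<le> y" using d by linarith+
  ultimately have "x = 0" "y = 0" by linarith+
  then show ?thesis using d by simp
qed

lemma sum_nat_eq_1:
  fixes f :: "'a \<Rightarrow> nat"
  assumes "finite A" "sum f A = 1"
  shows "\<exists>a\<in>A. f a = 1 \<and> (\<forall>b\<in>A. b \<noteq> a \<longrightarrow> f b = 0)"
proof -
  obtain a where a: "a \<in> A" "f a \<noteq> 0" using assms by (metis sum.neutral zero_neq_one)
  have "sum f A = f a + sum f (A - {a})" using assms(1) a(1) by (rule sum.remove)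
  then have "f a = 1" "sum f (A - {a}) = 0" using a(2) assms(2) by auto
  then show ?thesis using a(1) assms(1) by auto
qed

text \<open>A segment is represented by the set of its two ends and a face by the set of its
  segments. Boundaries are not assumed to be cycles: \<open>Fc_deg\<close> merely excludes free
  ends, and the cyclic shape is derived once the counting has shown that a boundary has at most four
  segments.\<close>

locale coloured_faces =
  fixes S :: "'n set set" and Fc :: "bool \<Rightarrow> 'n set set set" and P :: "'n set" and T :: nat
  assumes finite_S: "finite S" and S_two: "e \<in> S \<Longrightarrow> card e = 2"
    and finite_Fc: "finite (Fc c)" and Fc_sub: "f \<in> Fc c \<Longrightarrow> f \<subseteq> S" and Fc_ne: "f \<in> Fc c \<Longrightarrow> f \<noteq> {}"
    and Fc_ex1: "e \<in> S \<Longrightarrow> \<exists>!f. f \<in> Fc c \<and> e \<in> f"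
    and Fc_deg: "f \<in> Fc c \<Longrightarrow> e \<in> f \<Longrightarrow> q \<in> e \<Longrightarrow> \<exists>e'\<in>f. e' \<noteq> e \<and> q \<in> e'"
    and Fc_sum: "(\<Sum>f\<in>Fc c. card f) = card S"
    and Fc_inj: "f \<in> Fc True \<Longrightarrow> f \<in> Fc False \<Longrightarrow> f = S"
    and euler: "card (Fc True) + card (Fc False) + card P \<ge> card S + 2"
    and cards: "card S = 16 + 3 * T" "card P = 8 + T"
begin

definition "nb p q \<longleftrightarrow> {p, q} \<in> S"
definition "face c p q = (THE f. f \<in> Fc c \<and> {p, q} \<in> f)"
definition "\<kappa> c p q = (THE r. r \<noteq> q \<and> {p, r} \<in> face c p q)"
definition "side c p q \<longleftrightarrow> nb p q \<and> card (face c p q) = 4"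

lemma nb_neq: "nb p q \<Longrightarrow> p \<noteq> q"
  using S_two unfolding nb_def by fastforce

lemma nb_sym: "nb p q \<Longrightarrow> nb q p"
  unfolding nb_def by (simp add: insert_commute)

lemma face: "nb p q \<Longrightarrow> face c p q \<in> Fc c" "nb p q \<Longrightarrow> {p, q} \<in> face c p q"
  using theI'[OF Fc_ex1] unfolding face_def nb_def by blast+

lemma face_eq: "nb p q \<Longrightarrow> f \<in> Fc c \<Longrightarrow> {p, q} \<in> f \<Longrightarrow> face c p q = f"
  using Fc_ex1[of "{p, q}" c] face unfolding nb_def by blast

lemma face_sym: "face c p q = face c q p"
  unfolding face_def by (simp add: insert_commute)

lemma finite_f: "f \<in> Fc c \<Longrightarrow> finite f"
  using Fc_sub finite_S by (rule finite_subset)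

lemma nb_f: "f \<in> Fc c \<Longrightarrow> {p, q} \<in> f \<Longrightarrow> nb p q"
  using Fc_sub unfolding nb_def by blast

lemma f_edge:
  assumes "f \<in> Fc c" "e \<in> f" "p \<in> e"
  obtains q where "e = {p, q}" "q \<noteq> p"
proof -
  have "card e = 2" using assms Fc_sub S_two by blast
  then obtain x y where "e = {x, y}" "x \<noteq> y" by (meson card_2_iff)
  then show ?thesis using assms(3) that by (auto simp: insert_commute)
qed

lemma next_edge:
  assumes "f \<in> Fc c" "{p, q} \<in> f"
  obtains r where "{p, r} \<in> f" "r \<noteq> q" "r \<noteq> p"
proof -
  obtain e where e: "e \<in> f" "e \<noteq> {p, q}" "p \<in> e" using Fc_deg[OF assms, of p] by blast
  obtain r where "e = {p, r}" "r \<noteq> p" by (rule f_edge[OF assms(1) e(1,3)])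
  then show ?thesis using that e by blast
qed

lemma card_f_ge3:
  assumes f: "f \<in> Fc c"
  shows "card f \<ge> 3"
proof -
  obtain e where e: "e \<in> f" using Fc_ne[OF f] by blast
  have "card e = 2" using e Fc_sub[OF f] S_two by blast
  then obtain p q where pq: "e = {p, q}" "p \<noteq> q" by (meson card_2_iff)
  have e': "{p, q} \<in> f" "{q, p} \<in> f" using e pq by (auto simp: insert_commute)
  obtain r where r: "{p, r} \<in> f" "r \<noteq> q" "r \<noteq> p" by (rule next_edge[OF f e'(1)])
  obtain s where s: "{q, s} \<in> f" "s \<noteq> p" "s \<noteq> q" by (rule next_edge[OF f e'(2)])
  have "card {{p, q}, {p, r}, {q, s}} = 3" using pq r s by (auto simp: card_insert_if doubleton_eq_iff)
  moreover have "{{p, q}, {p, r}, {q, s}} \<subseteq> f" using e' r s by blast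
  ultimately show ?thesis using card_mono[OF finite_f[OF f]] by metis
qed

lemma excess: "(\<Sum>f\<in>Fc c. card f - 3) = 1"
proof -
  have s: "card S = 3 * card (Fc c) + (\<Sum>f\<in>Fc c. card f - 3)" for c
  proof -
    have "card S = (\<Sum>f\<in>Fc c. card f)" using Fc_sum by simp
    also have "\<dots> = (\<Sum>f\<in>Fc c. 3 + (card f - 3))" using card_f_ge3 by (intro sum.cong) auto
    also have "\<dots> = 3 * card (Fc c) + (\<Sum>f\<in>Fc c. card f - 3)" by (subst sum.distrib) simp
    finally show ?thesis .
  qed
  from mod3_excess[OF cards s s euler] show ?thesis by (cases c) auto
qed

lemma one_quad: "\<exists>f\<in>Fc c. card f = 4 \<and> (\<forall>g\<in>Fc c. g \<noteq> f \<longrightarrow> card g = 3)"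
proof -
  have "\<exists>f\<in>Fc c. card f - 3 = 1 \<and> (\<forall>g\<in>Fc c. g \<noteq> f \<longrightarrow> card g - 3 = 0)"
    by (rule sum_nat_eq_1[OF finite_Fc excess])
  then obtain f where f: "f \<in> Fc c" "card f - 3 = 1" "\<And>g. g \<in> Fc c \<Longrightarrow> g \<noteq> f \<Longrightarrow> card g - 3 = 0"
    by blast
  have "card f = 4" using f(2) by simp
  moreover have "card g = 3" if "g \<in> Fc c" "g \<noteq> f" for g using f(3)[OF that] card_f_ge3[OF that(1)] by simp
  ultimately show ?thesis using f(1) by blast
qed

lemma card_f: "f \<in> Fc c \<Longrightarrow> card f = 3 \<or> card f = 4"
  using one_quad by metis

text \<open>Three segments of a boundary at \<open>p\<close> would have to continue at their other
  ends, which takes at least two further segments avoiding \<open>p\<close>: five in all, more than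
  any face has.\<close>

lemma degree_two:
  assumes f: "f \<in> Fc c" and e: "{p, a} \<in> f" "{p, b} \<in> f" "{p, d} \<in> f" and ab: "a \<noteq> b"
  shows "d = a \<or> d = b"
proof (rule ccontr)
  assume "\<not> ?thesis"
  then have d: "d \<noteq> a" "d \<noteq> b" by auto
  have n: "p \<noteq> a" "p \<noteq> b" "p \<noteq> d" using nb_neq nb_f[OF f] e by blast+
  have e': "{a, p} \<in> f" "{b, p} \<in> f" "{d, p} \<in> f" using e by (auto simp: insert_commute)
  obtain a' where a': "{a, a'} \<in> f" "a' \<noteq> p" "a' \<noteq> a" by (rule next_edge[OF f e'(1)])
  obtain b' where b': "{b, b'} \<in> f" "b' \<noteq> p" "b' \<noteq> b" by (rule next_edge[OF f e'(2)])
  obtain d' where d': "{d, d'} \<in> f" "d' \<noteq> p" "d' \<noteq> d" by (rule next_edge[OF f e'(3)])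
  have 3: "card {{p, a}, {p, b}, {p, d}} = 3" using n ab d by (auto simp: card_insert_if doubleton_eq_iff)
  have "\<exists>x y. x \<in> f \<and> y \<in> f \<and> x \<noteq> y \<and> p \<notin> x \<and> p \<notin> y"
  proof (cases "{a, a'} = {b, b'}")
    case True
    then have "{a, a'} \<noteq> {d, d'}" using ab d by (auto simp: doubleton_eq_iff)
    then show ?thesis using a' d' n by blast
  next
    case False
    then show ?thesis using a' b' n by blast
  qed
  then obtain x y where xy: "x \<in> f" "y \<in> f" "x \<noteq> y" "p \<notin> x" "p \<notin> y" by blast
  have "card ({x, y} \<union> {{p, a}, {p, b}, {p, d}}) = 5"
    using 3 xy by (subst card_Un_disjoint) auto
  moreover have "{x, y} \<union> {{p, a}, {p, b}, {p, d}} \<subseteq> f" using xy e by blast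
  ultimately have "5 \<le> card f" using card_mono[OF finite_f[OF f]] by metis
  then show False using card_f[OF f] by auto
qed

lemma \<kappa>:
  assumes "nb p q"
  shows "\<kappa> c p q \<noteq> q" "{p, \<kappa> c p q} \<in> face c p q"
proof -
  let ?f = "face c p q"
  note f = face[OF assms, of c]
  obtain r where r: "{p, r} \<in> ?f" "r \<noteq> q" "r \<noteq> p" by (rule next_edge[OF f])
  have "\<exists>!r. r \<noteq> q \<and> {p, r} \<in> ?f" using r degree_two[OF f(1) f(2) r(1)] by blast
  from theI'[OF this] show "\<kappa> c p q \<noteq> q" "{p, \<kappa> c p q} \<in> ?f" unfolding \<kappa>_def by auto
qed

lemma \<kappa>_eqI: "f \<in> Fc c \<Longrightarrow> {p, q} \<in> f \<Longrightarrow> {p, r} \<in> f \<Longrightarrow> r \<noteq> q \<Longrightarrow> \<kappa> c p q = r"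
  using \<kappa>[OF nb_f, of f c p q c] degree_two[of f c p q r "\<kappa> c p q"] face_eq[OF nb_f, of f c p q f c] by metis

lemma \<kappa>_nb: "nb p q \<Longrightarrow> nb p (\<kappa> c p q)"
  using \<kappa>(2) face(1) nb_f by metis

lemma \<kappa>_inv: "nb p q \<Longrightarrow> \<kappa> c p (\<kappa> c p q) = q"
  using \<kappa>_eqI[OF face(1) \<kappa>(2) face(2)] \<kappa>(1) by metis

lemma tri:
  assumes n: "nb p q" and ns: "\<not> side c p q"
  defines "r \<equiv> \<kappa> c p q"
  shows "\<kappa> c q p = r" "nb q r" "\<kappa> c r p = q" "face c p q = {{p, q}, {p, r}, {q, r}}"
proof -
  let ?f = "face c p q" and ?s = "\<kappa> c q p"
  note f = face[OF n, of c]
  have c3: "card ?f = 3" using ns n card_f[OF f(1)] unfolding side_def by blast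
  have fq: "face c q p = ?f" by (rule face_sym)
  have r: "r \<noteq> q" "{p, r} \<in> ?f" using \<kappa>[OF n, of c] unfolding r_def by auto
  have s: "?s \<noteq> p" "{q, ?s} \<in> ?f" using \<kappa>[OF nb_sym[OF n], of c] fq by auto
  have np: "p \<noteq> q" "p \<noteq> r" "q \<noteq> ?s" using nb_neq n nb_f[OF f(1)] r s by auto
  have 3: "card {{p, q}, {p, r}, {q, ?s}} = 3" using np r s by (auto simp: card_insert_if doubleton_eq_iff)
  have "{{p, q}, {p, r}, {q, ?s}} \<subseteq> ?f" using f r s by blast
  then have fe: "?f = {{p, q}, {p, r}, {q, ?s}}" using 3 c3 finite_f[OF f(1)] by (metis card_subset_eq)
  have "{r, p} \<in> ?f" using r by (simp add: insert_commute)
  then obtain t where t: "{r, t} \<in> ?f" "t \<noteq> p" "t \<noteq> r" by (rule next_edge[OF f(1)])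
  then have "r = ?s" using fe np r s by (auto simp: doubleton_eq_iff)
  then show k: "\<kappa> c q p = r" by simp
  have qr: "{q, r} \<in> ?f" using s k by simp
  then show "nb q r" using nb_f[OF f(1)] by blast
  show "?f = {{p, q}, {p, r}, {q, r}}" using fe k by simp
  show "\<kappa> c r p = q" by (rule \<kappa>_eqI[OF f(1)]) (use r qr np in \<open>auto simp: insert_commute\<close>)
qed

text \<open>With the same third corner the triangles on the two sides of \<open>p q\<close> would
  consist of the same three segments, and by \<open>Fc_inj\<close> these would be all segments, of
  which there are at least 16.\<close>

lemma tri_neq:
  assumes n: "nb p q" and ns: "\<not> side c p q" "\<not> side (\<not> c) p q"
  shows "\<kappa> c p q \<noteq> \<kappa> (\<not> c) p q"
proof
  assume "\<kappa> c p q = \<kappa> (\<not> c) p q"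
  then have e: "face c p q = face (\<not> c) p q" using tri(4)[OF n ns(1)] tri(4)[OF n ns(2)] by simp
  have "face c p q = S"
    using face(1)[OF n, of c] face(1)[OF n, of "\<not> c"] Fc_inj e by (cases c) auto
  then have "card S \<le> 4" using card_f[OF face(1)[OF n, of c]] by auto
  then show False using cards by simp
qed

lemma side_iff:
  assumes f: "f \<in> Fc c" "card f = 4"
  shows "side c y z \<longleftrightarrow> {y, z} \<in> f"
proof
  assume "side c y z"
  then have n: "nb y z" "card (face c y z) = 4" unfolding side_def by auto
  obtain g where g: "g \<in> Fc c" "\<forall>h\<in>Fc c. h \<noteq> g \<longrightarrow> card h = 3" using one_quad[of c] by blast
  have "face c y z = g" using bspec[OF g(2) face(1)[OF n(1)]] n(2) by auto
  moreover have "f = g" using bspec[OF g(2) f(1)] f(2) by auto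
  ultimately show "{y, z} \<in> f" using face(2)[OF n(1), of c] by simp
next
  assume "{y, z} \<in> f"
  then show "side c y z" unfolding side_def using nb_f[OF f(1)] face_eq[OF _ f(1)] f(2) by auto
qed

lemma quad_ex: "\<exists>p q. side c p q"
proof -
  obtain f where f: "f \<in> Fc c" "card f = 4" using one_quad[of c] by blast
  obtain e where e: "e \<in> f" using Fc_ne[OF f(1)] by blast
  have "card e = 2" using e Fc_sub[OF f(1)] S_two by blast
  then obtain p q where "e = {p, q}" by (meson card_2_iff)
  then show ?thesis using side_iff[OF f] e by blast
qed

lemma quad:
  assumes sd: "side c p q"
  defines "r \<equiv> \<kappa> c p q" and "s \<equiv> \<kappa> c q p"
  shows "nb p q \<and> r \<noteq> s \<and> side c p r \<and> nb r s \<and> \<kappa> c r p = s \<and> {y. \<exists>z. side c y z} = {p, q, r, s}"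
proof -
  let ?f = "face c p q"
  have n: "nb p q" and c4: "card ?f = 4" using sd unfolding side_def by auto
  note f = face[OF n, of c]
  have r: "r \<noteq> q" "{p, r} \<in> ?f" using \<kappa>[OF n, of c] unfolding r_def by auto
  have s: "s \<noteq> p" "{q, s} \<in> ?f" using \<kappa>[OF nb_sym[OF n], of c] face_sym[of c q p] unfolding s_def by auto
  have np: "p \<noteq> q" "p \<noteq> r" "q \<noteq> s" using nb_neq n nb_f[OF f(1)] r s by auto
  have 3: "card {{p, q}, {p, r}, {q, s}} = 3" using np r s by (auto simp: card_insert_if doubleton_eq_iff)
  have sub: "{{p, q}, {p, r}, {q, s}} \<subseteq> ?f" using f r s by blast
  have "card (?f - {{p, q}, {p, r}, {q, s}}) = 1"
    using c4 3 sub finite_f[OF f(1)] by (simp add: card_Diff_subset)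
  then obtain e where e: "?f - {{p, q}, {p, r}, {q, s}} = {e}" by (meson card_1_singletonE)
  then have eD: "e \<in> ?f - {{p, q}, {p, r}, {q, s}}" by simp
  have ins: "X = {a, b, d, e}" if "{a, b, d} \<subseteq> X" "X - {a, b, d} = {e}" for X and a b d :: "'n set"
    using that by blast
  have fe: "?f = {{p, q}, {p, r}, {q, s}, e}" using ins[OF sub e] .
  have fe: "?f = {{p, q}, {p, r}, {q, s}, e}" "e \<in> ?f" "e \<noteq> {p, q}" "e \<noteq> {p, r}" "e \<noteq> {q, s}"
    using fe eD by simp_all
  have pe: "p \<notin> e"
  proof
    assume "p \<in> e"
    then obtain d where "e = {p, d}" "d \<noteq> p" by (rule f_edge[OF f(1) fe(2)])
    then show False using degree_two[OF f r(2), of d] fe r(1) by auto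
  qed
  have qe: "q \<notin> e"
  proof
    assume "q \<in> e"
    then obtain d where d: "e = {q, d}" "d \<noteq> q" by (rule f_edge[OF f(1) fe(2)])
    have "{q, p} \<in> ?f" using f(2) by (simp add: insert_commute)
    from degree_two[OF f(1) this s(2), of d] show False using fe d s(1) by (auto simp: insert_commute)
  qed
  \<comment> \<open>The fourth segment \<open>e\<close> avoids \<open>p\<close> and
    \<open>q\<close>, and both of its ends lie on another segment of the boundary. If
    \<open>r = s\<close>, the only node available for this is \<open>r\<close>.\<close>
  have rs: "r \<noteq> s"
  proof
    assume "r = s"
    have "card e = 2" using fe(2) Fc_sub[OF f(1)] S_two by blast
    then obtain x y where xy: "e = {x, y}" "x \<noteq> y" by (meson card_2_iff)
    have "z = r" if "z \<in> e" for z
      using Fc_deg[OF f(1) fe(2) that] fe pe qe that \<open>r = s\<close> by auto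
    then show False using xy by auto
  qed
  have re: "r \<in> e"
  proof -
    have "{r, p} \<in> ?f" using r by (simp add: insert_commute)
    then obtain t where "{r, t} \<in> ?f" "t \<noteq> p" "t \<noteq> r" by (rule next_edge[OF f(1)])
    then show ?thesis using fe(1) np r rs by (auto simp: doubleton_eq_iff)
  qed
  have se: "s \<in> e"
  proof -
    have "{s, q} \<in> ?f" using s by (simp add: insert_commute)
    then obtain t where "{s, t} \<in> ?f" "t \<noteq> q" "t \<noteq> s" by (rule next_edge[OF f(1)])
    then show ?thesis using fe(1) np s rs by (auto simp: doubleton_eq_iff)
  qed
  obtain s' where "e = {r, s'}" by (rule f_edge[OF f(1) fe(2) re])
  then have e_eq: "e = {r, s}" using se rs by auto
  have fe': "?f = {{p, q}, {p, r}, {q, s}, {r, s}}" using fe(1) e_eq by simp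
  have "nb r s" using nb_f[OF f(1)] fe(2) e_eq by blast
  moreover have "\<kappa> c r p = s"
    by (rule \<kappa>_eqI[OF f(1)]) (use r fe' s in \<open>auto simp: insert_commute\<close>)
  moreover have "side c p r" using side_iff[OF f(1) c4] r by simp
  moreover have "{y. \<exists>z. side c y z} = {p, q, r, s}"
    unfolding side_iff[OF f(1) c4] fe' by (auto simp: doubleton_eq_iff)
  ultimately show ?thesis using n rs by blast
qed

text \<open>Around a crossing of three strands \<open>q, q'\<close>, \<open>r, r'\<close>, \<open>s, s'\<close>: a triangle of corners is impossible since
  the colours alternate, so the six rays form a hexagon.\<close>

definition "adj x q r \<longleftrightarrow> (\<exists>c. \<kappa> c x q = r)"

lemma hexagon_aux:
  assumes n: "nb x q" "nb x q'" "nb x r" "nb x r'" "nb x s" "nb x s'"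
    and d: "distinct [q, q', r, r', s, s']"
    and a: "adj x q r" "adj x q' r'" "adj x q s'" "adj x q' s"
    and b: "adj x r s \<and> adj x r' s' \<or> adj x r s' \<and> adj x r' s"
  shows "q' = \<kappa> c x (\<kappa> (\<not> c) x (\<kappa> c x q))" "{\<kappa> c x q, \<kappa> (\<not> c) x q} = {r, s'}"
proof -
  obtain e where e: "\<kappa> e x q = r" using a(1) unfolding adj_def by blast
  obtain e' where e': "\<kappa> e' x q = s'" using a(3) unfolding adj_def by blast
  have "e' = (\<not> e)" by (cases e; cases e') (use e e' d in auto)
  then have 1: "\<kappa> (\<not> e) x q = s'" using e' by simp
  have i: "\<kappa> e x r = q" "\<kappa> (\<not> e) x s' = q" using \<kappa>_inv[OF n(1)] e 1 by metis+
  have "\<not> adj x r s'"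
  proof
    assume "adj x r s'"
    then obtain f where f: "\<kappa> f x r = s'" unfolding adj_def by blast
    then have "\<kappa> f x s' = r" using \<kappa>_inv[OF n(3)] by metis
    then show False using f i d by (cases "f = e") auto
  qed
  then have rs: "adj x r s" "adj x r' s'" using b by auto
  obtain f where f: "\<kappa> f x r = s" using rs(1) unfolding adj_def by blast
  have "f = (\<not> e)" by (cases e; cases f) (use f i d in auto)
  then have 2: "\<kappa> (\<not> e) x r = s" "\<kappa> (\<not> e) x s = r" using f \<kappa>_inv[OF n(3)] by auto
  obtain g where g: "\<kappa> g x q' = s" using a(4) unfolding adj_def by blast
  then have gs: "\<kappa> g x s = q'" using \<kappa>_inv[OF n(2)] by metis
  have "g = e" by (cases e; cases g) (use gs 2 d in auto)
  then have 3: "\<kappa> e x s = q'" "\<kappa> e x q' = s" using gs g by auto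
  obtain h where h: "\<kappa> h x r' = s'" using rs(2) unfolding adj_def by blast
  then have hs: "\<kappa> h x s' = r'" using \<kappa>_inv[OF n(4)] by metis
  have "h = e" by (cases e; cases h) (use hs i d in auto)
  then have 4: "\<kappa> e x s' = r'" "\<kappa> e x r' = s'" using hs h by auto
  obtain k where k: "\<kappa> k x q' = r'" using a(2) unfolding adj_def by blast
  then have kr: "\<kappa> k x r' = q'" using \<kappa>_inv[OF n(2)] by metis
  have "k = (\<not> e)" by (cases e; cases k) (use kr 4 d in auto)
  then have 5: "\<kappa> (\<not> e) x r' = q'" using kr by simp
  show "q' = \<kappa> c x (\<kappa> (\<not> c) x (\<kappa> c x q))"
  proof (cases "c = e")
    case True
    then show ?thesis using e 2 3 by simp
  next
    case False
    then have "c = (\<not> e)" by auto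
    then show ?thesis using 1 4 5 by simp
  qed
  show "{\<kappa> c x q, \<kappa> (\<not> c) x q} = {r, s'}"
    by (cases "c = e") (use e 1 in \<open>auto simp: insert_commute\<close>)
qed

text \<open>Exchanging the names \<open>r\<close>, \<open>r'\<close> or \<open>s\<close>,
  \<open>s'\<close> where necessary brings each combination of corners into the form of
  \<open>hexagon_aux\<close>, with the first strand between \<open>r\<close> and \<open>s'\<close>
  at one end and between \<open>r'\<close> and \<open>s\<close> at the other.\<close>

lemma hexagon:
  assumes n: "nb x q" "nb x q'" "nb x r" "nb x r'" "nb x s" "nb x s'"
    and d: "distinct [q, q', r, r', s, s']"
    and qr: "adj x q r \<and> adj x q' r' \<or> adj x q r' \<and> adj x q' r"
    and qs: "adj x q s \<and> adj x q' s' \<or> adj x q s' \<and> adj x q' s"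
    and rs: "adj x r s \<and> adj x r' s' \<or> adj x r s' \<and> adj x r' s"
  shows "q' = \<kappa> c x (\<kappa> (\<not> c) x (\<kappa> c x q))"
    "\<exists>b\<in>{r, r'}. \<exists>t\<in>{s, s'}. {\<kappa> c x q, \<kappa> (\<not> c) x q} = {b, t}"
proof -
  have "\<exists>b b' t t'. {b, b'} = {r, r'} \<and> {t, t'} = {s, s'} \<and> nb x b \<and> nb x b' \<and> nb x t \<and> nb x t' \<and>
      distinct [q, q', b, b', t, t'] \<and> adj x q b \<and> adj x q' b' \<and> adj x q t' \<and> adj x q' t \<and>
      (adj x b t \<and> adj x b' t' \<or> adj x b t' \<and> adj x b' t)"
    using qr
  proof
    assume a: "adj x q r \<and> adj x q' r'"
    from qs show ?thesis
    proof
      assume "adj x q s \<and> adj x q' s'"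
      then show ?thesis using a n d rs by (intro exI[of _ r] exI[of _ r'] exI[of _ s'] exI[of _ s]) auto
    next
      assume "adj x q s' \<and> adj x q' s"
      then show ?thesis using a n d rs by (intro exI[of _ r] exI[of _ r'] exI[of _ s] exI[of _ s']) auto
    qed
  next
    assume a: "adj x q r' \<and> adj x q' r"
    from qs show ?thesis
    proof
      assume "adj x q s \<and> adj x q' s'"
      then show ?thesis using a n d rs by (intro exI[of _ r'] exI[of _ r] exI[of _ s'] exI[of _ s]) auto
    next
      assume "adj x q s' \<and> adj x q' s"
      then show ?thesis using a n d rs by (intro exI[of _ r'] exI[of _ r] exI[of _ s] exI[of _ s']) auto
    qed
  qed
  then obtain b b' t t' where bt: "{b, b'} = {r, r'}" "{t, t'} = {s, s'}" "nb x b" "nb x b'" "nb x t" "nb x t'"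
      "distinct [q, q', b, b', t, t']" "adj x q b" "adj x q' b'" "adj x q t'" "adj x q' t"
      "adj x b t \<and> adj x b' t' \<or> adj x b t' \<and> adj x b' t" by (elim exE conjE)
  note h = hexagon_aux[OF n(1,2) bt(3-12)]
  show "q' = \<kappa> c x (\<kappa> (\<not> c) x (\<kappa> c x q))" by (rule h(1))
  have m: "b \<in> {r, r'}" "t' \<in> {s, s'}" using bt(1,2) by auto
  show "\<exists>b\<in>{r, r'}. \<exists>t\<in>{s, s'}. {\<kappa> c x q, \<kappa> (\<not> c) x q} = {b, t}"
    by (rule bexI[OF _ m(1)], rule bexI[OF _ m(2)], rule h(2))
qed

lemma adjI: "f \<in> Fc c \<Longrightarrow> {x, q} \<in> f \<Longrightarrow> {x, r} \<in> f \<Longrightarrow> q \<noteq> r \<Longrightarrow> adj x q r"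
  using \<kappa>_eqI unfolding adj_def by metis

end

section \<open>The planarisation of a drawing\<close>

definition consecutive :: "real set \<Rightarrow> real \<Rightarrow> real \<Rightarrow> bool" where
  "consecutive \<tau> s t \<longleftrightarrow> s \<in> \<tau> \<and> t \<in> \<tau> \<and> s < t \<and> (\<forall>r\<in>\<tau>. \<not> (s < r \<and> r < t))"

lemma consecutive_unique_right: "consecutive \<tau> s t \<Longrightarrow> consecutive \<tau> s t' \<Longrightarrow> t = t'"
  unfolding consecutive_def by (metis linorder_neqE)

lemma consecutive_unique_left: "consecutive \<tau> s t \<Longrightarrow> consecutive \<tau> s' t \<Longrightarrow> s = s'"
  unfolding consecutive_def by (metis linorder_neqE)

lemma consecutive_right_ex:
  assumes "finite \<tau>" "s \<in> \<tau>" "r \<in> \<tau>" "s < r"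
  shows "\<exists>t. consecutive \<tau> s t"
proof -
  let ?R = "{t \<in> \<tau>. s < t}"
  have "finite ?R" "?R \<noteq> {}" using assms by auto
  then have "Min ?R \<in> ?R" "\<And>t. t \<in> ?R \<Longrightarrow> Min ?R \<le> t" by (rule Min_in, simp)
  then have "consecutive \<tau> s (Min ?R)" unfolding consecutive_def using assms(2) by force
  then show ?thesis by blast
qed

lemma consecutive_left_ex:
  assumes "finite \<tau>" "s \<in> \<tau>" "r \<in> \<tau>" "r < s"
  shows "\<exists>t. consecutive \<tau> t s"
proof -
  let ?R = "{t \<in> \<tau>. t < s}"
  have "finite ?R" "?R \<noteq> {}" using assms by auto
  then have "Max ?R \<in> ?R" "\<And>t. t \<in> ?R \<Longrightarrow> t \<le> Max ?R" by (rule Max_in, simp)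
  then have "consecutive \<tau> (Max ?R) s" unfolding consecutive_def using assms(2) by force
  then show ?thesis by blast
qed

lemma consecutive_cover:
  assumes "finite \<tau>" "a \<in> \<tau>" "b \<in> \<tau>" "a \<le> r" "r \<le> b" "a < b"
  shows "\<exists>s t. consecutive \<tau> s t \<and> s \<le> r \<and> r \<le> t"
proof (cases "r = b")
  case True
  then show ?thesis using consecutive_left_ex[OF assms(1,3,2,6)] unfolding consecutive_def by fastforce
next
  case False
  let ?R = "{t \<in> \<tau>. t \<le> r}"
  have "finite ?R" "?R \<noteq> {}" using assms by auto
  then have m: "Max ?R \<in> ?R" "\<And>t. t \<in> ?R \<Longrightarrow> t \<le> Max ?R" by (rule Max_in, simp)
  obtain t where t: "consecutive \<tau> (Max ?R) t"
    using consecutive_right_ex[OF assms(1), of "Max ?R" b] m(1) assms False by force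
  then have "r \<le> t" using m(2)[of t] unfolding consecutive_def by force
  then show ?thesis using t m(1) by blast
qed

lemma card_consecutive:
  assumes "finite \<tau>" "\<tau> \<noteq> {}"
  shows "card {(s, t). consecutive \<tau> s t} = card \<tau> - 1"
proof -
  have "bij_betw fst {(s, t). consecutive \<tau> s t} (\<tau> - {Max \<tau>})"
  proof (rule bij_betw_imageI)
    show "inj_on fst {(s, t). consecutive \<tau> s t}"
      by (auto simp: inj_on_def intro: consecutive_unique_right)
    show "fst ` {(s, t). consecutive \<tau> s t} = \<tau> - {Max \<tau>}"
    proof (intro equalityI subsetI)
      fix s assume "s \<in> fst ` {(s, t). consecutive \<tau> s t}"
      then obtain t where "consecutive \<tau> s t" by auto
      then have "s \<in> \<tau>" "t \<in> \<tau>" "s < t" unfolding consecutive_def by auto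
      then show "s \<in> \<tau> - {Max \<tau>}" using Max_ge[OF assms(1), of t] by auto
    next
      fix s assume s: "s \<in> \<tau> - {Max \<tau>}"
      then have "s < Max \<tau>" using Max_ge[OF assms(1), of s] by force
      then obtain t where "consecutive \<tau> s t"
        using consecutive_right_ex[OF assms(1), of s "Max \<tau>"] s Max_in[OF assms] by blast
      then show "s \<in> fst ` {(s, t). consecutive \<tau> s t}" by force
    qed
  qed
  then have "card {(s, t). consecutive \<tau> s t} = card (\<tau> - {Max \<tau>})" by (rule bij_betw_same_card)
  then show ?thesis using assms Max_in by simp
qed

text \<open>Vertices are identified with their positions, so an edge is a two-element set of points
  of the plane and can be compared directly with intersections of arcs.\<close>

locale k44_drawing =
  fixes U V :: "complex set" and E :: "complex set set" and \<gamma> :: "complex set \<Rightarrow> real \<Rightarrow> complex"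
  assumes card_UV: "card U = 4" "card V = 4" "U \<inter> V = {}"
    and E_def: "E = {{u, v} | u v. u \<in> U \<and> v \<in> V}"
    and arc: "e \<in> E \<Longrightarrow> arc (\<gamma> e)"
    and ends: "e \<in> E \<Longrightarrow> {pathstart (\<gamma> e), pathfinish (\<gamma> e)} = e"
    and image_O: "e \<in> E \<Longrightarrow> path_image (\<gamma> e) \<inter> (U \<union> V) = e"
    and adjacent: "e \<in> E \<Longrightarrow> f \<in> E \<Longrightarrow> e \<noteq> f \<Longrightarrow> e \<inter> f \<noteq> {} \<Longrightarrow>
      path_image (\<gamma> e) \<inter> path_image (\<gamma> f) = e \<inter> f"
    and disjoint: "e \<in> E \<Longrightarrow> f \<in> E \<Longrightarrow> e \<inter> f = {} \<Longrightarrow> path_image (\<gamma> e) \<inter> path_image (\<gamma> f) = {} \<or>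
      (\<exists>p. path_image (\<gamma> e) \<inter> path_image (\<gamma> f) = {p} \<and>
         meet_transversally_at (path_image (\<gamma> e)) (path_image (\<gamma> f)) p)"
    and three: "x \<notin> U \<union> V \<Longrightarrow> e \<in> E \<Longrightarrow> f \<in> E \<Longrightarrow> e \<noteq> f \<Longrightarrow> x \<in> path_image (\<gamma> e) \<Longrightarrow> x \<in> path_image (\<gamma> f) \<Longrightarrow>
      card {e \<in> E. x \<in> path_image (\<gamma> e)} = 3"
begin

definition "X = {x. x \<notin> U \<union> V \<and> (\<exists>e\<in>E. \<exists>f\<in>E. e \<noteq> f \<and> x \<in> path_image (\<gamma> e) \<inter> path_image (\<gamma> f))}"
definition "P = U \<union> V \<union> X"
definition "N e = path_image (\<gamma> e) \<inter> P"
text \<open>The nodes on an edge are ordered by their parameters; consecutive elements of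
  \<open>\<tau> e\<close> delimit one segment of the planarisation.\<close>

definition "\<tau> e = {t \<in> {0..1}. \<gamma> e t \<in> P}"
definition "seg e s t = \<gamma> e ` {s..t}"
definition "cons e s t \<longleftrightarrow> e \<in> E \<and> consecutive (\<tau> e) s t"
definition "A = {seg e s t | e s t. cons e s t}"
definition "S = {{\<gamma> e s, \<gamma> e t} | e s t. cons e s t}"

lemma finite_UV: "finite U" "finite V"
  using card_UV by (metis card.infinite zero_neq_numeral)+

lemma E_image: "E = (\<lambda>(u, v). {u, v}) ` (U \<times> V)"
  unfolding E_def by auto

lemma finite_E: "finite E"
  unfolding E_image using finite_UV by simp

lemma card_E: "card E = 16"
proof -
  have "inj_on (\<lambda>(u, v). {u, v}) (U \<times> V)"
    using card_UV(3) by (auto simp: inj_on_def doubleton_eq_iff)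
  then have "card E = card (U \<times> V)" unfolding E_image by (rule card_image)
  then show ?thesis using card_UV by (simp add: card_cartesian_product)
qed

lemma E_sub:
  assumes "e \<in> E"
  shows "e \<subseteq> U \<union> V" "card e = 2"
proof -
  obtain u v where uv: "e = {u, v}" "u \<in> U" "v \<in> V" using assms unfolding E_def by blast
  then show "e \<subseteq> U \<union> V" by blast
  have "u \<noteq> v" using uv card_UV(3) by blast
  then show "card e = 2" using uv by simp
qed

lemma common:
  assumes "e \<in> E" "f \<in> E" "e \<noteq> f"
  obtains p where "path_image (\<gamma> e) \<inter> path_image (\<gamma> f) \<subseteq> {p}"
proof (cases "e \<inter> f = {}")
  case True
  then show ?thesis using disjoint[OF assms(1,2)] that by blast
next
  case False
  have "\<exists>p. e \<inter> f \<subseteq> {p}"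
  proof -
    obtain u v u' v' where "e = {u, v}" "f = {u', v'}" "u \<in> U" "v \<in> V" "u' \<in> U" "v' \<in> V"
      using assms unfolding E_def by blast
    then show ?thesis using assms(3) card_UV(3) by (cases "u = u'") auto
  qed
  then show ?thesis using adjacent[OF assms False] that by auto
qed

lemma common_eq:
  assumes "e \<in> E" "f \<in> E" "p \<in> path_image (\<gamma> e)" "p \<in> path_image (\<gamma> f)"
    "q \<in> path_image (\<gamma> e)" "q \<in> path_image (\<gamma> f)" "p \<noteq> q"
  shows "e = f"
proof (rule ccontr)
  assume "e \<noteq> f"
  then obtain x where "path_image (\<gamma> e) \<inter> path_image (\<gamma> f) \<subseteq> {x}" by (rule common[OF assms(1,2)])
  then show False using assms(3-7) by blast
qed

lemma common_P: "e \<in> E \<Longrightarrow> f \<in> E \<Longrightarrow> e \<noteq> f \<Longrightarrow> path_image (\<gamma> e) \<inter> path_image (\<gamma> f) \<subseteq> P"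
  unfolding P_def X_def by blast

lemma finite_X: "finite X"
proof (rule finite_subset)
  show "X \<subseteq> (\<Union>e\<in>E. \<Union>f\<in>E - {e}. path_image (\<gamma> e) \<inter> path_image (\<gamma> f))"
    unfolding X_def by blast
  have "finite (path_image (\<gamma> e) \<inter> path_image (\<gamma> f))" if ef: "e \<in> E" "f \<in> E - {e}" for e f
  proof -
    obtain p where "path_image (\<gamma> e) \<inter> path_image (\<gamma> f) \<subseteq> {p}" by (rule common[of e f]) (use ef in auto)
    then show ?thesis by (rule finite_subset) simp
  qed
  then show "finite (\<Union>e\<in>E. \<Union>f\<in>E - {e}. path_image (\<gamma> e) \<inter> path_image (\<gamma> f))"
    using finite_E by (intro finite_UN_I) auto
qed

lemma X_disj: "X \<inter> (U \<union> V) = {}" unfolding X_def by blast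

lemma finite_P: "finite P" unfolding P_def using finite_X finite_UV by simp

lemma card_P: "card P = 8 + card X"
proof -
  have "card (U \<union> V) = 8" using card_UV finite_UV by (simp add: card_Un_disjoint)
  then show ?thesis unfolding P_def using finite_UV finite_X X_disj by (subst card_Un_disjoint) auto
qed

lemma inj: "e \<in> E \<Longrightarrow> inj_on (\<gamma> e) {0..1}" using arc unfolding arc_def by blast

lemma inj_eq: "e \<in> E \<Longrightarrow> s \<in> {0..1} \<Longrightarrow> t \<in> {0..1} \<Longrightarrow> \<gamma> e s = \<gamma> e t \<Longrightarrow> s = t"
  using inj by (meson inj_onD)

lemma path_image_eq: "path_image (\<gamma> e) = \<gamma> e ` {0..1}" by (simp add: path_image_def)

lemma \<tau>_sub: "\<tau> e \<subseteq> {0..1}" unfolding \<tau>_def by blast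

lemma N_image: "N e = \<gamma> e ` \<tau> e"
  unfolding N_def \<tau>_def path_image_eq by blast

lemma finite_\<tau>: "e \<in> E \<Longrightarrow> finite (\<tau> e)"
proof -
  assume e: "e \<in> E"
  have "finite (\<gamma> e ` \<tau> e)" using finite_P unfolding N_image[symmetric] N_def by simp
  then show ?thesis using inj_on_subset[OF inj[OF e] \<tau>_sub] finite_imageD by blast
qed

lemma end_points: "e \<in> E \<Longrightarrow> {\<gamma> e 0, \<gamma> e 1} = e"
  using ends unfolding pathstart_def pathfinish_def by blast

lemma \<tau>_ends: "e \<in> E \<Longrightarrow> 0 \<in> \<tau> e \<and> 1 \<in> \<tau> e"
  using end_points E_sub(1) unfolding \<tau>_def P_def by auto

lemma card_\<tau>: "e \<in> E \<Longrightarrow> card (\<tau> e) = 2 + card (N e \<inter> X)"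
proof -
  assume e: "e \<in> E"
  have "card (\<tau> e) = card (N e)" unfolding N_image
    using inj_on_subset[OF inj[OF e] \<tau>_sub] by (simp add: card_image)
  also have "N e = e \<union> (N e \<inter> X)" unfolding N_def P_def using image_O[OF e] by blast
  also have "card \<dots> = card e + card (N e \<inter> X)"
    using E_sub[OF e] finite_X X_disj finite_UV by (intro card_Un_disjoint) (auto intro: finite_subset)
  finally show ?thesis using E_sub(2)[OF e] by simp
qed

lemma consD:
  assumes "cons e s t"
  shows "e \<in> E" "s \<in> \<tau> e" "t \<in> \<tau> e" "s < t" "s \<in> {0..1}" "t \<in> {0..1}" "{s..t} \<subseteq> {0..1}"
  using assms \<tau>_sub[of e] unfolding cons_def consecutive_def by auto

lemma seg_P: "cons e s t \<Longrightarrow> seg e s t \<inter> P = {\<gamma> e s, \<gamma> e t}"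
proof -
  assume c: "cons e s t"
  note d = consD[OF c]
  have "r = s \<or> r = t" if r: "s \<le> r" "r \<le> t" "\<gamma> e r \<in> P" for r
  proof -
    have "r \<in> \<tau> e" unfolding \<tau>_def using r d by auto
    then show ?thesis using c r unfolding cons_def consecutive_def by force
  qed
  then have "seg e s t \<inter> P \<subseteq> {\<gamma> e s, \<gamma> e t}" unfolding seg_def by fastforce
  moreover have "\<gamma> e s \<in> P" "\<gamma> e t \<in> P" using d(2,3) unfolding \<tau>_def by auto
  ultimately show ?thesis unfolding seg_def using d(4) by auto
qed

lemma seg_arc:
  assumes c: "cons e s t"
  shows "arc (subpath s t (\<gamma> e))" "path_image (subpath s t (\<gamma> e)) = seg e s t"
    "pathstart (subpath s t (\<gamma> e)) = \<gamma> e s" "pathfinish (subpath s t (\<gamma> e)) = \<gamma> e t"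
proof -
  note d = consD[OF c]
  show "arc (subpath s t (\<gamma> e))"
    using arc_subpath_arc[OF arc[OF d(1)] d(5,6)] d(4) by simp
  show "path_image (subpath s t (\<gamma> e)) = seg e s t"
    unfolding seg_def using d(4) by (simp add: path_image_subpath_gen closed_segment_eq_real_ivl)
qed simp_all

text \<open>Two different edges share at most one point, so the two ends of a segment determine its
  edge, and injectivity of the arc determines the parameters. Hence segments may be represented by
  their pairs of ends.\<close>

lemma seg_inj:
  assumes "cons e s t" "cons f s' t'" "{\<gamma> e s, \<gamma> e t} = {\<gamma> f s', \<gamma> f t'}"
  shows "e = f \<and> s = s' \<and> t = t'"
proof -
  note d = consD[OF assms(1)] and d' = consD[OF assms(2)]
  have ne: "\<gamma> e s \<noteq> \<gamma> e t" using inj_eq[OF d(1,5,6)] d(4) by auto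
  have "\<gamma> e s \<in> path_image (\<gamma> e)" "\<gamma> e t \<in> path_image (\<gamma> e)" "\<gamma> f s' \<in> path_image (\<gamma> f)" "\<gamma> f t' \<in> path_image (\<gamma> f)"
    using d d' unfolding path_image_eq by auto
  then have ef: "e = f" using common_eq[OF d(1) d'(1) _ _ _ _ ne] assms(3) by (auto simp: doubleton_eq_iff)
  then have "\<gamma> e s = \<gamma> e s' \<and> \<gamma> e t = \<gamma> e t' \<or> \<gamma> e s = \<gamma> e t' \<and> \<gamma> e t = \<gamma> e s'"
    using assms(3) by (auto simp: doubleton_eq_iff)
  then have "s = s' \<and> t = t' \<or> s = t' \<and> t = s'" using inj_eq[OF d(1)] d d' by blast
  then show ?thesis using ef d(4) d'(4) by auto
qed

lemma cons_set: "{(e, s, t). cons e s t} = Sigma E (\<lambda>e. {(s, t). consecutive (\<tau> e) s t})"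
  unfolding cons_def by auto

lemma finite_cons: "finite {(e, s, t). cons e s t}"
proof -
  have "finite {(s, t). consecutive (\<tau> e) s t}" if "e \<in> E" for e
    by (rule finite_subset[of _ "\<tau> e \<times> \<tau> e"]) (use finite_\<tau>[OF that] in \<open>auto simp: consecutive_def\<close>)
  then show ?thesis unfolding cons_set using finite_E by auto
qed

lemma S_image: "S = (\<lambda>(e, s, t). {\<gamma> e s, \<gamma> e t}) ` {(e, s, t). cons e s t}"
  unfolding S_def by (auto simp: image_iff)

lemma A_image: "A = (\<lambda>(e, s, t). seg e s t) ` {(e, s, t). cons e s t}"
  unfolding A_def by (auto simp: image_iff)

lemma finite_S: "finite S" and finite_A: "finite A"
  unfolding S_image A_image using finite_cons by simp_all

lemma sum_crossings: "(\<Sum>e\<in>E. card (N e \<inter> X)) = 3 * card X"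
proof -
  have "(\<Sum>e\<in>E. card (N e \<inter> X)) = card (Sigma E (\<lambda>e. N e \<inter> X))" using finite_E finite_X by simp
  also have "\<dots> = card (Sigma X (\<lambda>x. {e \<in> E. x \<in> path_image (\<gamma> e)}))"
  proof (rule bij_betw_same_card[of "\<lambda>(e, x). (x, e)"])
    show "bij_betw (\<lambda>(e, x). (x, e)) (Sigma E (\<lambda>e. N e \<inter> X)) (Sigma X (\<lambda>x. {e \<in> E. x \<in> path_image (\<gamma> e)}))"
      unfolding bij_betw_def inj_on_def N_def P_def by (auto simp: image_iff)
  qed
  also have "\<dots> = (\<Sum>x\<in>X. card {e \<in> E. x \<in> path_image (\<gamma> e)})" using finite_E finite_X by simp
  also have "\<dots> = (\<Sum>x\<in>X. 3)"
  proof (rule sum.cong)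
    fix x assume "x \<in> X"
    then show "card {e \<in> E. x \<in> path_image (\<gamma> e)} = 3" using three unfolding X_def by blast
  qed simp
  finally show ?thesis by simp
qed

text \<open>An edge with \<open>n\<close> triple points is cut into \<open>n + 1\<close> segments,
  and summing over the 16 edges counts every triple point three times.\<close>

lemma card_S: "card S = 16 + 3 * card X"
proof -
  have "inj_on (\<lambda>(e, s, t). {\<gamma> e s, \<gamma> e t}) {(e, s, t). cons e s t}"
    using seg_inj by (auto simp: inj_on_def)
  then have "card S = card {(e, s, t). cons e s t}" unfolding S_image by (rule card_image)
  also have "\<dots> = (\<Sum>e\<in>E. card {(s, t). consecutive (\<tau> e) s t})" unfolding cons_set
  proof (rule card_SigmaI[OF finite_E])
    show "\<forall>e\<in>E. finite {(s, t). consecutive (\<tau> e) s t}"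
    proof
      fix e assume "e \<in> E"
      show "finite {(s, t). consecutive (\<tau> e) s t}"
        by (rule finite_subset[of _ "\<tau> e \<times> \<tau> e"]) (use finite_\<tau>[OF \<open>e \<in> E\<close>] in \<open>auto simp: consecutive_def\<close>)
    qed
  qed
  also have "\<dots> = (\<Sum>e\<in>E. 1 + card (N e \<inter> X))"
  proof (rule sum.cong)
    fix e assume e: "e \<in> E"
    show "card {(s, t). consecutive (\<tau> e) s t} = 1 + card (N e \<inter> X)"
      using card_consecutive[OF finite_\<tau>[OF e]] \<tau>_ends[OF e] card_\<tau>[OF e] by auto
  qed simp
  also have "\<dots> = 16 + 3 * card X" 
    using card_E sum_crossings by (subst sum.distrib) simp
  finally show ?thesis .
qed

lemma seg_sub: "cons e s t \<Longrightarrow> seg e s t \<subseteq> path_image (\<gamma> e)"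
  using consD(7) unfolding seg_def path_image_eq by blast

lemma seg_Int:
  assumes "cons e s t" "cons f s' t'" "seg e s t \<noteq> seg f s' t'"
  shows "seg e s t \<inter> seg f s' t' \<subseteq> P"
proof (cases "e = f")
  case False
  then show ?thesis using common_P[of e f] seg_sub[OF assms(1)] seg_sub[OF assms(2)] consD(1)[OF assms(1)] consD(1)[OF assms(2)]
    by blast
next
  case True
  note d = consD[OF assms(1)] and d' = consD[OF assms(2)]
  have ne: "s \<noteq> s' \<or> t \<noteq> t'" using assms(3) True by blast
  show ?thesis
  proof
    fix z assume z: "z \<in> seg e s t \<inter> seg f s' t'"
    have "\<exists>r\<in>{s..t}. z = \<gamma> e r" "\<exists>r\<in>{s'..t'}. z = \<gamma> e r"
      using z True unfolding seg_def by blast+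
    then obtain r r' where r1: "z = \<gamma> e r" "s \<le> r" "r \<le> t" and r2: "z = \<gamma> e r'" "s' \<le> r'" "r' \<le> t'"
      by (meson atLeastAtMost_iff)
    note r = r1 r2
    then have "r = r'" using inj_eq[OF d(1), of r r'] d d' by auto
    moreover have "t \<le> s' \<or> t' \<le> s"
    proof (rule ccontr)
      assume a: "\<not> ?thesis"
      have st: "s' \<in> \<tau> e" "t' \<in> \<tau> e" using d' True by auto
      have "\<not> (s < s' \<and> s' < t)" "\<not> (s < t' \<and> t' < t)"
        using assms(1) st unfolding cons_def consecutive_def by auto
      moreover have "\<not> (s' < s \<and> s < t')" "\<not> (s' < t \<and> t < t')"
        using assms(2) d(2,3) True unfolding cons_def consecutive_def by auto
      ultimately show False using a ne d(4) d'(4) by linarith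
    qed
    ultimately have "r = t \<or> r = s" using r by auto
    then show "z \<in> P" using r(1) d(2,3) unfolding \<tau>_def by auto
  qed
qed

lemma rest_image:
  assumes c: "cons e s t" and "r \<in> {0..1}" "f \<in> E" "f = e \<longrightarrow> r \<le> s \<or> t \<le> r"
  shows "\<gamma> f r \<in> P \<union> \<Union>(A - {seg e s t})"
proof (cases "\<gamma> f r \<in> P")
  case False
  obtain s' t' where st: "consecutive (\<tau> f) s' t'" "s' \<le> r" "r \<le> t'"
    using consecutive_cover[OF finite_\<tau>[OF assms(3)], of 0 1 r] \<tau>_ends[OF assms(3)] assms(2) by auto
  then have c': "cons f s' t'" using assms(3) unfolding cons_def by blast
  have z: "\<gamma> f r \<in> seg f s' t'" unfolding seg_def using st by auto
  have "seg f s' t' \<noteq> seg e s t"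
  proof
    assume eq: "seg f s' t' = seg e s t"
    then have "{\<gamma> f s', \<gamma> f t'} = {\<gamma> e s, \<gamma> e t}" using seg_P[OF c] seg_P[OF c'] by simp
    then have "f = e" "s' = s" "t' = t" using seg_inj[OF c' c] by auto
    then have "r = s \<or> r = t" using st assms(4) by auto
    then have "r \<in> \<tau> f" using consD(2,3)[OF c] \<open>f = e\<close> by auto
    then show False using False unfolding \<tau>_def by blast
  qed
  moreover have "seg f s' t' \<in> A" unfolding A_def using c' by blast
  ultimately show ?thesis using z by blast
qed simp

sublocale G: plane_graph P A
proof
  show "finite P" "finite A" using finite_P finite_A .
  show "\<exists>g. arc g \<and> path_image g = s \<and> s \<inter> P = {pathstart g, pathfinish g}" if s: "s \<in> A" for s
  proof -
    obtain e a b where c: "s = seg e a b" "cons e a b" using s unfolding A_def by blast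
    show ?thesis using seg_arc[OF c(2)] seg_P[OF c(2)] c(1) by metis
  qed
  show "s \<inter> t \<subseteq> P" if st: "s \<in> A" "t \<in> A" "s \<noteq> t" for s t
    using st seg_Int unfolding A_def by blast
qed

lemma path_component_image:
  assumes c: "cons e s t" and f: "f \<in> E" and ab: "0 \<le> a" "a \<le> b" "b \<le> 1" and ne: "f = e \<longrightarrow> b \<le> s \<or> t \<le> a"
  shows "path_component (P \<union> \<Union>(A - {seg e s t})) (\<gamma> f a) (\<gamma> f b)"
proof -
  have "path (subpath a b (\<gamma> f))" using arc_imp_path[OF arc[OF f]] ab by (intro path_subpath) auto
  moreover have "path_image (subpath a b (\<gamma> f)) \<subseteq> P \<union> \<Union>(A - {seg e s t})"
  proof
    fix z assume "z \<in> path_image (subpath a b (\<gamma> f))"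
    then obtain r where r: "z = \<gamma> f r" "a \<le> r" "r \<le> b"
      using ab by (auto simp: path_image_subpath_gen closed_segment_eq_real_ivl)
    then show "z \<in> P \<union> \<Union>(A - {seg e s t})" using rest_image[OF c _ f, of r] ab ne by auto
  qed
  ultimately show ?thesis unfolding path_component_def by (intro exI[of _ "subpath a b (\<gamma> f)"]) simp
qed

text \<open>Every edge \<open>u v\<close> of \<open>K\<^sub>4\<^sub>,\<^sub>4\<close> lies on a
  4-cycle \<open>u v' u' v\<close>. The ends of a segment are joined without using it by following
  the edge outwards to \<open>u\<close> and \<open>v\<close> and taking the other three edges of the
  cycle.\<close>

lemma bridgeless:
  assumes c: "cons e s t"
  shows "path_component (P \<union> \<Union>(A - {seg e s t})) (\<gamma> e s) (\<gamma> e t)"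
proof -
  let ?R = "path_component (P \<union> \<Union>(A - {seg e s t}))"
  note d = consD[OF c]
  obtain u v where uv: "e = {u, v}" "u \<in> U" "v \<in> V" using d(1) unfolding E_def by blast
  have "\<not> U \<subseteq> {u}" "\<not> V \<subseteq> {v}" using card_UV card_mono[of "{u}" U] card_mono[of "{v}" V] by auto
  then obtain u' v' where uv': "u' \<in> U" "v' \<in> V" "u' \<noteq> u" "v' \<noteq> v" by blast
  have ne: "{u, v'} \<noteq> e" "{u', v'} \<noteq> e" "{u', v} \<noteq> e"
    using uv uv' card_UV(3) by (auto simp: doubleton_eq_iff)
  have edge: "?R x y" if f: "{x, y} \<in> E" "{x, y} \<noteq> e" for x y
  proof -
    have r: "?R (\<gamma> {x, y} 0) (\<gamma> {x, y} 1)" using path_component_image[OF c f(1), of 0 1] f(2) by simp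
    then have r': "?R (\<gamma> {x, y} 1) (\<gamma> {x, y} 0)" by (rule path_component_sym)
    have "{\<gamma> {x, y} 0, \<gamma> {x, y} 1} = {x, y}" by (rule end_points[OF f(1)])
    then show ?thesis using r r' by (auto simp: doubleton_eq_iff)
  qed
  have E: "{u, v'} \<in> E" "{u', v'} \<in> E" "{v, u'} \<in> E" "{v', u'} \<in> E" "{u', v} \<in> E" unfolding E_def using uv uv' by (auto simp: insert_commute)
  have "?R u v'" "?R v' u'" "?R u' v" using edge E ne by (auto simp: insert_commute)
  then have uvR: "?R u v" by (meson path_component_trans)
  have 0: "?R (\<gamma> e 0) (\<gamma> e s)" "?R (\<gamma> e t) (\<gamma> e 1)"
    using path_component_image[OF c d(1), of 0 s] path_component_image[OF c d(1), of t 1] d by auto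
  have "?R (\<gamma> e 0) (\<gamma> e 1)"
    using end_points[OF d(1)] uv(1) uvR path_component_sym[OF uvR] by (auto simp: doubleton_eq_iff)
  then show ?thesis using 0 by (meson path_component_trans path_component_sym)
qed

sublocale G: bridgeless_plane_graph P A
proof
  show "path_component (P \<union> \<Union>(A - {s})) p q" if s: "s \<in> A" and pq: "p \<in> s \<inter> P" "q \<in> s \<inter> P" for s p q
  proof -
    obtain e a b where c: "s = seg e a b" "cons e a b" using s unfolding A_def by blast
    note b = bridgeless[OF c(2)]
    have "p = \<gamma> e a \<or> p = \<gamma> e b" "q = \<gamma> e a \<or> q = \<gamma> e b" using pq seg_P[OF c(2)] c(1) by auto
    moreover have "p \<in> P" "q \<in> P" using pq by auto
    ultimately show ?thesis using b path_component_sym[OF b] c(1) by (auto intro: path_component_refl)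
  qed
  show "s = t" if st: "s \<in> A" "t \<in> A" "s \<inter> P = t \<inter> P" for s t
  proof -
    obtain e a b where c: "s = seg e a b" "cons e a b" using st(1) unfolding A_def by blast
    obtain f a' b' where c': "t = seg f a' b'" "cons f a' b'" using st(2) unfolding A_def by blast
    have "{\<gamma> e a, \<gamma> e b} = {\<gamma> f a', \<gamma> f b'}" using st(3) seg_P[OF c(2)] seg_P[OF c'(2)] c(1) c'(1) by simp
    then show ?thesis using seg_inj[OF c(2) c'(2)] c(1) c'(1) by simp
  qed
  show "A \<noteq> {}"
  proof -
    have "S \<noteq> {}" using card_S by auto
    then show ?thesis unfolding S_def A_def by blast
  qed
qed

lemma A_S: "(\<lambda>s. s \<inter> P) ` A = S"
proof -
  have "(\<lambda>s. s \<inter> P) ` A = (\<lambda>(e, s, t). seg e s t \<inter> P) ` {(e, s, t). cons e s t}"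
    unfolding A_image by (auto simp: image_iff)
  also have "\<dots> = S" unfolding S_image
  proof (rule image_cong)
    fix x assume x: "x \<in> {(e, s, t). cons e s t}"
    obtain e s t where "x = (e, s, t)" by (cases x)
    then show "(case x of (e, s, t) \<Rightarrow> seg e s t \<inter> P) = (case x of (e, s, t) \<Rightarrow> {\<gamma> e s, \<gamma> e t})"
      using seg_P x by simp
  qed simp
  finally show ?thesis .
qed

lemma A_inj: "inj_on (\<lambda>s. s \<inter> P) A"
  using G.simple by (auto simp: inj_on_def)

lemma card_A: "card A = card S"
  using card_image[OF A_inj] A_S by simp

section \<open>Two-colouring the faces by winding numbers\<close>

definition "K = P \<union> \<Union>A"

lemma image_K: "f \<in> E \<Longrightarrow> path_image (\<gamma> f) \<subseteq> K"
proof
  fix z assume f: "f \<in> E" and "z \<in> path_image (\<gamma> f)"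
  then obtain r where r: "z = \<gamma> f r" "0 \<le> r" "r \<le> 1" unfolding path_image_eq by auto
  obtain s t where st: "consecutive (\<tau> f) s t" "s \<le> r" "r \<le> t"
    using consecutive_cover[OF finite_\<tau>[OF f], of 0 1 r] \<tau>_ends[OF f] r by auto
  then have "cons f s t" using f unfolding cons_def by blast
  then have "seg f s t \<in> A" unfolding A_def by blast
  moreover have "z \<in> seg f s t" unfolding seg_def using r st by auto
  ultimately show "z \<in> K" unfolding K_def by blast
qed

text \<open>An arc \<open>\<gamma> e\<close> may run in either direction. \<open>\<eta> u v\<close>
  runs from \<open>u\<close> in \<open>U\<close> to \<open>v\<close> in \<open>V\<close>, and
  \<open>dir u v\<close> is the sign that this change of direction gives to the winding
  number.\<close>

definition "\<eta> u v = (if pathstart (\<gamma> {u, v}) = u then \<gamma> {u, v} else reversepath (\<gamma> {u, v}))"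
definition "dir u v = (if pathstart (\<gamma> {u, v}) = u then 1 else - 1 :: complex)"

lemma \<eta>:
  assumes "u \<in> U" "v \<in> V"
  shows "path (\<eta> u v)" "pathstart (\<eta> u v) = u" "pathfinish (\<eta> u v) = v" "path_image (\<eta> u v) \<subseteq> K"
    "z \<notin> K \<Longrightarrow> winding_number (\<eta> u v) z = dir u v * winding_number (\<gamma> {u, v}) z"
proof -
  have e: "{u, v} \<in> E" unfolding E_def using assms by blast
  have uv: "u \<noteq> v" using assms card_UV(3) by blast
  note p = arc_imp_path[OF arc[OF e]]
  show "path (\<eta> u v)" unfolding \<eta>_def using p by simp
  show "pathstart (\<eta> u v) = u" "pathfinish (\<eta> u v) = v"
    using ends[OF e] uv unfolding \<eta>_def by (auto simp: doubleton_eq_iff)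
  show "path_image (\<eta> u v) \<subseteq> K" unfolding \<eta>_def using image_K[OF e] by simp
  show "winding_number (\<eta> u v) z = dir u v * winding_number (\<gamma> {u, v}) z" if "z \<notin> K"
    using winding_number_reversepath[OF p, of z] image_K[OF e] that unfolding \<eta>_def dir_def by auto
qed

definition "wn u v z = dir u v * winding_number (\<gamma> {u, v}) z"
definition "loop u u' v v' = (\<eta> u v +++ reversepath (\<eta> u' v)) +++ (\<eta> u' v' +++ reversepath (\<eta> u v'))"

lemma loop:
  assumes "u \<in> U" "u' \<in> U" "v \<in> V" "v' \<in> V"
  shows "path (loop u u' v v')" "pathstart (loop u u' v v') = pathfinish (loop u u' v v')"
    "path_image (loop u u' v v') \<subseteq> K"
    "z \<notin> K \<Longrightarrow> winding_number (loop u u' v v') z = wn u v z - wn u' v z + wn u' v' z - wn u v' z"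
proof -
  note n = \<eta>[OF assms(1,3)] \<eta>[OF assms(2,3)] \<eta>[OF assms(2,4)] \<eta>[OF assms(1,4)]
  show "path (loop u u' v v')" "pathstart (loop u u' v v') = pathfinish (loop u u' v v')"
    unfolding loop_def using n by simp_all
  show "path_image (loop u u' v v') \<subseteq> K"
    unfolding loop_def using n by (simp add: path_image_join)
  show "winding_number (loop u u' v v') z = wn u v z - wn u' v z + wn u' v' z - wn u v' z" if z: "z \<notin> K"
  proof -
    have o: "z \<notin> path_image (\<eta> u v)" "z \<notin> path_image (\<eta> u' v)" "z \<notin> path_image (\<eta> u' v')" "z \<notin> path_image (\<eta> u v')"
      using n z by blast+
    have "winding_number (loop u u' v v') z =
        winding_number (\<eta> u v +++ reversepath (\<eta> u' v)) z + winding_number (\<eta> u' v' +++ reversepath (\<eta> u v')) z"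
      unfolding loop_def using n o by (intro winding_number_join) (auto simp: path_image_join)
    moreover have "winding_number (\<eta> u v +++ reversepath (\<eta> u' v)) z = winding_number (\<eta> u v) z - winding_number (\<eta> u' v) z"
      using n o winding_number_join[of "\<eta> u v" z "reversepath (\<eta> u' v)"] winding_number_reversepath[of "\<eta> u' v" z] by simp
    moreover have "winding_number (\<eta> u' v' +++ reversepath (\<eta> u v')) z = winding_number (\<eta> u' v') z - winding_number (\<eta> u v') z"
      using n o winding_number_join[of "\<eta> u' v'" z "reversepath (\<eta> u v')"] winding_number_reversepath[of "\<eta> u v'" z] by simp
    ultimately show ?thesis using n z unfolding wn_def by simp
  qed
qed

text \<open>\<open>K\<^sub>4\<^sub>,\<^sub>4\<close> is the edge-disjoint union of four 4-cycles; the faces are coloured by the parity of the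
  total winding number of these closed curves.\<close>

lemma winding_sum:
  obtains \<sigma> :: "complex \<times> complex \<Rightarrow> complex" and \<Omega> :: "complex \<Rightarrow> complex" where
    "\<And>x. \<sigma> x = 1 \<or> \<sigma> x = -1"
    "\<And>z. \<Omega> z = (\<Sum>x\<in>U \<times> V. \<sigma> x * winding_number (\<gamma> {fst x, snd x}) z)"
    "\<And>z. z \<notin> K \<Longrightarrow> \<Omega> z \<in> \<int>"
    "\<And>C y z. connected C \<Longrightarrow> C \<inter> K = {} \<Longrightarrow> y \<in> C \<Longrightarrow> z \<in> C \<Longrightarrow> \<Omega> y = \<Omega> z"
proof -
  obtain us where us: "set us = U" "distinct us" using finite_UV finite_distinct_list by blast
  then have "length us = 4" using card_UV(1) distinct_card by metis
  then obtain u0 u1 u2 u3 where "us = [u0, u1, u2, u3]" by (auto simp: numeral_eq_Suc length_Suc_conv)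
  then have U: "U = {u0, u1, u2, u3}" "distinct [u0, u1, u2, u3]" using us by auto
  obtain vs where vs: "set vs = V" "distinct vs" using finite_UV finite_distinct_list by blast
  then have "length vs = 4" using card_UV(2) distinct_card by metis
  then obtain v0 v1 v2 v3 where "vs = [v0, v1, v2, v3]" by (auto simp: numeral_eq_Suc length_Suc_conv)
  then have V: "V = {v0, v1, v2, v3}" "distinct [v0, v1, v2, v3]" using vs by auto
  \<comment> \<open>\<open>a u * b v\<close> is the sign with which the edge from \<open>u\<close>
    to \<open>v\<close> is traversed in its 4-cycle. The four cycles combine \<open>u0, u1\<close>
    or \<open>u2, u3\<close> with \<open>v0, v1\<close> or \<open>v2, v3\<close>.\<close>
  define a where "a u = (if u = u0 \<or> u = u2 then 1 else - 1 :: complex)" for u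
  define b where "b v = (if v = v0 \<or> v = v2 then 1 else - 1 :: complex)" for v
  have ab: "a u0 = 1" "a u1 = -1" "a u2 = 1" "a u3 = -1" "b v0 = 1" "b v1 = -1" "b v2 = 1" "b v3 = -1"
    using U(2) V(2) unfolding a_def b_def by auto
  define \<sigma> where "\<sigma> x = a (fst x) * b (snd x) * dir (fst x) (snd x)" for x
  define \<Omega> where "\<Omega> z = (\<Sum>x\<in>U \<times> V. \<sigma> x * winding_number (\<gamma> {fst x, snd x}) z)" for z
  have eq: "\<Omega> z = winding_number (loop u0 u1 v0 v1) z + winding_number (loop u0 u1 v2 v3) z +
      winding_number (loop u2 u3 v0 v1) z + winding_number (loop u2 u3 v2 v3) z" if z: "z \<notin> K" for z
  proof -
    have "\<Omega> z = (\<Sum>u\<in>U. \<Sum>v\<in>V. a u * b v * wn u v z)"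
      unfolding \<Omega>_def \<sigma>_def wn_def by (simp add: sum.cartesian_product case_prod_unfold mult.assoc)
    also have "\<dots> = (\<Sum>u\<in>U. a u * (wn u v0 z - wn u v1 z + wn u v2 z - wn u v3 z))"
    proof (rule sum.cong)
      fix u
      have "(\<Sum>v\<in>V. a u * b v * wn u v z) = a u * (b v0 * wn u v0 z + (b v1 * wn u v1 z + (b v2 * wn u v2 z + b v3 * wn u v3 z)))"
        using V by (simp add: algebra_simps)
      also have "\<dots> = a u * (wn u v0 z - wn u v1 z + wn u v2 z - wn u v3 z)"
        unfolding ab by (simp add: algebra_simps)
      finally show "(\<Sum>v\<in>V. a u * b v * wn u v z) = a u * (wn u v0 z - wn u v1 z + wn u v2 z - wn u v3 z)" .
    qed simp
    also have "\<dots> = a u0 * (wn u0 v0 z - wn u0 v1 z + wn u0 v2 z - wn u0 v3 z) + (a u1 * (wn u1 v0 z - wn u1 v1 z + wn u1 v2 z - wn u1 v3 z)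
        + (a u2 * (wn u2 v0 z - wn u2 v1 z + wn u2 v2 z - wn u2 v3 z) + a u3 * (wn u3 v0 z - wn u3 v1 z + wn u3 v2 z - wn u3 v3 z)))"
      using U by simp
    also have "\<dots> = (wn u0 v0 z - wn u0 v1 z + wn u0 v2 z - wn u0 v3 z) - (wn u1 v0 z - wn u1 v1 z + wn u1 v2 z - wn u1 v3 z)
        + (wn u2 v0 z - wn u2 v1 z + wn u2 v2 z - wn u2 v3 z) - (wn u3 v0 z - wn u3 v1 z + wn u3 v2 z - wn u3 v3 z)"
      unfolding ab by simp
    finally show ?thesis using loop(4)[OF _ _ _ _ z] U(1) V(1) by simp
  qed
  have inU: "u0 \<in> U" "u1 \<in> U" "u2 \<in> U" "u3 \<in> U" and inV: "v0 \<in> V" "v1 \<in> V" "v2 \<in> V" "v3 \<in> V" using U V by auto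
  note l = loop[OF inU(1,2) inV(1,2)] loop[OF inU(1,2) inV(3,4)] loop[OF inU(3,4) inV(1,2)] loop[OF inU(3,4) inV(3,4)]
  show ?thesis
  proof (rule that)
    show "\<sigma> x = 1 \<or> \<sigma> x = -1" for x unfolding \<sigma>_def a_def b_def dir_def by simp
    show "\<Omega> z = (\<Sum>x\<in>U \<times> V. \<sigma> x * winding_number (\<gamma> {fst x, snd x}) z)" for z by (rule \<Omega>_def)
    show "\<Omega> z \<in> \<int>" if "z \<notin> K" for z
    proof -
      have "winding_number (loop u u' v v') z \<in> \<int>" if "u \<in> U" "u' \<in> U" "v \<in> V" "v' \<in> V" for u u' v v'
        using integer_winding_number[OF loop(1)[OF that] loop(2)[OF that, symmetric], of z] loop(3)[OF that] \<open>z \<notin> K\<close> by blast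
      then show ?thesis unfolding eq[OF that] using inU inV by (intro Ints_add) auto
    qed
    show "\<Omega> y = \<Omega> z" if C: "connected C" "C \<inter> K = {}" "y \<in> C" "z \<in> C" for C y z
    proof -
      have "winding_number (loop u u' v v') y = winding_number (loop u u' v v') z"
        if "u \<in> U" "u' \<in> U" "v \<in> V" "v' \<in> V" for u u' v v'
        using winding_number_eq[OF loop(1)[OF that] loop(2)[OF that, symmetric] C(3,4,1)] loop(3)[OF that] C(2) by blast
      moreover have "y \<notin> K" "z \<notin> K" using C by auto
      ultimately show ?thesis using eq inU inV by simp
    qed
  qed
qed

text \<open>The total winding number is a constant integer on every face and changes by one across
  an arc: exactly one edge runs through the arc, and the contributions of everything else are
  continuous there. So faces on both sides of an arc have different parity.\<close>

lemma colouring: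
  obtains col :: "complex set \<Rightarrow> bool" where
    "\<And>s F F'. s \<in> A \<Longrightarrow> F \<in> G.faces \<Longrightarrow> F' \<in> G.faces \<Longrightarrow> s \<in> G.bdry F \<Longrightarrow> s \<in> G.bdry F' \<Longrightarrow> F \<noteq> F' \<Longrightarrow> col F \<noteq> col F'"
proof -
  obtain \<sigma> \<Omega> where \<Omega>: "\<And>x. \<sigma> x = 1 \<or> \<sigma> x = (-1 :: complex)"
    "\<And>z. \<Omega> z = (\<Sum>x\<in>U \<times> V. \<sigma> x * winding_number (\<gamma> {fst x, snd x}) z)"
    "\<And>z. z \<notin> K \<Longrightarrow> \<Omega> z \<in> \<int>"
    "\<And>C y z. connected C \<Longrightarrow> C \<inter> K = {} \<Longrightarrow> y \<in> C \<Longrightarrow> z \<in> C \<Longrightarrow> \<Omega> y = \<Omega> z"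
    by (rule winding_sum) blast
  define val where "val F = \<Omega> (SOME z. z \<in> F)" for F
  have face: "connected F" "F \<inter> K = {}" "F \<noteq> {}" if "F \<in> G.faces" for F
    using that in_components_connected in_components_nonempty G.face_off unfolding G.faces_def K_def by blast+
  have val: "\<Omega> z = val F" if "F \<in> G.faces" "z \<in> F" for F z
    unfolding val_def by (rule \<Omega>(4)[OF face(1,2)[OF that(1)] that(2)]) (use that(2) in \<open>rule someI\<close>)
  have val_int: "val F \<in> \<int>" if F: "F \<in> G.faces" for F
  proof -
    obtain z where z: "z \<in> F" using face(3)[OF F] by blast
    then have "z \<notin> K" using face(2)[OF F] by blast
    then show ?thesis using \<Omega>(3)[of z] val[OF F z] by simp
  qed
  have jump: "\<exists>D D'. D \<in> G.faces \<and> D' \<in> G.faces \<and> D \<noteq> D' \<and> s0 \<in> G.bdry D \<and> s0 \<in> G.bdry D' \<and>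
      (val D - val D' = 1 \<or> val D - val D' = -1)" if s0: "s0 \<in> A" for s0
  proof -
    obtain e s t where c: "s0 = seg e s t" "cons e s t" using s0 unfolding A_def by blast
    note d = consD[OF c(2)]
    let ?g = "subpath s t (\<gamma> e)"
    note g = seg_arc[OF c(2), folded c(1)]
    have ends: "s0 \<inter> P = {pathstart ?g, pathfinish ?g}" using seg_P[OF c(2)] c(1) by simp
    have con: "path_component (P \<union> \<Union>(A - {s0})) (pathfinish ?g) (pathstart ?g)"
      using path_component_sym[OF bridgeless[OF c(2)]] c(1) by simp
    have B: "A - {s0} \<subseteq> A" "s0 \<notin> A - {s0}" by auto
    obtain D D' a where Da: "arc a" "path_image a \<subseteq> P \<union> \<Union>(A - {s0})" "pathstart a = pathfinish ?g" "pathfinish a = pathstart ?g"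
      "D \<in> components (- (P \<union> \<Union>(insert s0 (A - {s0}))))" "D' \<in> components (- (P \<union> \<Union>(insert s0 (A - {s0}))))"
      "D \<noteq> D'" "D \<subseteq> inside (path_image (?g +++ a))" "D' \<subseteq> outside (path_image (?g +++ a))"
      "\<And>m. m \<in> s0 - P \<Longrightarrow> m \<in> closure D \<and> m \<in> closure D' \<and> (\<exists>\<delta>>0. ball m \<delta> - s0 \<subseteq> D \<union> D')"
      by (rule G.arc_sides[OF B(1) s0 B(2) g(1,2) ends con]) blast
    have "insert s0 (A - {s0}) = A" using s0 by blast
    then have DF: "D \<in> G.faces" "D' \<in> G.faces" using Da(5,6) unfolding G.faces_def by auto
    have "s0 - P \<noteq> {}" by (rule G.interior_ne[OF s0])
    then obtain m where m: "m \<in> s0 - P" by blast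
    have mD: "m \<in> closure D" "m \<in> closure D'" using Da(10)[OF m] by auto
    have touch: "s0 \<in> G.bdry D" "s0 \<in> G.bdry D'"
      unfolding G.bdry_def G.touches_def using s0 m mD by blast+
    have a_s0: "s0 \<inter> path_image a \<subseteq> P" using Da(2) G.inter s0 by blast
    have J: "simple_path (?g +++ a)"
    proof (rule simple_path_join_loop)
      show "path_image ?g \<inter> path_image a \<subseteq> {pathstart ?g, pathstart a}"
        using a_s0 ends g(2) Da(3) by auto
    qed (use Da g in auto)
    obtain u v where uv: "e = {u, v}" "u \<in> U" "v \<in> V" using d(1) unfolding E_def by blast
    let ?x = "(u, v)" and ?I = "U \<times> V - {(u, v)}"
    \<comment> \<open>\<open>R\<close> collects all contributions except that of the segment itself:
      the two remaining pieces of the edge \<open>e\<close> and the other 15 edges.\<close>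
    define R where "R z = \<sigma> ?x * (winding_number (subpath 0 s (\<gamma> e)) z + winding_number (subpath t 1 (\<gamma> e)) z) +
      (\<Sum>x\<in>?I. \<sigma> x * winding_number (\<gamma> {fst x, snd x}) z)" for z
    have pe: "path (\<gamma> e)" using arc_imp_path[OF arc[OF d(1)]] .
    have 01: "(0::real) \<in> {0..1}" "(1::real) \<in> {0..1}" by auto
    have psub: "path (subpath 0 s (\<gamma> e))" "path (subpath t 1 (\<gamma> e))" using pe d(5,6) 01 by (auto intro!: path_subpath)
    have \<Omega>g: "\<Omega> z = \<sigma> ?x * winding_number ?g z + R z" if z: "z \<in> D \<union> D'" for z
    proof -
      have zK: "z \<notin> K" using z face(2) DF by blast
      then have ze: "z \<notin> path_image (\<gamma> e)" using image_K[OF d(1)] by blast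
      have "winding_number (subpath 0 s (\<gamma> e)) z + winding_number (subpath s 1 (\<gamma> e)) z = winding_number (subpath 0 1 (\<gamma> e)) z"
        by (rule winding_number_subpath_combine[OF pe ze]) (use d in auto)
      moreover have "winding_number (subpath s t (\<gamma> e)) z + winding_number (subpath t 1 (\<gamma> e)) z = winding_number (subpath s 1 (\<gamma> e)) z"
        by (rule winding_number_subpath_combine[OF pe ze]) (use d in auto)
      ultimately have "winding_number (\<gamma> e) z = winding_number (subpath 0 s (\<gamma> e)) z + winding_number ?g z + winding_number (subpath t 1 (\<gamma> e)) z"
        by (simp add: add.assoc)
      moreover have "\<Omega> z = \<sigma> ?x * winding_number (\<gamma> e) z + (\<Sum>x\<in>?I. \<sigma> x * winding_number (\<gamma> {fst x, snd x}) z)"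
        unfolding \<Omega>(2) using finite_UV uv by (subst sum.remove[of _ ?x]) auto
      ultimately show ?thesis unfolding R_def by (simp add: algebra_simps)
    qed
    obtain r where r: "m = \<gamma> e r" "s \<le> r" "r \<le> t" using m unfolding c(1) seg_def by auto
    have rst: "s < r" "r < t"
    proof -
      have "\<gamma> e s \<in> P" "\<gamma> e t \<in> P" using d(2,3) unfolding \<tau>_def by auto
      then have "r \<noteq> s" "r \<noteq> t" using m r(1) by auto
      then show "s < r" "r < t" using r by auto
    qed
    have off: "m \<notin> path_image (subpath 0 s (\<gamma> e))" "m \<notin> path_image (subpath t 1 (\<gamma> e))"
    proof -
      have i: "path_image (subpath 0 s (\<gamma> e)) = \<gamma> e ` {0..s}" "path_image (subpath t 1 (\<gamma> e)) = \<gamma> e ` {t..1}"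
        using d by (auto simp: path_image_subpath_gen closed_segment_eq_real_ivl)
      have ne: "\<gamma> e r' \<noteq> m" if "r' \<in> {0..1}" "r' \<noteq> r" for r'
        using inj_eq[OF d(1), of r' r] that r(1) rst d(5,6) by auto
      show "m \<notin> path_image (subpath 0 s (\<gamma> e))" unfolding i
      proof
        assume "m \<in> \<gamma> e ` {0..s}"
        then obtain r' where "m = \<gamma> e r'" "r' \<in> {0..s}" by blast
        then show False using ne[of r'] rst d(5,6) by auto
      qed
      show "m \<notin> path_image (subpath t 1 (\<gamma> e))" unfolding i
      proof
        assume "m \<in> \<gamma> e ` {t..1}"
        then obtain r' where "m = \<gamma> e r'" "r' \<in> {t..1}" by blast
        then show False using ne[of r'] rst d(5,6) by auto
      qed
    qed
    have other: "path (\<gamma> {fst x, snd x})" "m \<notin> path_image (\<gamma> {fst x, snd x})" if x: "x \<in> ?I" for x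
    proof -
      have f: "{fst x, snd x} \<in> E" unfolding E_def using x by auto
      show "path (\<gamma> {fst x, snd x})" using arc_imp_path[OF arc[OF f]] .
      have "{fst x, snd x} \<noteq> e"
      proof
        assume "{fst x, snd x} = e"
        then have "fst x = u \<and> snd x = v \<or> fst x = v \<and> snd x = u" unfolding uv(1) by (simp add: doubleton_eq_iff)
        moreover have "fst x \<in> U" "snd x \<in> V" "x \<noteq> (u, v)" using x by auto
        ultimately show False using uv card_UV(3) by (metis disjoint_iff prod.collapse)
      qed
      then have "path_image (\<gamma> {fst x, snd x}) \<inter> path_image (\<gamma> e) \<subseteq> P" using common_P[OF f d(1)] by blast
      moreover have "m \<in> path_image (\<gamma> e)" using m c(1) seg_sub[OF c(2)] by blast
      ultimately show "m \<notin> path_image (\<gamma> {fst x, snd x})" using m by blast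
    qed
    have cont: "continuous (at m) R"
      unfolding R_def
      by (intro continuous_add continuous_mult continuous_const continuous_sum
          continuous_at_winding_number[OF psub(1) off(1)] continuous_at_winding_number[OF psub(2) off(2)]
          continuous_at_winding_number[OF other(1) other(2)])
    have ma: "m \<notin> path_image a" using a_s0 m by blast
    have "val D - val D' = 1 \<or> val D - val D' = -1"
      by (rule winding_jump[OF J g(1) Da(1,3,4,8,9) mD ma cont \<Omega>(1)[of ?x], of \<Omega>])
        (erule \<Omega>g | erule val[OF DF(1)] | erule val[OF DF(2)] | rule val_int[OF DF(1)] | rule val_int[OF DF(2)])+
    then show ?thesis using DF Da(7) touch by blast
  qed
  define col where "col F \<longleftrightarrow> (\<exists>n. even n \<and> val F = of_int n)" for F
  have "col F \<noteq> col F'"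
    if F: "s \<in> A" "F \<in> G.faces" "F' \<in> G.faces" "s \<in> G.bdry F" "s \<in> G.bdry F'" "F \<noteq> F'" for s F F'
  proof -
    obtain D D' where D: "D \<in> G.faces" "D' \<in> G.faces" "D \<noteq> D'" "s \<in> G.bdry D" "s \<in> G.bdry D'"
      "val D - val D' = 1 \<or> val D - val D' = -1" using jump[OF F(1)] by blast
    obtain C C' where C: "G.sides s C C'" using G.two_sides[OF F(1)] by blast
    have "H = C \<or> H = C'" if "H \<in> G.faces" "s \<in> G.bdry H" for H
      using C that unfolding G.sides_def G.bdry_def by blast
    then have "F = D \<and> F' = D' \<or> F = D' \<and> F' = D" using F D by metis
    moreover have "val D' - val D = -1 \<or> val D' - val D = 1" using D(6) by (metis minus_diff_eq minus_minus)
    ultimately have v: "val F - val F' = 1 \<or> val F - val F' = -1"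
      using D(6) by auto
    obtain n where n: "val F = of_int n" using val_int[OF F(2)] by (auto elim: Ints_cases)
    obtain n' where n': "val F' = of_int n'" using val_int[OF F(3)] by (auto elim: Ints_cases)
    have "n - n' = 1 \<or> n - n' = -1"
      using v unfolding n n' of_int_diff[symmetric] by (metis of_int_1 of_int_eq_iff of_int_minus)
    then have "even n \<noteq> even n'" by presburger
    then show ?thesis unfolding col_def n n' by simp
  qed
  then show ?thesis by (rule that)
qed

end

section \<open>Crossings of a drawing\<close>

locale k44_coloured = k44_drawing +
  fixes col :: "complex set \<Rightarrow> bool"
  assumes col: "s \<in> A \<Longrightarrow> F \<in> G.faces \<Longrightarrow> F' \<in> G.faces \<Longrightarrow> s \<in> G.bdry F \<Longrightarrow> s \<in> G.bdry F' \<Longrightarrow> F \<noteq> F' \<Longrightarrow>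
    col F \<noteq> col F'"
begin

definition "ebdry F = (\<lambda>s. s \<inter> P) ` G.bdry F"
definition "Fc c = ebdry ` {F \<in> G.faces. col F = c}"

lemma bdry_sub: "G.bdry F \<subseteq> A" using G.bdry_A by blast

lemma ebdry_iff: "s \<in> A \<Longrightarrow> s \<inter> P \<in> ebdry F \<longleftrightarrow> s \<in> G.bdry F"
  unfolding ebdry_def by (rule inj_on_image_mem_iff[OF A_inj _ bdry_sub])

lemma S_E: "e \<in> S \<Longrightarrow> \<exists>s\<in>A. e = s \<inter> P" using A_S by blast

lemma ebdry_ex1:
  assumes "e \<in> S"
  shows "\<exists>!F. F \<in> G.faces \<and> col F = c \<and> e \<in> ebdry F"
proof -
  obtain s where s: "s \<in> A" "e = s \<inter> P" using S_E[OF assms] by blast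
  have "\<exists>!F. F \<in> G.faces \<and> col F = c \<and> s \<in> G.bdry F" by (rule G.sum_card_bdry(1)[OF col s(1)])
  then show ?thesis using ebdry_iff[OF s(1)] s(2) by simp
qed

lemma card_ebdry: "card (ebdry F) = card (G.bdry F)"
  unfolding ebdry_def by (rule card_image[OF inj_on_subset[OF A_inj bdry_sub]])

lemma ebdry_ne: "F \<in> G.faces \<Longrightarrow> ebdry F \<noteq> {}"
  unfolding ebdry_def using G.bdry_ne by simp

lemma ebdry_S: "ebdry F \<subseteq> S"
  unfolding ebdry_def using bdry_sub A_S by blast

lemma inj_ebdry: "inj_on ebdry {F \<in> G.faces. col F = c}"
proof (rule inj_onI)
  fix F F' assume F: "F \<in> {F \<in> G.faces. col F = c}" "F' \<in> {F \<in> G.faces. col F = c}" "ebdry F = ebdry F'"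
  obtain e where e: "e \<in> ebdry F" using ebdry_ne F(1) by blast
  then have "e \<in> S" using ebdry_S by blast
  from ebdry_ex1[OF this, of c] show "F = F'" using F e by blast
qed

sublocale F: coloured_faces S Fc P "card X"
proof
  show "finite S" by (rule finite_S)
  show "card e = 2" if "e \<in> S" for e using S_E[OF that] G.card_ends by blast
  show "finite (Fc c)" for c unfolding Fc_def using G.finite_faces by simp
  show "f \<subseteq> S" "f \<noteq> {}" if "f \<in> Fc c" for f c using that ebdry_S ebdry_ne unfolding Fc_def by blast+
  show "\<exists>!f. f \<in> Fc c \<and> e \<in> f" if "e \<in> S" for e c
    using ebdry_ex1[OF that, of c] unfolding Fc_def by blast
  show "\<exists>e'\<in>f. e' \<noteq> e \<and> q \<in> e'" if f: "f \<in> Fc c" "e \<in> f" "q \<in> e" for f c e q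
  proof -
    obtain F where F: "F \<in> G.faces" "f = ebdry F" using f(1) unfolding Fc_def by blast
    obtain s where s: "s \<in> G.bdry F" "e = s \<inter> P" using f(2) F(2) unfolding ebdry_def by blast
    have q: "q \<in> s \<inter> P" using f(3) s(2) by simp
    obtain t where t: "t \<in> G.bdry F" "t \<noteq> s" "q \<in> t" using G.bdry_degree[OF F(1) s(1) q] by blast
    have "t \<inter> P \<noteq> s \<inter> P" using A_inj t(1,2) s(1) bdry_sub by (auto simp: inj_on_def)
    moreover have "t \<inter> P \<in> f" unfolding F(2) ebdry_def using t(1) by blast
    ultimately show ?thesis using t(3) q s(2) by (intro bexI[of _ "t \<inter> P"]) auto
  qed
  show "(\<Sum>f\<in>Fc c. card f) = card S" for c
  proof -
    have "(\<Sum>f\<in>Fc c. card f) = (\<Sum>F\<in>{F \<in> G.faces. col F = c}. card (G.bdry F))"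
      unfolding Fc_def by (subst sum.reindex[OF inj_ebdry]) (simp add: card_ebdry)
    also have "\<dots> = card A" by (rule G.sum_card_bdry(2)[OF col])
    finally show ?thesis using card_A by simp
  qed
  show "f = S" if f: "f \<in> Fc True" "f \<in> Fc False" for f
  proof -
    obtain F where F: "F \<in> G.faces" "f = ebdry F" "col F" using f(1) unfolding Fc_def by blast
    obtain F' where F': "F' \<in> G.faces" "f = ebdry F'" "\<not> col F'" using f(2) unfolding Fc_def by blast
    have "G.bdry F = G.bdry F'"
      using inj_on_image_eq_iff[OF A_inj bdry_sub bdry_sub] F(2) F'(2) unfolding ebdry_def by metis
    then have "G.bdry F = A" using G.bdry_inj[OF F(1) F'(1)] F(3) F'(3) by blast
    then show ?thesis unfolding F(2) ebdry_def using A_S by simp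
  qed
  show "card S + 2 \<le> card (Fc True) + card (Fc False) + card P"
  proof -
    have "P \<noteq> {}" using card_P by auto
    then obtain \<D> where D: "\<D> \<subseteq> G.faces" "card \<D> + card P \<ge> card A + 2" using G.euler by blast
    have c: "card (Fc c) = card {F \<in> G.faces. col F = c}" for c
      unfolding Fc_def by (rule card_image[OF inj_ebdry])
    have "card G.faces = card ({F \<in> G.faces. col F = True} \<union> {F \<in> G.faces. col F = False})"
      by (rule arg_cong[where f = card]) auto
    also have "\<dots> = card (Fc True) + card (Fc False)"
      unfolding c by (rule card_Un_disjoint) (use G.finite_faces in auto)
    finally show ?thesis using card_mono[OF G.finite_faces D(1)] D(2) card_A by simp
  qed
  show "card S = 16 + 3 * card X" "card P = 8 + card X" by (rule card_S card_P)+
qed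

section \<open>Consecutive rays at a triple point bound a common face\<close>

lemma through:
  assumes "x \<in> X" "e \<in> E" "x \<in> path_image (\<gamma> e)"
  obtains s r t where "cons e s r" "cons e r t" "\<gamma> e r = x"
proof -
  obtain r where r: "x = \<gamma> e r" "0 \<le> r" "r \<le> 1" using assms(3) unfolding path_image_eq by auto
  have "r \<in> \<tau> e" using assms(1) r unfolding \<tau>_def P_def by auto
  moreover have "r \<noteq> 0" "r \<noteq> 1" using end_points[OF assms(2)] E_sub(1)[OF assms(2)] X_disj assms(1) r(1) by auto
  ultimately show ?thesis
    using consecutive_left_ex[OF finite_\<tau>[OF assms(2)], of r 0] consecutive_right_ex[OF finite_\<tau>[OF assms(2)], of r 1]
      \<tau>_ends[OF assms(2)] r that assms(2) unfolding cons_def by fastforce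
qed

lemma continuous_on_edge: "e \<in> E \<Longrightarrow> T \<subseteq> {0..1} \<Longrightarrow> continuous_on T (\<gamma> e)"
  by (rule continuous_on_subset[OF arc_imp_path[OF arc, unfolded path_def]])

lemma compact_image: "e \<in> E \<Longrightarrow> T \<subseteq> {0..1} \<Longrightarrow> compact T \<Longrightarrow> compact (\<gamma> e ` T)"
  by (rule compact_continuous_image[OF continuous_on_edge])

lemma half_arc_image:
  assumes e: "e \<in> E" and T: "T \<subseteq> {0..1}" "r \<in> {0..1}" "r \<notin> T" "insert r T = closure T"
  shows "half_arc (\<gamma> e r) (\<gamma> e ` T)"
proof -
  have c: "compact (closure T)" using T(1) compact_eq_bounded_closed bounded_subset[OF bounded_closed_interval] by auto
  have sub: "closure T \<subseteq> {0..1}" by (rule closure_minimal[OF T(1) closed_atLeastAtMost])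
  have "\<gamma> e r \<notin> \<gamma> e ` T" using inj_eq[OF e T(2)] T(1,3) by blast
  moreover have "closed (insert (\<gamma> e r) (\<gamma> e ` T))"
    using compact_imp_closed[OF compact_image[OF e sub c]] T(4) by (metis image_insert)
  moreover have "\<gamma> e ` closure T \<subseteq> closure (\<gamma> e ` T)"
    by (rule image_closure_subset[OF continuous_on_edge[OF e sub] closed_closure closure_subset])
  ultimately show ?thesis unfolding half_arc_def using T(4) by blast
qed

lemma split_arc:
  assumes c: "cons e s r" "cons e r t"
  shows "split_at (\<gamma> e r) (path_image (\<gamma> e)) (\<gamma> e ` {0..<r}) (\<gamma> e ` {r<..1})"
proof -
  note d = consD[OF c(1)] consD[OF c(2)]
  have r: "0 < r" "r < 1" using d by auto
  have "half_arc (\<gamma> e r) (\<gamma> e ` {0..<r})" "half_arc (\<gamma> e r) (\<gamma> e ` {r<..1})"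
    using r by (intro half_arc_image[OF d(1)]; auto)+
  moreover have "\<gamma> e ` {0..<r} \<inter> \<gamma> e ` {r<..1} = {}"
  proof (rule equals0I)
    fix z assume "z \<in> \<gamma> e ` {0..<r} \<inter> \<gamma> e ` {r<..1}"
    then obtain a b where ab: "a \<in> {0..<r}" "b \<in> {r<..1}" "z = \<gamma> e a" "z = \<gamma> e b" by blast
    then show False using inj_eq[OF d(1), of a b] r by auto
  qed
  moreover have "{0..1} = insert r ({0..<r} \<union> {r<..1})" using r by auto
  then have "path_image (\<gamma> e) = insert (\<gamma> e r) (\<gamma> e ` {0..<r} \<union> \<gamma> e ` {r<..1})"
    unfolding path_image_eq by (metis image_insert image_Un)
  ultimately show ?thesis unfolding split_at_def by blast
qed

text \<open>The transversality charts deal with a whole half \<open>Y\<close> of an edge, whereas a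
  face borders single segments. Close to \<open>x\<close> the half lies in its first segment
  \<open>a\<close>, which links the two.\<close>

definition "ray x a Y \<longleftrightarrow> a \<in> A \<and> x \<in> a \<and> x \<notin> Y \<and> (\<exists>\<delta>>0. Y \<inter> ball x \<delta> \<subseteq> a)"

lemma ray_image:
  assumes c: "cons e s t" and r: "r = s \<or> r = t" "r \<notin> T" "T \<subseteq> {s..t} \<union> T'" "compact T'" "T' \<subseteq> {0..1}" "r \<notin> T'"
  shows "ray (\<gamma> e r) (seg e s t) (\<gamma> e ` T)"
proof -
  note d = consD[OF c]
  have r01: "r \<in> {0..1}" using r(1) d by blast
  have T01: "T \<subseteq> {0..1}" using r(3,5) d(7) by blast
  have "\<gamma> e r \<notin> \<gamma> e ` T'" using inj_eq[OF d(1) r01] r(5,6) by blast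
  then have m: "\<gamma> e r \<in> - (\<gamma> e ` T')" by blast
  have "closed (\<gamma> e ` T')" using compact_image[OF d(1) r(5,4)] by (rule compact_imp_closed)
  then have o: "open (- (\<gamma> e ` T'))" by (rule open_Compl)
  obtain \<delta> where \<delta>: "\<delta> > 0" "ball (\<gamma> e r) \<delta> \<subseteq> - (\<gamma> e ` T')"
    by (rule openE[OF o m])
  have "\<gamma> e ` T \<inter> ball (\<gamma> e r) \<delta> \<subseteq> seg e s t" using \<delta>(2) r(3) unfolding seg_def by blast
  moreover have "\<gamma> e r \<notin> \<gamma> e ` T" using inj_eq[OF d(1) r01] T01 r(2) by blast
  moreover have "\<gamma> e r \<in> seg e s t" using r(1) d(4) unfolding seg_def by auto
  ultimately show ?thesis unfolding ray_def A_def using c \<delta>(1) by blast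
qed

lemma rays:
  assumes c: "cons e s r" "cons e r t"
  shows "ray (\<gamma> e r) (seg e s r) (\<gamma> e ` {0..<r})" "ray (\<gamma> e r) (seg e r t) (\<gamma> e ` {r<..1})"
proof -
  note d = consD[OF c(1)] consD[OF c(2)]
  show "ray (\<gamma> e r) (seg e s r) (\<gamma> e ` {0..<r})"
    by (rule ray_image[OF c(1), of _ _ "{0..s}"]) (use d in auto)
  show "ray (\<gamma> e r) (seg e r t) (\<gamma> e ` {r<..1})"
    by (rule ray_image[OF c(2), of _ _ "{t..1}"]) (use d in auto)
qed

lemma isolated:
  assumes "x \<in> P"
  obtains \<delta> where "\<delta> > 0" "ball x \<delta> \<inter> ((P - {x}) \<union> \<Union>{a \<in> A. x \<notin> a}) = {}"
proof -
  have "compact (P - {x})" using finite_P by (simp add: finite_imp_compact)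
  moreover have "compact (\<Union>{a \<in> A. x \<notin> a})" using finite_A G.compact_arc by (intro compact_Union) auto
  ultimately have "closed ((P - {x}) \<union> \<Union>{a \<in> A. x \<notin> a})"
    using compact_imp_closed by blast
  then have "open (- ((P - {x}) \<union> \<Union>{a \<in> A. x \<notin> a}))" by (rule open_Compl)
  moreover have "x \<in> - ((P - {x}) \<union> \<Union>{a \<in> A. x \<notin> a})" by blast
  ultimately obtain \<delta> where "\<delta> > 0" "ball x \<delta> \<subseteq> - ((P - {x}) \<union> \<Union>{a \<in> A. x \<notin> a})"
    using open_contains_ball by blast
  then show ?thesis using that by blast
qed

text \<open>In a small ball about \<open>x\<close> the graph consists of arcs at \<open>x\<close>
  only, so a small connected set witnessing the corner misses the entire graph. The face containing
  it has both segments on its boundary.\<close>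

lemma corner_face:
  assumes x: "x \<in> P" and L: "corner x L Y Z" "\<And>h. h \<in> E \<Longrightarrow> x \<in> path_image (\<gamma> h) \<Longrightarrow> path_image (\<gamma> h) \<subseteq> L" "x \<in> L"
    and ray: "ray x a Y" "ray x b Z"
  shows "\<exists>F\<in>G.faces. a \<in> G.bdry F \<and> b \<in> G.bdry F"
proof -
  obtain \<delta> where \<delta>: "\<delta> > 0" "ball x \<delta> \<inter> ((P - {x}) \<union> \<Union>{a \<in> A. x \<notin> a}) = {}"
    by (rule isolated[OF x])
  obtain \<delta>1 where \<delta>1: "\<delta>1 > 0" "Y \<inter> ball x \<delta>1 \<subseteq> a" using ray(1) unfolding ray_def by blast
  obtain \<delta>2 where \<delta>2: "\<delta>2 > 0" "Z \<inter> ball x \<delta>2 \<subseteq> b" using ray(2) unfolding ray_def by blast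
  define r where "r = min \<delta> (min \<delta>1 \<delta>2)"
  have r: "r > 0" "ball x r \<subseteq> ball x \<delta>" "ball x r \<subseteq> ball x \<delta>1" "ball x r \<subseteq> ball x \<delta>2"
    using \<delta>(1) \<delta>1(1) \<delta>2(1) unfolding r_def by auto
  obtain C where C: "connected C" "C \<noteq> {}" "C \<subseteq> ball x r - L" "closure C \<inter> Y \<inter> ball x r \<noteq> {}" "closure C \<inter> Z \<inter> ball x r \<noteq> {}"
    using L(1)[unfolded corner_def, rule_format, OF r(1)] by blast
  have "a' \<subseteq> L" if a': "a' \<in> A" "x \<in> a'" for a'
  proof -
    obtain e s t where c: "a' = seg e s t" "cons e s t" using a'(1) unfolding A_def by blast
    show ?thesis using L(2)[OF consD(1)[OF c(2)]] seg_sub[OF c(2)] a'(2) c(1) by blast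
  qed
  then have "ball x \<delta> \<inter> (P \<union> \<Union>A) \<subseteq> L" using \<delta>(2) L(3) by blast
  then have off: "C \<subseteq> - (P \<union> \<Union>A)" using C(3) r(2) by blast
  moreover have "- (P \<union> \<Union>A) \<noteq> {}" using off C(2) by blast
  ultimately obtain F where F: "F \<in> G.faces" "C \<subseteq> F"
    using exists_component_superset[OF _ _ C(1)] unfolding G.faces_def by blast
  have cl: "closure C \<subseteq> closure F" using F(2) by (rule closure_mono)
  have "a \<in> G.bdry F"
  proof -
    obtain p where "p \<in> closure C" "p \<in> Y" "p \<in> ball x r" using C(4) by blast
    then have "p \<in> closure F \<inter> (a - P)" using \<delta>1(2) \<delta>(2) r ray(1) cl unfolding ray_def by blast
    then show ?thesis unfolding G.bdry_def G.touches_def using ray(1) unfolding ray_def by blast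
  qed
  moreover have "b \<in> G.bdry F"
  proof -
    obtain p where "p \<in> closure C" "p \<in> Z" "p \<in> ball x r" using C(5) by blast
    then have "p \<in> closure F \<inter> (b - P)" using \<delta>2(2) \<delta>(2) r ray(2) cl unfolding ray_def by blast
    then show ?thesis unfolding G.bdry_def G.touches_def using ray(2) unfolding ray_def by blast
  qed
  ultimately show ?thesis using F(1) by blast
qed

lemma meet_at:
  assumes x: "x \<in> X" and e: "e \<in> E" "f \<in> E" "e \<noteq> f" "x \<in> path_image (\<gamma> e)" "x \<in> path_image (\<gamma> f)"
  shows "path_image (\<gamma> e) \<inter> path_image (\<gamma> f) = {x}" "meet_transversally_at (path_image (\<gamma> e)) (path_image (\<gamma> f)) x"
proof -
  have "e \<inter> f = {}"
  proof (rule ccontr)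
    assume "e \<inter> f \<noteq> {}"
    then have "x \<in> e" using adjacent[OF e(1-3)] e(4,5) by blast
    then show False using E_sub(1)[OF e(1)] X_disj x by blast
  qed
  then obtain p where p: "path_image (\<gamma> e) \<inter> path_image (\<gamma> f) = {p}"
    "meet_transversally_at (path_image (\<gamma> e)) (path_image (\<gamma> f)) p" using disjoint[OF e(1,2)] e(4,5) by blast
  have "x \<in> {p}" unfolding p(1)[symmetric] using e(4,5) by simp
  then show "path_image (\<gamma> e) \<inter> path_image (\<gamma> f) = {x}" "meet_transversally_at (path_image (\<gamma> e)) (path_image (\<gamma> f)) x"
    using p by simp_all
qed

lemma cons_P:
  assumes "cons e s t"
  shows "\<gamma> e s \<noteq> \<gamma> e t" "{\<gamma> e s, \<gamma> e t} \<in> S" "seg e s t \<in> A" "\<gamma> e s \<in> N e" "\<gamma> e t \<in> N e"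
    "\<gamma> e s \<in> path_image (\<gamma> e)" "\<gamma> e t \<in> path_image (\<gamma> e)"
proof -
  note d = consD[OF assms]
  show "\<gamma> e s \<noteq> \<gamma> e t" using inj_eq[OF d(1,5,6)] d(4) by auto
  show "{\<gamma> e s, \<gamma> e t} \<in> S" unfolding S_def using assms by blast
  show "seg e s t \<in> A" unfolding A_def using assms by blast
  show "\<gamma> e s \<in> N e" "\<gamma> e t \<in> N e" unfolding N_image using d by auto
  then show "\<gamma> e s \<in> path_image (\<gamma> e)" "\<gamma> e t \<in> path_image (\<gamma> e)" unfolding N_def by auto
qed

text \<open>\<open>transversal_corners\<close> for \<open>e\<close> and \<open>f\<close>, with
  \<open>g\<close> as the third curve through \<open>x\<close>. One pair of edges yields two of the
  six corners and leaves open which alternative holds; \<open>F.hexagon\<close> combines the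
  alternatives for the three pairs.\<close>

lemma two_corners:
  assumes x: "x \<in> X" and thr: "{h \<in> E. x \<in> path_image (\<gamma> h)} = {e, f, g}" and d: "e \<noteq> f" "e \<noteq> g" "f \<noteq> g"
    and e: "cons e s r" "cons e r t" "\<gamma> e r = x" and f: "cons f s' r'" "cons f r' t'" "\<gamma> f r' = x"
    and g: "cons g s'' r''" "cons g r'' t''" "\<gamma> g r'' = x"
  shows "F.adj x (\<gamma> e s) (\<gamma> f s') \<and> F.adj x (\<gamma> e t) (\<gamma> f t') \<or> F.adj x (\<gamma> e s) (\<gamma> f t') \<and> F.adj x (\<gamma> e t) (\<gamma> f s')"
proof -
  let ?L = "path_image (\<gamma> e) \<union> path_image (\<gamma> f) \<union> path_image (\<gamma> g)"
  have E: "e \<in> E" "f \<in> E" "g \<in> E" and xi: "x \<in> path_image (\<gamma> e)" "x \<in> path_image (\<gamma> f)" "x \<in> path_image (\<gamma> g)"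
    using thr by auto
  note m1 = meet_at[OF x E(1,2) d(1) xi(1,2)] and m2 = meet_at[OF x E(1,3) d(2) xi(1,3)] and m3 = meet_at[OF x E(2,3) d(3) xi(2,3)]
  note sp = split_arc[OF e(1,2), unfolded e(3)] split_arc[OF f(1,2), unfolded f(3)] split_arc[OF g(1,2), unfolded g(3)]
  note re = rays[OF e(1,2), unfolded e(3)] and rf = rays[OF f(1,2), unfolded f(3)]
  have adj: "F.adj x q q'"
    if h: "corner x ?L Y Z" "ray x a Y" "ray x b Z" "a \<in> A" "b \<in> A" "a \<inter> P = {x, q}" "b \<inter> P = {x, q'}" "q \<noteq> q'" for Y Z a b q q'
  proof -
    have L: "path_image (\<gamma> h) \<subseteq> ?L" if "h \<in> E" "x \<in> path_image (\<gamma> h)" for h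
    proof -
      have "h \<in> {e, f, g}" unfolding thr[symmetric] using that by simp
      then show ?thesis by auto
    qed
    have "x \<in> P" "x \<in> ?L" using x xi unfolding P_def by auto
    then obtain F where F: "F \<in> G.faces" "a \<in> G.bdry F" "b \<in> G.bdry F"
      using corner_face[OF _ h(1) L _ h(2,3)] by blast
    have q: "{x, q} \<in> ebdry F" "{x, q'} \<in> ebdry F" using ebdry_iff[OF h(4)] ebdry_iff[OF h(5)] F h(6,7) by auto
    have "ebdry F \<in> Fc (col F)" unfolding Fc_def using F(1) by blast
    then show ?thesis by (rule F.adjI[OF _ q h(8)])
  qed
  have ne: "\<gamma> e a \<noteq> \<gamma> f b" if a: "\<gamma> e a \<noteq> x" "\<gamma> e a \<in> path_image (\<gamma> e)" "\<gamma> f b \<in> path_image (\<gamma> f)" for a b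
  proof
    assume "\<gamma> e a = \<gamma> f b"
    then have "\<gamma> e a \<in> {x}" unfolding m1(1)[symmetric] using a by simp
    then show False using a by simp
  qed
  note p = cons_P[OF e(1), unfolded e(3)] cons_P[OF e(2), unfolded e(3)] cons_P[OF f(1), unfolded f(3)] cons_P[OF f(2), unfolded f(3)]
  have P: "seg e s r \<inter> P = {x, \<gamma> e s}" "seg e r t \<inter> P = {x, \<gamma> e t}" "seg f s' r' \<inter> P = {x, \<gamma> f s'}" "seg f r' t' \<inter> P = {x, \<gamma> f t'}"
    using seg_P[OF e(1)] seg_P[OF e(2)] seg_P[OF f(1)] seg_P[OF f(2)] e(3) f(3) by auto
  have n: "\<gamma> e s \<noteq> \<gamma> f s'" "\<gamma> e s \<noteq> \<gamma> f t'" "\<gamma> e t \<noteq> \<gamma> f s'" "\<gamma> e t \<noteq> \<gamma> f t'"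
    using ne p by auto
  have A: "seg e s r \<in> A" "seg e r t \<in> A" "seg f s' r' \<in> A" "seg f r' t' \<in> A" using p by auto
  from transversal_corners[OF m1(2) m2(2,1) m3(2,1) sp] show ?thesis
  proof
    assume "corner x ?L (\<gamma> e ` {0..<r}) (\<gamma> f ` {0..<r'}) \<and> corner x ?L (\<gamma> e ` {r<..1}) (\<gamma> f ` {r'<..1})"
    then show ?thesis
      using adj[OF _ re(1) rf(1) A(1,3) P(1,3) n(1)] adj[OF _ re(2) rf(2) A(2,4) P(2,4) n(4)] by blast
  next
    assume "corner x ?L (\<gamma> e ` {0..<r}) (\<gamma> f ` {r'<..1}) \<and> corner x ?L (\<gamma> e ` {r<..1}) (\<gamma> f ` {0..<r'})"
    then show ?thesis
      using adj[OF _ re(1) rf(2) A(1,4) P(1,4) n(2)] adj[OF _ re(2) rf(1) A(2,3) P(2,3) n(3)] by blast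
  qed
qed

section \<open>The near-triangulation read off from a drawing\<close>

definition "ed p q = (THE e. \<exists>s t. cons e s t \<and> {p, q} = {\<gamma> e s, \<gamma> e t})"
definition "opp x q = (THE r. F.nb x r \<and> ed x r = ed x q \<and> r \<noteq> q)"

lemma ed_eq:
  assumes "cons e s t"
  shows "ed (\<gamma> e s) (\<gamma> e t) = e" "ed (\<gamma> e t) (\<gamma> e s) = e"
proof -
  have u: "f = e" if h: "\<exists>s' t'. cons f s' t' \<and> {\<gamma> e s, \<gamma> e t} = {\<gamma> f s', \<gamma> f t'}" for f
  proof -
    obtain s' t' where c: "cons f s' t'" "{\<gamma> e s, \<gamma> e t} = {\<gamma> f s', \<gamma> f t'}" using h by blast
    show ?thesis using seg_inj[OF assms c] by simp
  qed
  show "ed (\<gamma> e s) (\<gamma> e t) = e" unfolding ed_def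
    by (rule the_equality) (use assms u in blast)+
  moreover have "{\<gamma> e s, \<gamma> e t} = {\<gamma> e t, \<gamma> e s}" by (rule insert_commute)
  ultimately show "ed (\<gamma> e t) (\<gamma> e s) = e" unfolding ed_def by simp
qed

lemma nb_cases:
  assumes "F.nb p q"
  obtains e s t where "cons e s t" "ed p q = e" "p = \<gamma> e s" "q = \<gamma> e t"
  | e s t where "cons e s t" "ed p q = e" "p = \<gamma> e t" "q = \<gamma> e s"
proof -
  obtain e s t where c: "cons e s t" "{p, q} = {\<gamma> e s, \<gamma> e t}" using assms[unfolded F.nb_def] unfolding S_def by blast
  from c(2) have "p = \<gamma> e s \<and> q = \<gamma> e t \<or> p = \<gamma> e t \<and> q = \<gamma> e s" by (auto simp: doubleton_eq_iff)
  then show ?thesis using that ed_eq[OF c(1)] c(1) by blast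
qed

lemma cons_nb: "cons e s t \<Longrightarrow> F.nb (\<gamma> e s) (\<gamma> e t) \<and> F.nb (\<gamma> e t) (\<gamma> e s)"
  unfolding F.nb_def using cons_P(2) by (auto simp: insert_commute)

lemma nb_param:
  assumes e: "e \<in> E" "r \<in> {0..1}" and n: "F.nb (\<gamma> e r) q" "ed (\<gamma> e r) q = e"
  shows "\<exists>t. q = \<gamma> e t \<and> (cons e r t \<or> cons e t r)"
  using n(1)
proof (cases rule: nb_cases)
  case (1 f s t)
  then have "f = e" using n(2) by simp
  then have "r = s" using inj_eq[OF e] consD(5)[OF 1(1)] 1(3) by blast
  then have "q = \<gamma> e t" "cons e r t" using 1 \<open>f = e\<close> by simp_all
  then show ?thesis by blast
next
  case (2 f s t)
  then have "f = e" using n(2) by simp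
  then have "r = t" using inj_eq[OF e] consD(6)[OF 2(1)] 2(3) by blast
  then have "q = \<gamma> e s" "cons e s r" using 2 \<open>f = e\<close> by simp_all
  then show ?thesis by blast
qed

lemma cons_unique: "cons e s t \<Longrightarrow> cons e s t' \<Longrightarrow> t = t'" "cons e s t \<Longrightarrow> cons e s' t \<Longrightarrow> s = s'"
  unfolding cons_def using consecutive_unique_right consecutive_unique_left by blast+

lemma opp_eq:
  assumes c: "cons e s r" "cons e r t"
  shows "opp (\<gamma> e r) (\<gamma> e s) = \<gamma> e t" "opp (\<gamma> e r) (\<gamma> e t) = \<gamma> e s"
proof -
  note d = consD[OF c(1)] consD[OF c(2)]
  have ne: "\<gamma> e s \<noteq> \<gamma> e t" using inj_eq[OF d(1,5)] d(4,11,13) by fastforce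
  have q: "q = \<gamma> e s \<or> q = \<gamma> e t" if "F.nb (\<gamma> e r) q" "ed (\<gamma> e r) q = e" for q
    using nb_param[OF d(1,6) that] cons_unique c by blast
  show "opp (\<gamma> e r) (\<gamma> e s) = \<gamma> e t" unfolding opp_def ed_eq[OF c(1)]
    by (rule the_equality) (use q ne ed_eq[OF c(2)] cons_nb[OF c(2)] in auto)
  show "opp (\<gamma> e r) (\<gamma> e t) = \<gamma> e s" unfolding opp_def ed_eq[OF c(2)]
    by (rule the_equality) (use q ne ed_eq[OF c(1)] cons_nb[OF c(1)] in auto)
qed

lemma X_nb:
  assumes "x \<in> X" "F.nb x q"
  obtains e s r t where "cons e s r" "cons e r t" "\<gamma> e r = x" "ed x q = e" "q = \<gamma> e s \<or> q = \<gamma> e t"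
proof -
  obtain e where e: "e \<in> E" "x \<in> path_image (\<gamma> e)" "ed x q = e"
    using assms(2) by (cases rule: nb_cases) (auto dest: consD(1) cons_P)
  obtain s r t where c: "cons e s r" "cons e r t" "\<gamma> e r = x" by (rule through[OF assms(1) e(1,2)])
  have "\<exists>t. q = \<gamma> e t \<and> (cons e r t \<or> cons e t r)"
    using nb_param[OF e(1) consD(6)[OF c(1)]] assms(2) e(3) c(3) by simp
  then have "q = \<gamma> e s \<or> q = \<gamma> e t" using cons_unique c by blast
  then show ?thesis using that c e(3) by blast
qed

lemma card_through: "x \<in> X \<Longrightarrow> card {h \<in> E. x \<in> path_image (\<gamma> h)} = 3"
  using three unfolding X_def by blast

lemma other_two:
  assumes "x \<in> X" "e \<in> E" "x \<in> path_image (\<gamma> e)"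
  obtains f g where "{h \<in> E. x \<in> path_image (\<gamma> h)} = {e, f, g}" "e \<noteq> f" "e \<noteq> g" "f \<noteq> g"
proof -
  let ?H = "{h \<in> E. x \<in> path_image (\<gamma> h)}"
  have e: "e \<in> ?H" using assms(2,3) by blast
  then have "card (?H - {e}) = 2" using card_through[OF assms(1)] finite_E by (simp add: card_Diff_singleton)
  then obtain f g where fg: "?H - {e} = {f, g}" "f \<noteq> g" by (meson card_2_iff)
  then have "?H = insert e {f, g}" using e by (metis insert_Diff)
  moreover have "f \<in> ?H - {e}" "g \<in> ?H - {e}" unfolding fg(1) by auto
  ultimately show ?thesis using that[of f g] fg(2) by auto
qed

text \<open>Provides the six rays at \<open>x\<close>, starting with the strand through
  \<open>q\<close>, together with the corner alternatives for each pair of strands, in the form that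
  \<open>F.hexagon\<close> expects.\<close>

lemma star:
  assumes x: "x \<in> X" and q: "F.nb x q"
  obtains r r' s s' where "F.nb x (opp x q)" "F.nb x r" "F.nb x r'" "F.nb x s" "F.nb x s'"
    "distinct [q, opp x q, r, r', s, s']" "ed x (opp x q) = ed x q" "ed x r' = ed x r" "ed x s' = ed x s"
    "ed x r \<noteq> ed x q" "ed x s \<noteq> ed x q" "ed x r \<noteq> ed x s"
    "F.adj x q r \<and> F.adj x (opp x q) r' \<or> F.adj x q r' \<and> F.adj x (opp x q) r"
    "F.adj x q s \<and> F.adj x (opp x q) s' \<or> F.adj x q s' \<and> F.adj x (opp x q) s"
    "F.adj x r s \<and> F.adj x r' s' \<or> F.adj x r s' \<and> F.adj x r' s"
proof -
  obtain e s r t where e: "cons e s r" "cons e r t" "\<gamma> e r = x" "ed x q = e" "q = \<gamma> e s \<or> q = \<gamma> e t"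
    by (rule X_nb[OF x q])
  have eE: "e \<in> E" "x \<in> path_image (\<gamma> e)" using consD(1)[OF e(1)] cons_P(7)[OF e(1)] e(3) by auto
  obtain f g where thr: "{h \<in> E. x \<in> path_image (\<gamma> h)} = {e, f, g}" and d: "e \<noteq> f" "e \<noteq> g" "f \<noteq> g"
    by (rule other_two[OF x eE])
  have fg: "f \<in> E" "x \<in> path_image (\<gamma> f)" "g \<in> E" "x \<in> path_image (\<gamma> g)" using thr by auto
  obtain s' r' t' where f: "cons f s' r'" "cons f r' t'" "\<gamma> f r' = x" by (rule through[OF x fg(1,2)])
  obtain s'' r'' t'' where g: "cons g s'' r''" "cons g r'' t''" "\<gamma> g r'' = x" by (rule through[OF x fg(3,4)])
  have nbs: "F.nb x (\<gamma> h a) \<and> F.nb x (\<gamma> h b) \<and> ed x (\<gamma> h a) = h \<and> ed x (\<gamma> h b) = h \<and>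
      opp x (\<gamma> h a) = \<gamma> h b \<and> opp x (\<gamma> h b) = \<gamma> h a \<and> \<gamma> h a \<noteq> \<gamma> h b \<and> \<gamma> h a \<noteq> x \<and> \<gamma> h b \<noteq> x \<and>
      \<gamma> h a \<in> path_image (\<gamma> h) \<and> \<gamma> h b \<in> path_image (\<gamma> h)"
    if h: "cons h a c" "cons h c b" "\<gamma> h c = x" for h a b c
  proof -
    note dd = consD[OF h(1)] consD[OF h(2)]
    have "\<gamma> h a \<noteq> \<gamma> h b" using inj_eq[OF dd(1,5), of b] dd(4,11,13) by auto
    then show ?thesis
      using cons_nb[OF h(1)] cons_nb[OF h(2)] ed_eq[OF h(1)] ed_eq[OF h(2)] opp_eq[OF h(1,2)] cons_P[OF h(1)] cons_P[OF h(2)] h(3)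
      by auto
  qed
  note ne = nbs[OF e(1-3)] and nf = nbs[OF f] and ng = nbs[OF g]
  have dist: "p \<noteq> p'" if "h \<in> E" "k \<in> E" "h \<noteq> k" "x \<in> path_image (\<gamma> h)" "x \<in> path_image (\<gamma> k)"
    "p \<in> path_image (\<gamma> h)" "p' \<in> path_image (\<gamma> k)" "p \<noteq> x" for h k p p'
  proof
    assume "p = p'"
    then have "p \<in> {x}" unfolding meet_at(1)[OF x that(1-5), symmetric] using that by simp
    then show False using that by simp
  qed
  have di: "distinct [\<gamma> e s, \<gamma> e t, \<gamma> f s', \<gamma> f t', \<gamma> g s'', \<gamma> g t'']"
    using dist[OF eE(1) fg(1) d(1) eE(2) fg(2)] dist[OF eE(1) fg(3) d(2) eE(2) fg(4)] dist[OF fg(1,3) d(3) fg(2,4)] ne nf ng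
    by auto
  have thr2: "{h \<in> E. x \<in> path_image (\<gamma> h)} = {e, g, f}" "{h \<in> E. x \<in> path_image (\<gamma> h)} = {f, g, e}"
    unfolding thr by auto
  note c1 = two_corners[OF x thr d e(1-3) f g]
  note c2 = two_corners[OF x thr2(1) d(2,1) d(3)[symmetric] e(1-3) g f]
  note c3 = two_corners[OF x thr2(2) d(3) d(1)[symmetric] d(2)[symmetric] f g e(1-3)]
  from e(5) show ?thesis
  proof
    assume q: "q = \<gamma> e s"
    have o: "opp x (\<gamma> e s) = \<gamma> e t" using ne by simp
    show ?thesis
      by (rule that[of "\<gamma> f s'" "\<gamma> f t'" "\<gamma> g s''" "\<gamma> g t''", unfolded q o]; (rule di c1 c2 c3)?) (simp_all add: ne nf ng d d[symmetric])
  next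
    assume q: "q = \<gamma> e t"
    have o: "opp x (\<gamma> e t) = \<gamma> e s" using ne by simp
    have di': "distinct [\<gamma> e t, \<gamma> e s, \<gamma> f s', \<gamma> f t', \<gamma> g s'', \<gamma> g t'']" using di by auto
    have c': "F.adj x (\<gamma> e t) (\<gamma> f s') \<and> F.adj x (\<gamma> e s) (\<gamma> f t') \<or> F.adj x (\<gamma> e t) (\<gamma> f t') \<and> F.adj x (\<gamma> e s) (\<gamma> f s')"
      "F.adj x (\<gamma> e t) (\<gamma> g s'') \<and> F.adj x (\<gamma> e s) (\<gamma> g t'') \<or> F.adj x (\<gamma> e t) (\<gamma> g t'') \<and> F.adj x (\<gamma> e s) (\<gamma> g s'')"
      using c1 c2 by blast+
    show ?thesis
      by (rule that[of "\<gamma> f s'" "\<gamma> f t'" "\<gamma> g s''" "\<gamma> g t''", unfolded q o]; (rule di' c' c3)?) (simp_all add: ne nf ng d d[symmetric])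
  qed
qed

lemma star_\<kappa>:
  assumes x: "x \<in> X" and q: "F.nb x q"
  shows "opp x q = F.\<kappa> c x (F.\<kappa> (\<not> c) x (F.\<kappa> c x q))" "ed x (F.\<kappa> c x q) \<noteq> ed x q"
    "ed x (F.\<kappa> c x q) \<noteq> ed x (F.\<kappa> (\<not> c) x q)"
proof -
  obtain r r' s s' where n: "F.nb x (opp x q)" "F.nb x r" "F.nb x r'" "F.nb x s" "F.nb x s'"
    and d: "distinct [q, opp x q, r, r', s, s']" and ed: "ed x (opp x q) = ed x q" "ed x r' = ed x r" "ed x s' = ed x s"
    "ed x r \<noteq> ed x q" "ed x s \<noteq> ed x q" "ed x r \<noteq> ed x s"
    and a: "F.adj x q r \<and> F.adj x (opp x q) r' \<or> F.adj x q r' \<and> F.adj x (opp x q) r"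
      "F.adj x q s \<and> F.adj x (opp x q) s' \<or> F.adj x q s' \<and> F.adj x (opp x q) s"
      "F.adj x r s \<and> F.adj x r' s' \<or> F.adj x r s' \<and> F.adj x r' s"
    by (rule star[OF x q])
  note h = F.hexagon[OF q n d a, of c]
  show "opp x q = F.\<kappa> c x (F.\<kappa> (\<not> c) x (F.\<kappa> c x q))" by (rule h(1))
  have "ed x (F.\<kappa> c x q) \<noteq> ed x q \<and> ed x (F.\<kappa> c x q) \<noteq> ed x (F.\<kappa> (\<not> c) x q)"
    using h(2)
  proof (elim bexE)
    fix b t assume bt: "b \<in> {r, r'}" "t \<in> {s, s'}" "{F.\<kappa> c x q, F.\<kappa> (\<not> c) x q} = {b, t}"
    have e: "ed x b = ed x r" "ed x t = ed x s" using bt(1,2) ed(2,3) by auto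
    have "F.\<kappa> c x q = b \<and> F.\<kappa> (\<not> c) x q = t \<or> F.\<kappa> c x q = t \<and> F.\<kappa> (\<not> c) x q = b"
      using bt(3) by (auto simp: doubleton_eq_iff)
    then show ?thesis using e ed(4-6) by auto
  qed
  then show "ed x (F.\<kappa> c x q) \<noteq> ed x q" "ed x (F.\<kappa> c x q) \<noteq> ed x (F.\<kappa> (\<not> c) x q)"
    by auto
qed

lemma end_nb:
  assumes e: "e \<in> E" and v: "v \<in> e"
  shows "\<exists>!q. F.nb v q \<and> ed v q = e"
proof -
  note t01 = \<tau>_ends[OF e] and fin = finite_\<tau>[OF e]
  have "v = \<gamma> e 0 \<or> v = \<gamma> e 1" using end_points[OF e] v by blast
  then show ?thesis
  proof
    assume v: "v = \<gamma> e 0"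
    obtain t where "consecutive (\<tau> e) 0 t" using consecutive_right_ex[OF fin, of 0 1] t01 by auto
    then have c: "cons e 0 t" using e unfolding cons_def by blast
    have "q = \<gamma> e t" if h: "F.nb v q" "ed v q = e" for q
    proof -
      obtain t' where t': "q = \<gamma> e t'" "cons e 0 t' \<or> cons e t' 0"
        using nb_param[OF e, of 0 q] h v by auto
      moreover have "\<not> cons e t' 0" using consD(4,5)[of e t' 0] by auto
      ultimately show ?thesis using cons_unique(1) c by blast
    qed
    then show ?thesis using cons_nb[OF c] ed_eq[OF c] v by (intro ex1I[of _ "\<gamma> e t"]) auto
  next
    assume v: "v = \<gamma> e 1"
    obtain t where "consecutive (\<tau> e) t 1" using consecutive_left_ex[OF fin, of 1 0] t01 by auto
    then have c: "cons e t 1" using e unfolding cons_def by blast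
    have "q = \<gamma> e t" if h: "F.nb v q" "ed v q = e" for q
    proof -
      obtain t' where t': "q = \<gamma> e t'" "cons e 1 t' \<or> cons e t' 1"
        using nb_param[OF e, of 1 q] h v by auto
      moreover have "\<not> cons e 1 t'" using consD(4,6)[of e 1 t'] by auto
      ultimately show ?thesis using cons_unique(2) c by blast
    qed
    then show ?thesis using cons_nb[OF c] ed_eq[OF c] v by (intro ex1I[of _ "\<gamma> e t"]) auto
  qed
qed

lemma uncrossed:
  assumes c: "cons e s t" and O: "\<gamma> e s \<in> U \<union> V" "\<gamma> e t \<in> U \<union> V"
  shows "N e = {\<gamma> e s, \<gamma> e t}"
proof -
  note d = consD[OF c]
  have o: "r = 0 \<or> r = 1" if r: "r \<in> {0..1}" "\<gamma> e r \<in> U \<union> V" for r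
  proof -
    have "\<gamma> e r \<in> {\<gamma> e 0, \<gamma> e 1}" unfolding end_points[OF d(1)] using image_O[OF d(1)] r unfolding path_image_eq by blast
    then show ?thesis using inj_eq[OF d(1) r(1)] by auto
  qed
  have st: "s = 0" "t = 1" using o[OF d(5) O(1)] o[OF d(6) O(2)] d(4,5,6) by auto
  have "r = 0 \<or> r = 1" if "r \<in> \<tau> e" for r
  proof -
    have "\<not> (0 < r \<and> r < 1)" using c that unfolding cons_def consecutive_def st by blast
    then show ?thesis using \<tau>_sub[of e] that by force
  qed
  then have "\<tau> e = {s, t}" using d(2,3) st by blast
  then show ?thesis unfolding N_image by simp
qed

lemma opp_order:
  assumes c: "cons e s t" and x: "\<gamma> e s \<in> X" "\<gamma> e t \<in> X"
  shows "opp (\<gamma> e s) (\<gamma> e t) \<noteq> opp (\<gamma> e t) (\<gamma> e s)"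
proof -
  note d = consD[OF c] and p = cons_P[OF c]
  obtain a r b where a: "cons e a r" "cons e r b" "\<gamma> e r = \<gamma> e s" by (rule through[OF x(1) d(1) p(6)])
  have rs: "r = s" by (rule inj_eq[OF d(1) consD(6)[OF a(1)] d(5) a(3)])
  obtain a' r' b' where b: "cons e a' r'" "cons e r' b'" "\<gamma> e r' = \<gamma> e t" by (rule through[OF x(2) d(1) p(7)])
  have rt: "r' = t" by (rule inj_eq[OF d(1) consD(6)[OF b(1)] d(6) b(3)])
  have "opp (\<gamma> e s) (\<gamma> e t) = \<gamma> e a" by (rule opp_eq(2)[OF a(1)[unfolded rs] c])
  moreover have "opp (\<gamma> e t) (\<gamma> e s) = \<gamma> e b'" by (rule opp_eq(1)[OF c b(2)[unfolded rt]])
  moreover have "\<gamma> e a \<noteq> \<gamma> e b'"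
    using inj_eq[OF d(1) consD(5)[OF a(1)] consD(6)[OF b(2)]] consD(4)[OF a(1)] consD(4)[OF b(2)] d(4) rs rt by auto
  ultimately show ?thesis by simp
qed

lemma contradiction: False
proof -
  interpret T: near_triangulation U V X F.nb ed N opp F.\<kappa> F.side E
  proof
    show "card U = 4" "card V = 4" "U \<inter> V = {}" by (rule card_UV)+
    show "X \<inter> (U \<union> V) = {}" by (rule X_disj)
    show "E = {{u, v} | u v. u \<in> U \<and> v \<in> V}" by (rule E_def)
    show "F.nb q p" if "F.nb p q" for p q using that by (rule F.nb_sym)
    show "\<not> F.nb p p" for p using F.nb_neq by blast
    show "ed p q \<in> E" "p \<in> N (ed p q)" if "F.nb p q" for p q
      using that by (cases rule: nb_cases, use consD(1) cons_P(4,5) in metis, use consD(1) cons_P(4,5) in metis)+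
    show "ed p q = ed q p" if "F.nb p q" for p q
      using that by (cases rule: nb_cases) (simp_all add: ed_eq)
    show "N e \<subseteq> U \<union> V \<union> X" for e unfolding N_def P_def by blast
    show ends: "N e \<inter> (U \<union> V) = e" if "e \<in> E" for e using image_O[OF that] unfolding N_def P_def by blast
    show "p = v" if h: "e \<in> E" "f \<in> E" "e \<noteq> f" "v \<in> e \<inter> f" "p \<in> N e" "p \<in> N f" for e f v p
    proof (rule ccontr)
      assume ne: "p \<noteq> v"
      have "v \<in> path_image (\<gamma> e)" "v \<in> path_image (\<gamma> f)" using image_O[OF h(1)] image_O[OF h(2)] h(4) by blast+
      moreover have "p \<in> path_image (\<gamma> e)" "p \<in> path_image (\<gamma> f)" using h(5,6) unfolding N_def by auto
      ultimately show False using common_eq[OF h(1,2) _ _ _ _ ne] h(3) by blast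
    qed
    show "e = f" if h: "e \<in> E" "f \<in> E" "p \<in> N e" "p \<in> N f" "q \<in> N e" "q \<in> N f" "p \<noteq> q" for e f p q
      using common_eq[OF h(1,2) _ _ _ _ h(7)] h(3-6) unfolding N_def by blast
    show "card {e \<in> E. x \<in> N e} = 3" if x: "x \<in> X" for x
    proof -
      have "{e \<in> E. x \<in> N e} = {e \<in> E. x \<in> path_image (\<gamma> e)}" using x unfolding N_def P_def by blast
      then show ?thesis using card_through[OF x] by simp
    qed
    show "\<exists>!q. F.nb v q \<and> ed v q = e" if "e \<in> E" "v \<in> e" for e v using that by (rule end_nb)
    show "N (ed p q) = {p, q}" if h: "F.nb p q" "p \<in> U \<union> V" "q \<in> U \<union> V" for p q
      using h(1)
    proof (cases rule: nb_cases)
      case (1 e s t)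
      then show ?thesis using uncrossed[OF 1(1)] h(2,3) by simp
    next
      case (2 e s t)
      then show ?thesis using uncrossed[OF 2(1)] h(2,3) by (simp add: insert_commute)
    qed
    show "F.nb x (opp x q) \<and> ed x (opp x q) = ed x q \<and> opp x q \<noteq> q" if h: "x \<in> X" "F.nb x q" for x q
      by (rule star[OF h]) auto
    show "opp x y \<noteq> opp y x" if h: "x \<in> X" "y \<in> X" "F.nb x y" for x y
      using h(3)
    proof (cases rule: nb_cases)
      case (1 e s t)
      then show ?thesis using opp_order[OF 1(1)] h(1,2) by simp
    next
      case (2 e s t)
      then show ?thesis using opp_order[OF 2(1)] h(1,2) by (simp add: eq_commute)
    qed
    show "F.nb p (F.\<kappa> c p q)" "F.\<kappa> c p (F.\<kappa> c p q) = q" "F.\<kappa> c p q \<noteq> q" if h: "F.nb p q" for c p q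
      using F.\<kappa>_nb[OF h] F.\<kappa>_inv[OF h] F.\<kappa>(1)[OF h] by auto
    show "opp x q = F.\<kappa> c x (F.\<kappa> (\<not> c) x (F.\<kappa> c x q))" "ed x (F.\<kappa> c x q) \<noteq> ed x q"
      "ed x (F.\<kappa> c x q) \<noteq> ed x (F.\<kappa> (\<not> c) x q)" if h: "x \<in> X" "F.nb x q" for x q c
      by (rule star_\<kappa>[OF h])+
    show "F.side c q p" if "F.side c p q" for c p q
      using that F.nb_sym F.face_sym[of c p q] unfolding F.side_def by simp
    show "F.\<kappa> c q p = F.\<kappa> c p q \<and> F.nb q (F.\<kappa> c p q) \<and> F.\<kappa> c (F.\<kappa> c p q) p = q"
      if h: "F.nb p q" "\<not> F.side c p q" for c p q
      using F.tri(1-3)[OF h] by simp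
    show "F.\<kappa> c p q \<noteq> F.\<kappa> (\<not> c) p q" if h: "F.nb p q" "\<not> F.side c p q" "\<not> F.side (\<not> c) p q" for c p q
      by (rule F.tri_neq[OF h])
    show "\<exists>p q. F.side c p q" for c by (rule F.quad_ex)
    show "F.nb p q \<and> F.\<kappa> c p q \<noteq> F.\<kappa> c q p \<and> F.side c p (F.\<kappa> c p q) \<and> F.nb (F.\<kappa> c p q) (F.\<kappa> c q p) \<and>
      F.\<kappa> c (F.\<kappa> c p q) p = F.\<kappa> c q p \<and> {y. \<exists>z. F.side c y z} = {p, q, F.\<kappa> c p q, F.\<kappa> c q p}"
      if "F.side c p q" for c p q
      by (rule F.quad[OF that])
  qed
  show False by (rule T.no_near_triangulation)
qed

end

section \<open>Transfer to drawings of an arbitrary \<open>K\<^sub>4\<^sub>,\<^sub>4\<close>\<close>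

lemma (in k44_drawing) no_drawing: False
proof -
  obtain col :: "complex set \<Rightarrow> bool" where
    "\<And>s F F'. s \<in> A \<Longrightarrow> F \<in> G.faces \<Longrightarrow> F' \<in> G.faces \<Longrightarrow> s \<in> G.bdry F \<Longrightarrow> s \<in> G.bdry F' \<Longrightarrow> F \<noteq> F' \<Longrightarrow> col F \<noteq> col F'"
    by (rule colouring) blast
  then have "k44_coloured U V E \<gamma> col" by unfold_locales
  then show False by (rule k44_coloured.contradiction)
qed

theorem theorem5p13:
  fixes G :: "('a, 'b) pre_digraph"
  assumes "K\<^bsub>4,4\<^esub> G"
  shows "\<nexists>pos \<gamma>. is_semi_regular_drawing G pos \<gamma>"
proof (rule notI, elim exE)
  fix pos \<gamma> assume sr: "is_semi_regular_drawing G pos \<gamma>"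
  have "\<exists>U V. verts G = U \<union> V \<and> U \<inter> V = {} \<and> card U = 4 \<and> card V = 4 \<and> arcs_ends G = U \<times> V \<union> V \<times> U"
    using assms unfolding complete_bipartite_digraph_def by (rule conjunct2)
  then obtain U0 V0 where UV: "verts G = U0 \<union> V0" "U0 \<inter> V0 = {}" "card U0 = 4" "card V0 = 4"
    "arcs_ends G = U0 \<times> V0 \<union> V0 \<times> U0" by (elim exE conjE)
  have edge_iff: "e \<in> edges G \<longleftrightarrow> (\<exists>u v. e = {u, v} \<and> u \<in> U0 \<and> v \<in> V0)" for e
  proof
    assume "e \<in> edges G"
    then obtain u v where uv: "e = {u, v}" "(u, v) \<in> U0 \<times> V0 \<union> V0 \<times> U0" unfolding edges_def UV(5) by blast
    then have "u \<in> U0 \<and> v \<in> V0 \<or> v \<in> U0 \<and> u \<in> V0" by blast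
    moreover have "e = {v, u}" using uv(1) by (simp add: insert_commute)
    ultimately show "\<exists>u v. e = {u, v} \<and> u \<in> U0 \<and> v \<in> V0" using uv(1) by metis
  next
    assume "\<exists>u v. e = {u, v} \<and> u \<in> U0 \<and> v \<in> V0"
    then show "e \<in> edges G" unfolding edges_def UV(5) by blast
  qed
  have sub: "e \<subseteq> verts G" if "e \<in> edges G" for e using that UV(1) unfolding edge_iff by auto
  have dr: "is_drawing G pos \<gamma>" and three: "is_crossing_point G pos \<gamma> x \<Longrightarrow> card (edges_through G pos \<gamma> x) = 3" for x
    using sr unfolding is_semi_regular_drawing_def by simp_all
  note D = dr[unfolded is_drawing_def edge_interior_def]
  have inj: "inj_on pos (verts G)" using D by (rule conjunct1)
  have arc: "arc (\<gamma> e)" "{pathstart (\<gamma> e), pathfinish (\<gamma> e)} = pos ` e" if "e \<in> edges G" for e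
    using D that by simp_all
  have off: "pos v \<in> path_image (\<gamma> e) \<Longrightarrow> pos v \<in> pos ` e" if "e \<in> edges G" "v \<in> verts G" for e v
    using D that by simp
  have adj: "path_image (\<gamma> e) \<inter> path_image (\<gamma> f) = pos ` (e \<inter> f)"
    if "e \<in> edges G" "f \<in> edges G" "e \<noteq> f" "e \<inter> f \<noteq> {}" for e f
    using D that by simp
  have dis: "path_image (\<gamma> e) \<inter> path_image (\<gamma> f) = {} \<or> (\<exists>p. path_image (\<gamma> e) \<inter> path_image (\<gamma> f) = {p} \<and>
      meet_transversally_at (path_image (\<gamma> e)) (path_image (\<gamma> f)) p)"
    if "e \<in> edges G" "f \<in> edges G" "e \<inter> f = {}" for e f
    using D that by simp
  \<comment> \<open>\<open>w\<close> recovers an edge of \<open>G\<close> from the positions of its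
    ends, so that the arcs can be indexed by pairs of points of the plane.\<close>
  define w where "w e = inv_into (verts G) pos ` e" for e
  have w: "w (pos ` e) = e" if "e \<in> edges G" for e
    unfolding w_def using inv_into_image_cancel[OF inj sub[OF that]] .
  have cap: "pos ` e \<inter> pos ` f = pos ` (e \<inter> f)" if "e \<in> edges G" "f \<in> edges G" for e f
    using inj_on_image_Int[OF inj sub[OF that(1)] sub[OF that(2)]] by simp
  have O: "path_image (\<gamma> e) \<inter> (pos ` U0 \<union> pos ` V0) = pos ` e" if e: "e \<in> edges G" for e
  proof (intro equalityI subsetI)
    fix z assume z: "z \<in> path_image (\<gamma> e) \<inter> (pos ` U0 \<union> pos ` V0)"
    then obtain v where "v \<in> verts G" "z = pos v" unfolding UV(1) by blast
    then show "z \<in> pos ` e" using off[OF e] z by blast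
  next
    fix z assume z: "z \<in> pos ` e"
    then have "z \<in> path_image (\<gamma> e)" unfolding arc(2)[OF e, symmetric] by auto
    moreover have "z \<in> pos ` U0 \<union> pos ` V0" using z sub[OF e] unfolding UV(1) by blast
    ultimately show "z \<in> path_image (\<gamma> e) \<inter> (pos ` U0 \<union> pos ` V0)" by blast
  qed
  have injUV: "inj_on pos U0" "inj_on pos V0" using inj unfolding UV(1) by (auto intro: inj_on_subset)
  have "k44_drawing (pos ` U0) (pos ` V0) ((`) pos ` edges G) (\<lambda>e. \<gamma> (w e))"
  proof
    show "card (pos ` U0) = 4" "card (pos ` V0) = 4" using injUV UV(3,4) by (simp_all add: card_image)
    show "pos ` U0 \<inter> pos ` V0 = {}"
      using inj_on_image_Int[OF inj, of U0 V0] UV(1,2) by simp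
    show "(`) pos ` edges G = {{u, v} |u v. u \<in> pos ` U0 \<and> v \<in> pos ` V0}"
    proof (intro equalityI subsetI)
      fix e assume "e \<in> (`) pos ` edges G"
      then obtain e0 where e0: "e0 \<in> edges G" "e = pos ` e0" by blast
      then have "\<exists>u v. e0 = {u, v} \<and> u \<in> U0 \<and> v \<in> V0" by (simp only: edge_iff)
      then obtain u v where "e0 = {u, v}" "u \<in> U0" "v \<in> V0" by (elim exE conjE)
      then have "e = {pos u, pos v}" "u \<in> U0" "v \<in> V0" using e0(2) by simp_all
      then show "e \<in> {{u, v} |u v. u \<in> pos ` U0 \<and> v \<in> pos ` V0}" by blast
    next
      fix e assume "e \<in> {{u, v} |u v. u \<in> pos ` U0 \<and> v \<in> pos ` V0}"
      then obtain u v where uv: "e = {pos u, pos v}" "u \<in> U0" "v \<in> V0" by blast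
      then have "{u, v} \<in> edges G" unfolding edge_iff by blast
      then have "pos ` {u, v} \<in> (`) pos ` edges G" by (rule imageI)
      then show "e \<in> (`) pos ` edges G" using uv(1) by simp
    qed
  next
    fix e assume "e \<in> (`) pos ` edges G"
    then obtain e0 where e: "e0 \<in> edges G" "e = pos ` e0" by blast
    show "arc (\<gamma> (w e))" "{pathstart (\<gamma> (w e)), pathfinish (\<gamma> (w e))} = e"
      "path_image (\<gamma> (w e)) \<inter> (pos ` U0 \<union> pos ` V0) = e"
      unfolding e(2) w[OF e(1)] by (rule arc[OF e(1)] O[OF e(1)])+
  next
    fix e f assume ef: "e \<in> (`) pos ` edges G" "f \<in> (`) pos ` edges G"
    obtain e0 where e: "e0 \<in> edges G" "e = pos ` e0" using ef(1) by blast
    obtain f0 where f: "f0 \<in> edges G" "f = pos ` f0" using ef(2) by blast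
    show "path_image (\<gamma> (w e)) \<inter> path_image (\<gamma> (w f)) = e \<inter> f" if "e \<noteq> f" "e \<inter> f \<noteq> {}"
      using that adj[OF e(1) f(1)] unfolding e(2) f(2) w[OF e(1)] w[OF f(1)] cap[OF e(1) f(1)] by auto
    show "path_image (\<gamma> (w e)) \<inter> path_image (\<gamma> (w f)) = {} \<or> (\<exists>p. path_image (\<gamma> (w e)) \<inter> path_image (\<gamma> (w f)) = {p} \<and>
        meet_transversally_at (path_image (\<gamma> (w e))) (path_image (\<gamma> (w f))) p)" if "e \<inter> f = {}"
      using that dis[OF e(1) f(1)] unfolding e(2) f(2) w[OF e(1)] w[OF f(1)] cap[OF e(1) f(1)] by auto
    show "card {e \<in> (`) pos ` edges G. x \<in> path_image (\<gamma> (w e))} = 3"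
      if x: "x \<notin> pos ` U0 \<union> pos ` V0" "e \<noteq> f" "x \<in> path_image (\<gamma> (w e))" "x \<in> path_image (\<gamma> (w f))" for x
    proof -
      \<comment> \<open>Away from the vertices, lying on an edge and lying in its interior are the
        same, so the points considered here are crossing points in the sense of the
        definition.\<close>
      have thr: "h \<in> edges_through G pos \<gamma> x \<longleftrightarrow> h \<in> edges G \<and> x \<in> path_image (\<gamma> h)" for h
        using x(1) sub[of h] unfolding edges_through_def edge_interior_def UV(1) by blast
      have "e0 \<in> edges_through G pos \<gamma> x" "f0 \<in> edges_through G pos \<gamma> x" "e0 \<noteq> f0"
        using e f x(2-4) w thr by auto
      then have "card (edges_through G pos \<gamma> x) = 3" by (intro three) (auto simp: is_crossing_point_def)
      moreover have "{e \<in> (`) pos ` edges G. x \<in> path_image (\<gamma> (w e))} = (`) pos ` edges_through G pos \<gamma> x"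
        using w thr by auto
      moreover have "inj_on ((`) pos) (edges_through G pos \<gamma> x)"
        by (rule inj_on_inverseI[of _ w]) (use w thr in auto)
      ultimately show ?thesis by (simp add: card_image)
    qed
  qed
  then show False by (rule k44_drawing.no_drawing)
qed

end
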